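(* Let $\sigma:\Sigma\to\Sigma$ be a countable state Markov shift which satisfies the big images and pre-images (BIP) property and let $G$ be a finitely generated group with identity $e$. Let $\varphi:\Sigma\to\mathbb{R}$ be locally Hölder continuous and let $\psi:\Sigma\to G$ satisfy $\psi(x)=\psi(x_1)$, such that $\varphi$ and $\psi$ satisfy Assumptions (I), (II) and (III) (stated in the context), and let $\xi\in\mathbb{R}^d$ be the point given by Assumption (III) and $\mu^\xi$ the Gibbs measure of $\varphi+\langle\xi,f\rangle$. If $G$ is amenable then, for every $a\in S$, each of the sequences of probability measures $$\mathfrak M_\varphi(\Lambda^\psi(n)),\quad \mathfrak M_\varphi(\Lambda^\psi_a(n)),\quad \mathfrak M_\varphi(\Lambda^\psi(n,o))\ (o\in\Sigma),\quad \mathfrak M_\varphi(\Lambda^\psi_a(n,o))\ (o\in[a])$$ converges to $\mu^\xi$ as $n\to\infty$ in the weak$^*$ topology (i.e. integrals of every bounded continuous function $\Sigma\to\mathbb{R}$ converge). Here $$\Lambda^\psi(n)=\{x\in\Sigma:\sigma^nx=x,\ \psi_n(x)=e\},\qquad \Lambda^\psi_a(n)=\{x\in[a]:\sigma^nx=x,\ \psi_n(x)=e\},$$ $$\Lambda^\psi(n,o)=\{x\in\Sigma:\sigma^nx=o,\ \psi_n(x)=e\},\qquad \Lambda^\psi_a(n,o)=\{x\in[a]:\sigma^nx=o,\ \psi_n(x)=e\}.$$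
   Context: Countable state Markov shift: $S$ is a countable set, $A$ an $S\times S$ matrix with entries in $\{0,1\}$, $\Sigma=\{x=(x_i)_{i=1}^\infty: x_i\in S,\ A(x_i,x_{i+1})=1\ \forall i\ge1\}$ with the topology generated by cylinders, $(\sigma x)_i=x_{i+1}$. $\mathcal W_n$ is the set of allowed words $w=(w_1,\dots,w_n)$ ($A(w_i,w_{i+1})=1$), $[w]=\{x\in\Sigma:x_i=w_i,\ 1\le i\le n\}$. BIP: there exist $b_1,\dots,b_N\in S$ such that for all $a\in S$ there are $i,j$ with $A(b_i,a)=1$ and $A(a,b_j)=1$. A countable state Markov shift is topologically mixing if for all states $a,b$ there is $N(a,b)$ such that for every $n\ge N(a,b)$ there is an allowed word $w$ of length $n$ with $awb$ allowed. $\varphi$ is locally Hölder continuous if $\sup_{w\in\mathcal W_n}\sup_{x,y\in[w]}|\varphi(x)-\varphi(y)|\le C\theta^n$ for all $n\ge1$, for some $C>0$, $0<\theta<1$. It is summable if $\sup_{x\in\Sigma}\sum_{\sigma y=x}e^{\varphi(y)}<\infty$. Write $\varphi^n=\sum_{j=0}^{n-1}\varphi\circ\sigma^j$, $\psi_n(x)=\psi(x)\psi(\sigma x)\cdots\psi(\sigma^{n-1}x)$. $T_\psi(x,g)=(\sigma x,g\psi(x))$ on $\Sigma\times G$ is a countable state Markov shift with states $S\times G$, a transition $(i,g)\to(j,h)$ being allowed iff $A(i,j)=1$ and $h=g\psi(i)$. $\overline G\cong\mathbb{Z}^d$ is the quotient of the abelianization of $G$ by its torsion subgroup, $\pi:G\to\overline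 G$ the projection, and $f:=\pi\circ\psi:\Sigma\to\mathbb{Z}^d$ (identifying $\overline G$ with $\mathbb{Z}^d$). Gurevič pressure: $P_{\mathrm G}(\varphi,\sigma)=\limsup_{n\to\infty}\frac1n\log\sum_{\sigma^nx=x,\ x_1=a}e^{\varphi^n(x)}$ (independent of $a\in S$). When $\sigma$ is topologically mixing with BIP and $\varphi$ is locally Hölder and summable, there is a unique Gibbs measure $\mu_\varphi$ for $\varphi$: a $\sigma$-invariant probability measure for which there are constants $A',B'>0$ with $A'\le\mu_\varphi([w])/e^{\varphi^n(x)-nP_{\mathrm G}(\varphi,\sigma)}\le B'$ for all $n\ge1$, $w\in\mathcal W_n$, $x\in[w]$. Let $\delta=\delta(\varphi,f)=\sup\{r\ge0:\varphi+r|f|\text{ is summable}\}$ ($|\cdot|$ the 2-norm on $\mathbb{R}^d$), $B(\delta)=\{w\in\mathbb{R}^d:|w|<\delta\}$, and $\mathfrak p(w)=P_{\mathrm G}(\varphi+\langle w,f\rangle,\sigma)$ (finite on $B(\delta)$). Assumption (I): $T_\psi$ is topologically mixing. Assumption (II): $\delta(\varphi,f)>0$. Assumption (III): $w\mapsto\mathfrak p(w)$ has a unique minimum at a point $\xi\in\mathrm{int}(B(\delta))$. Put $\mu^\xi=\mu_{\varphi+\langle\xi,f\rangle}$. With $\delta_x$ the Dirac measure, $\tau_{x,n}=\frac1n\sum_{j=0}^{n-1}\delta_{\sigma^jx}$. For countable $\Lambda_n\subset\Sigma$ (nonempty), $\Pi_\varphi(\Lambda_n)=\sum_{x\in\Lambda_n}e^{\varphi^n(x)}$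 and $\mathfrak M_\varphi(\Lambda_n)=\Pi_\varphi(\Lambda_n)^{-1}\sum_{x\in\Lambda_n}e^{\varphi^n(x)}\tau_{x,n}$. The sets $\Lambda_n$ in the theorem are nonempty for all large $n$, and the limits are taken over such $n$. *)

theory Defs
  imports
    "HOL-Analysis.Analysis"
    "HOL-Probability.Giry_Monad"
    "HOL-Algebra.Generated_Groups"
    "HOL-Algebra.Elementary_Groups"
    "HOL-Algebra.Product_Groups"
begin

section \<open>Countable state Markov shifts\<close>

text \<open>
  A shift is given by a state set \<open>S\<close> and a \<open>{0,1}\<close>-matrix on \<open>S\<close>, encoded as a relation
  \<open>A\<close>. Sequences are indexed from \<open>0\<close>, so \<open>x 0\<close> is the first letter of \<open>x\<close>.
\<close>

definition markov_shift :: "'s set \<Rightarrow> ('s \<Rightarrow> 's \<Rightarrow> bool) \<Rightarrow> (nat \<Rightarrow> 's) set" where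
  "markov_shift S A = {x. \<forall>i. x i \<in> S \<and> A (x i) (x (Suc i))}"

definition left_shift :: "(nat \<Rightarrow> 's) \<Rightarrow> nat \<Rightarrow> 's" where
  "left_shift x = (\<lambda>i. x (Suc i))"

definition allowed_words :: "'s set \<Rightarrow> ('s \<Rightarrow> 's \<Rightarrow> bool) \<Rightarrow> nat \<Rightarrow> 's list set" where
  "allowed_words S A n = {w. length w = n \<and> set w \<subseteq> S \<and> successively A w}"

definition cylinder :: "'s set \<Rightarrow> ('s \<Rightarrow> 's \<Rightarrow> bool) \<Rightarrow> 's list \<Rightarrow> (nat \<Rightarrow> 's) set" where
  "cylinder S A w = {x \<in> markov_shift S A. \<forall>i<length w. x i = w ! i}"

definition shift_topology :: "'s set \<Rightarrow> ('s \<Rightarrow> 's \<Rightarrow> bool) \<Rightarrow> (nat \<Rightarrow> 's) topology" where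
  "shift_topology S A =
     topology_generated_by {cylinder S A w | n w. n \<ge> 1 \<and> w \<in> allowed_words S A n}"

definition shift_borel :: "'s set \<Rightarrow> ('s \<Rightarrow> 's \<Rightarrow> bool) \<Rightarrow> (nat \<Rightarrow> 's) measure" where
  "shift_borel S A = sigma (markov_shift S A) {U. openin (shift_topology S A) U}"

definition BIP :: "'s set \<Rightarrow> ('s \<Rightarrow> 's \<Rightarrow> bool) \<Rightarrow> bool" where
  "BIP S A \<longleftrightarrow> (\<exists>B. finite B \<and> B \<subseteq> S \<and> (\<forall>a\<in>S. \<exists>b\<in>B. \<exists>c\<in>B. A b a \<and> A a c))"

definition topologically_mixing :: "'s set \<Rightarrow> ('s \<Rightarrow> 's \<Rightarrow> bool) \<Rightarrow> bool" where
  "topologically_mixing S A \<longleftrightarrow>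
     (\<forall>a\<in>S. \<forall>b\<in>S. \<exists>N. \<forall>n\<ge>N. \<exists>w \<in> allowed_words S A n. successively A (a # w @ [b]))"


section \<open>Potentials, pressure and Gibbs measures\<close>

definition birkhoff :: "((nat \<Rightarrow> 's) \<Rightarrow> real) \<Rightarrow> nat \<Rightarrow> (nat \<Rightarrow> 's) \<Rightarrow> real" where
  "birkhoff \<phi> n x = (\<Sum>j<n. \<phi> ((left_shift ^^ j) x))"

definition locally_Holder ::
    "'s set \<Rightarrow> ('s \<Rightarrow> 's \<Rightarrow> bool) \<Rightarrow> ((nat \<Rightarrow> 's) \<Rightarrow> real) \<Rightarrow> bool" where
  "locally_Holder S A \<phi> \<longleftrightarrow>
     (\<exists>C>0. \<exists>\<theta>. 0 < \<theta> \<and> \<theta> < 1 \<and>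
        (\<forall>n\<ge>1. \<forall>w \<in> allowed_words S A n. \<forall>x \<in> cylinder S A w. \<forall>y \<in> cylinder S A w.
           \<bar>\<phi> x - \<phi> y\<bar> \<le> C * \<theta> ^ n))"

definition summable_potential ::
    "'s set \<Rightarrow> ('s \<Rightarrow> 's \<Rightarrow> bool) \<Rightarrow> ((nat \<Rightarrow> 's) \<Rightarrow> real) \<Rightarrow> bool" where
  "summable_potential S A \<phi> \<longleftrightarrow>
     (SUP x \<in> markov_shift S A.
        \<Sum>\<^sub>\<infinity> y \<in> {y \<in> markov_shift S A. left_shift y = x}. ennreal (exp (\<phi> y))) < \<infinity>"

definition ext_ln :: "ennreal \<Rightarrow> ereal" where
  "ext_ln t = (if t = 0 then -\<infinity> else if t = \<infinity> then \<infinity> else ereal (ln (enn2real t)))"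

text \<open>
  The reference state \<open>a\<close> is kept as an argument; for the shifts considered (topologically mixing,
  locally Hoelder potential) the value does not depend on it.
\<close>

definition Gurevich_pressure ::
    "'s set \<Rightarrow> ('s \<Rightarrow> 's \<Rightarrow> bool) \<Rightarrow> 's \<Rightarrow> ((nat \<Rightarrow> 's) \<Rightarrow> real) \<Rightarrow> ereal" where
  "Gurevich_pressure S A a \<phi> =
     limsup (\<lambda>n. ext_ln (\<Sum>\<^sub>\<infinity> x \<in> {x \<in> markov_shift S A. (left_shift ^^ n) x = x \<and> x 0 = a}.
                             ennreal (exp (birkhoff \<phi> n x))) / ereal (real n))"

definition Gibbs_measure ::
    "'s set \<Rightarrow> ('s \<Rightarrow> 's \<Rightarrow> bool) \<Rightarrow> 's \<Rightarrow> ((nat \<Rightarrow> 's) \<Rightarrow> real) \<Rightarrow> (nat \<Rightarrow> 's) measure \<Rightarrow> bool" where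
  "Gibbs_measure S A a \<phi> \<mu> \<longleftrightarrow>
     sets \<mu> = sets (shift_borel S A) \<and> prob_space \<mu> \<and> distr \<mu> \<mu> left_shift = \<mu> \<and>
     (\<exists>P::real. Gurevich_pressure S A a \<phi> = ereal P \<and>
        (\<exists>A'>0. \<exists>B'>0. \<forall>n\<ge>1. \<forall>w \<in> allowed_words S A n. \<forall>x \<in> cylinder S A w.
           A' \<le> measure \<mu> (cylinder S A w) / exp (birkhoff \<phi> n x - real n * P) \<and>
           measure \<mu> (cylinder S A w) / exp (birkhoff \<phi> n x - real n * P) \<le> B'))"


section \<open>Groups\<close>

definition finitely_generated :: "('g, 'm) monoid_scheme \<Rightarrow> bool" where
  "finitely_generated G \<longleftrightarrow> (\<exists>K. finite K \<and> K \<subseteq> carrier G \<and> generate G K = carrier G)"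

text \<open>Amenability of a discrete group: a finitely additive left-invariant probability on all subsets.\<close>

definition amenable :: "('g, 'm) monoid_scheme \<Rightarrow> bool" where
  "amenable G \<longleftrightarrow>
     (\<exists>m :: 'g set \<Rightarrow> real.
        m (carrier G) = 1 \<and>
        (\<forall>E \<subseteq> carrier G. 0 \<le> m E) \<and>
        (\<forall>E \<subseteq> carrier G. \<forall>F \<subseteq> carrier G. E \<inter> F = {} \<longrightarrow> m (E \<union> F) = m E + m F) \<and>
        (\<forall>g \<in> carrier G. \<forall>E \<subseteq> carrier G. m (g <#\<^bsub>G\<^esub> E) = m E))"

definition abelianization :: "('g, 'm) monoid_scheme \<Rightarrow> 'g set monoid" where
  "abelianization G = G Mod (derived G (carrier G))"

definition torsion_part :: "('g, 'm) monoid_scheme \<Rightarrow> 'g set" where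
  "torsion_part H = {x \<in> carrier H. \<exists>n::nat. n > 0 \<and> x [^]\<^bsub>H\<^esub> n = \<one>\<^bsub>H\<^esub>}"

definition free_abelianization :: "('g, 'm) monoid_scheme \<Rightarrow> 'g set set monoid" where
  "free_abelianization G = abelianization G Mod torsion_part (abelianization G)"

definition free_ab_proj :: "('g, 'm) monoid_scheme \<Rightarrow> 'g \<Rightarrow> 'g set set" where
  "free_ab_proj G g =
     torsion_part (abelianization G) #>\<^bsub>abelianization G\<^esub> (derived G (carrier G) #>\<^bsub>G\<^esub> g)"

abbreviation int_lattice :: "nat \<Rightarrow> (nat \<Rightarrow> int) monoid" where
  "int_lattice d \<equiv> product_group {..<d} (\<lambda>_. integer_group)"


section \<open>Group extensions\<close>

text \<open>
  The map \<open>\<psi>\<close> on the shift depends only on the first letter, hence is given as a function of a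
  state, its value at the point \<open>x\<close> being \<open>\<psi> (x 0)\<close>.
\<close>

definition skew_transition ::
    "('s \<Rightarrow> 's \<Rightarrow> bool) \<Rightarrow> ('g, 'm) monoid_scheme \<Rightarrow> ('s \<Rightarrow> 'g) \<Rightarrow> 's \<times> 'g \<Rightarrow> 's \<times> 'g \<Rightarrow> bool" where
  "skew_transition A G \<psi> p q \<longleftrightarrow> A (fst p) (fst q) \<and> snd q = snd p \<otimes>\<^bsub>G\<^esub> \<psi> (fst p)"

primrec cocycle ::
    "('g, 'm) monoid_scheme \<Rightarrow> ('s \<Rightarrow> 'g) \<Rightarrow> nat \<Rightarrow> (nat \<Rightarrow> 's) \<Rightarrow> 'g" where
  "cocycle G \<psi> 0 x = \<one>\<^bsub>G\<^esub>"
| "cocycle G \<psi> (Suc n) x = cocycle G \<psi> n x \<otimes>\<^bsub>G\<^esub> \<psi> ((left_shift ^^ n) x 0)"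

text \<open>
  Points of \<open>\<real>\<^sup>d\<close> are functions on \<open>nat\<close> of which only the coordinates \<open>i < d\<close> matter; the space
  itself is the library's \<^const>\<open>Euclidean_space\<close>, which unlike a type-indexed space admits
  \<open>d = 0\<close>. The argument \<open>\<iota>\<close> is the identification of the torsion-free abelianization
  with \<open>\<int>\<^sup>d\<close>.
\<close>

definition lattice_map ::
    "('g, 'm) monoid_scheme \<Rightarrow> ('g set set \<Rightarrow> nat \<Rightarrow> int) \<Rightarrow> ('s \<Rightarrow> 'g) \<Rightarrow> (nat \<Rightarrow> 's) \<Rightarrow> nat \<Rightarrow> real" where
  "lattice_map G \<iota> \<psi> x = (\<lambda>i. real_of_int (\<iota> (free_ab_proj G (\<psi> (x 0))) i))"

definition norm_d :: "nat \<Rightarrow> (nat \<Rightarrow> real) \<Rightarrow> real" where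
  "norm_d d v = L2_set v {..<d}"

definition inner_d :: "nat \<Rightarrow> (nat \<Rightarrow> real) \<Rightarrow> (nat \<Rightarrow> real) \<Rightarrow> real" where
  "inner_d d v w = (\<Sum>i<d. v i * w i)"

definition tilt ::
    "nat \<Rightarrow> ((nat \<Rightarrow> 's) \<Rightarrow> real) \<Rightarrow> ((nat \<Rightarrow> 's) \<Rightarrow> nat \<Rightarrow> real) \<Rightarrow> (nat \<Rightarrow> real) \<Rightarrow> (nat \<Rightarrow> 's) \<Rightarrow> real" where
  "tilt d \<phi> f w = (\<lambda>x. \<phi> x + inner_d d w (f x))"

definition summability_radius ::
    "'s set \<Rightarrow> ('s \<Rightarrow> 's \<Rightarrow> bool) \<Rightarrow> nat \<Rightarrow> ((nat \<Rightarrow> 's) \<Rightarrow> real) \<Rightarrow> ((nat \<Rightarrow> 's) \<Rightarrow> nat \<Rightarrow> real) \<Rightarrow> ereal" where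
  "summability_radius S A d \<phi> f =
     Sup {ereal r | r. r \<ge> 0 \<and> summable_potential S A (\<lambda>x. \<phi> x + r * norm_d d (f x))}"

definition ball_d :: "nat \<Rightarrow> ereal \<Rightarrow> (nat \<Rightarrow> real) set" where
  "ball_d d \<delta> = {w \<in> topspace (Euclidean_space d). ereal (norm_d d w) < \<delta>}"

definition unique_minimum_on :: "'v set \<Rightarrow> ('v \<Rightarrow> 'b::linorder) \<Rightarrow> 'v \<Rightarrow> bool" where
  "unique_minimum_on D p \<xi> \<longleftrightarrow> \<xi> \<in> D \<and> (\<forall>w\<in>D. w \<noteq> \<xi> \<longrightarrow> p \<xi> < p w)"


section \<open>Weighted averages of empirical measures\<close>

definition empirical_measure ::
    "'s set \<Rightarrow> ('s \<Rightarrow> 's \<Rightarrow> bool) \<Rightarrow> nat \<Rightarrow> (nat \<Rightarrow> 's) \<Rightarrow> (nat \<Rightarrow> 's) measure" where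
  "empirical_measure S A n x =
     measure_of (markov_shift S A) (sets (shift_borel S A))
       (\<lambda>E. (\<Sum>j<n. emeasure (return (shift_borel S A) ((left_shift ^^ j) x)) E) / of_nat n)"

definition partition_sum :: "((nat \<Rightarrow> 's) \<Rightarrow> real) \<Rightarrow> nat \<Rightarrow> (nat \<Rightarrow> 's) set \<Rightarrow> ennreal" where
  "partition_sum \<phi> n \<Lambda> = (\<Sum>\<^sub>\<infinity> x \<in> \<Lambda>. ennreal (exp (birkhoff \<phi> n x)))"

definition averaged_measure ::
    "'s set \<Rightarrow> ('s \<Rightarrow> 's \<Rightarrow> bool) \<Rightarrow> ((nat \<Rightarrow> 's) \<Rightarrow> real) \<Rightarrow> nat \<Rightarrow> (nat \<Rightarrow> 's) set \<Rightarrow> (nat \<Rightarrow> 's) measure" where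
  "averaged_measure S A \<phi> n \<Lambda> =
     measure_of (markov_shift S A) (sets (shift_borel S A))
       (\<lambda>E. (\<Sum>\<^sub>\<infinity> x \<in> \<Lambda>. ennreal (exp (birkhoff \<phi> n x)) * emeasure (empirical_measure S A n x) E)
              / partition_sum \<phi> n \<Lambda>)"

text \<open>
  If \<open>\<Lambda> n\<close> is empty then \<open>averaged_measure S A \<phi> n (\<Lambda> n)\<close> is the zero measure. The limit
  below is along all \<open>n\<close>; taking \<open>h = 1\<close>, convergence to a probability measure therefore includes
  the assertion that \<open>\<Lambda> n\<close> is nonempty for all large \<open>n\<close>.
\<close>

definition weak_star_converges ::
    "'s set \<Rightarrow> ('s \<Rightarrow> 's \<Rightarrow> bool) \<Rightarrow> (nat \<Rightarrow> (nat \<Rightarrow> 's) measure) \<Rightarrow> (nat \<Rightarrow> 's) measure \<Rightarrow> bool" where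
  "weak_star_converges S A M \<mu> \<longleftrightarrow>
     (\<forall>h :: (nat \<Rightarrow> 's) \<Rightarrow> real.
        continuous_map (shift_topology S A) euclideanreal h \<and> bounded (h ` markov_shift S A) \<longrightarrow>
        (\<lambda>n. \<integral>x. h x \<partial>M n) \<longlonglongrightarrow> (\<integral>x. h x \<partial>\<mu>))"

end

theory Submission
  imports Defs
begin

text \<open>
  On the sets in question \<open>\<psi>\<^sub>n = 1\<close>, so the weights \<open>exp (\<phi>\<^sup>n)\<close> agree with those of
  \<open>\<Phi> = \<phi> + \<langle>\<xi>, f\<rangle>\<close>, whose Gibbs measure is \<open>\<mu>\<close>. Empirical averages of a cylinder that
  deviate from its \<open>\<mu>\<close>-measure carry exponentially less weight than \<open>exp (n P)\<close>, where \<open>P\<close> is the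
  pressure of \<open>\<Phi>\<close>: a Gibbs measure is quasi-Bernoulli, and this multiplies the small
  probability of a bad long block. It remains to see that the total weight of the return words with
  \<open>\<psi>\<^sub>n = 1\<close> grows no slower than \<open>exp (n P)\<close>. If it grew more slowly than \<open>exp (n s)\<close> with \<open>s < P\<close>,
  the Green function \<open>h g = \<Sum>\<^sub>n exp (- n s) Z\<^sub>n g\<close> on \<open>G\<close> would be finite and superharmonic with
  bounded ratios \<open>h (g \<gamma>) / h g\<close>. An invariant mean of the logarithms of these ratios is a
  homomorphism \<open>G \<rightarrow> \<real>\<close>, that is, \<open>\<gamma> \<mapsto> \<langle>w, \<pi> \<gamma>\<rangle>\<close>, and Jensen's inequality bounds the pressure
  at \<open>w\<close> by \<open>s\<close>. Convexity of the pressure and the minimum at \<open>\<xi>\<close> give \<open>P \<le> s\<close>.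
\<close>

section \<open>Points, cylinders and the Borel structure of the shift\<close>

text \<open>The alphabet may be infinite, so a sum over words may diverge. Such sums are handled
  through finite partial sums or with extended nonnegative values. A word is represented by a point
  that begins with it; bounded distortion limits the effect of the tail to a factor
  \<open>exp D\<close>, so that periodic points, preimages of \<open>o\<close> and arbitrary
  representatives can replace one another.

  Deviating words lose a full exponential rate, so a lower bound for the return mass at every rate
  below \<open>P\<close> is enough, and subexponential errors are harmless.

  That a long block is rarely bad is a form of ergodicity. Von Neumann's argument makes long ergodic
  averages close to one another in L2. The lower product bound for a Gibbs measure then forbids them
  to be clearly positive on one set and clearly negative on another, both of substantial measure: an
  average would otherwise often disagree with a much longer one.

  The character obtained from the mean has no a priori size, so its vector \<open>w\<close> need not
  lie in the ball on which the minimum is assumed.\<close>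

lemma left_shift_funpow: "(left_shift ^^ n) x = (\<lambda>i. x (i + n))"
  by (induction n arbitrary: x) (auto simp: left_shift_def funpow_swap1)

lemma left_shift_funpow_add: "(left_shift ^^ n) ((left_shift ^^ m) x) = (left_shift ^^ (m + n)) x"
  by (simp add: left_shift_funpow ac_simps)

lemma left_shift_funpow_in:
  "x \<in> markov_shift S A \<Longrightarrow> (left_shift ^^ n) x \<in> markov_shift S A"
  by (auto simp: left_shift_funpow markov_shift_def)

section \<open>Gluing and periodizing points\<close>

definition graft :: "nat \<Rightarrow> (nat \<Rightarrow> 's) \<Rightarrow> (nat \<Rightarrow> 's) \<Rightarrow> nat \<Rightarrow> 's" where
  "graft n x y = (\<lambda>i. if i < n then x i else y (i - n))"

definition periodize :: "nat \<Rightarrow> (nat \<Rightarrow> 's) \<Rightarrow> nat \<Rightarrow> 's" where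
  "periodize n x = (\<lambda>i. x (i mod n))"

lemma graft_less [simp]: "i < n \<Longrightarrow> graft n x y i = x i"
  by (simp add: graft_def)

lemma left_shift_graft [simp]: "(left_shift ^^ n) (graft n x y) = y"
  by (auto simp: left_shift_funpow graft_def)

text \<open>Only the first \<open>n\<close> steps of \<open>x\<close> are required to be admissible,
  so a finite path, encoded as a function with arbitrary later values, can be continued by a point
  of the shift.\<close>

lemma graft_path:
  assumes "\<And>i. i < n \<Longrightarrow> x i \<in> S \<and> A (x i) (x (Suc i))" "y \<in> markov_shift S A" "x n = y 0"
  shows "graft n x y \<in> markov_shift S A"
proof -
  have "graft n x y i \<in> S \<and> A (graft n x y i) (graft n x y (Suc i))" for i
  proof (cases "i < n")
    case True
    then have "graft n x y (Suc i) = x (Suc i)"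
      using assms(3) by (cases "Suc i = n") (auto simp: graft_def)
    then show ?thesis using True assms by (auto simp: graft_def)
  next
    case False
    then show ?thesis using assms(2) by (auto simp: markov_shift_def graft_def Suc_diff_le)
  qed
  then show ?thesis by (auto simp: markov_shift_def)
qed

lemma graft_in:
  assumes "x \<in> markov_shift S A" "y \<in> markov_shift S A" "x n = y 0"
  shows "graft n x y \<in> markov_shift S A"
  by (rule graft_path) (use assms in \<open>auto simp: markov_shift_def\<close>)

lemma graft_0: "x n = y 0 \<Longrightarrow> graft n x y 0 = x 0"
  by (cases n) (auto simp: graft_def)

lemma periodize_less [simp]: "i < n \<Longrightarrow> periodize n x i = x i"
  by (simp add: periodize_def)

lemma left_shift_periodize [simp]: "(left_shift ^^ n) (periodize n x) = periodize n x"
  by (auto simp: left_shift_funpow periodize_def)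

lemma periodize_path:
  assumes "\<And>i. i < n \<Longrightarrow> x i \<in> S \<and> A (x i) (x (Suc i))" "x n = x 0" "n \<ge> 1"
  shows "periodize n x \<in> markov_shift S A"
proof -
  have "x (Suc i mod n) = x (Suc (i mod n))" for i
    using assms(2) by (cases "Suc (i mod n) = n") (auto simp: mod_Suc)
  moreover have "i mod n < n" for i using assms(3) by simp
  ultimately show ?thesis
    using assms(1) by (auto simp: markov_shift_def periodize_def)
qed

lemma periodize_in:
  assumes "x \<in> markov_shift S A" "x n = x 0" "n \<ge> 1"
  shows "periodize n x \<in> markov_shift S A"
  by (rule periodize_path) (use assms in \<open>auto simp: markov_shift_def\<close>)

text \<open>A point of period \<open>n\<close> repeats its first \<open>n\<close> letters. Like the
  analogue for preimages after it, this turns sums over points into sums over words. Period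
  \<open>0\<close> would impose no condition, hence \<open>n \<ge> 1\<close>.\<close>

lemma periodic_eqI:
  assumes "(left_shift ^^ n) x = x" "(left_shift ^^ n) y = y" "n \<ge> 1" "\<And>i. i < n \<Longrightarrow> x i = y i"
  shows "x = y"
proof
  have *: "z i = z (i mod n)" if "(left_shift ^^ n) z = z" for z :: "nat \<Rightarrow> 'a" and i
  proof -
    have 1: "z (j + n) = z j" for j using that by (metis left_shift_funpow)
    have "z (j + n * k) = z j" for j k
    proof (induction k)
      case (Suc k)
      then show ?case using 1[of "j + n * k"] by (simp add: algebra_simps)
    qed simp
    then show ?thesis by (metis mod_mult_div_eq)
  qed
  show "x i = y i" for i
    using *[OF assms(1)] *[OF assms(2)] assms(3,4) by (metis mod_less_divisor less_le_trans zero_less_one)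
qed

lemma preimage_eqI:
  assumes "(left_shift ^^ n) x = z" "(left_shift ^^ n) y = z" "\<And>i. i < n \<Longrightarrow> x i = y i"
  shows "x = y"
proof
  show "x i = y i" for i
    using assms fun_cong[of _ _ "i - n"] by (cases "i < n") (auto simp: left_shift_funpow fun_eq_iff, metis le_add_diff_inverse2 not_less)
qed

section \<open>Birkhoff sums and bounded distortion\<close>

lemma birkhoff_add:
  "birkhoff \<phi> (n + m) x = birkhoff \<phi> n x + birkhoff \<phi> m ((left_shift ^^ n) x)"
proof -
  have "birkhoff \<phi> (n + m) x = (\<Sum>j<n. \<phi> ((left_shift ^^ j) x)) + (\<Sum>j\<in>{n..<n+m}. \<phi> ((left_shift ^^ j) x))"
    unfolding birkhoff_def by (simp add: lessThan_atLeast0 sum.atLeastLessThan_concat)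
  also have "(\<Sum>j\<in>{n..<n+m}. \<phi> ((left_shift ^^ j) x)) = (\<Sum>j<m. \<phi> ((left_shift ^^ (n + j)) x))"
    by (rule sum.reindex_bij_witness[of _ "\<lambda>j. n + j" "\<lambda>j. j - n"]) auto
  finally show ?thesis unfolding birkhoff_def by (simp only: left_shift_funpow_add)
qed

text \<open>After \<open>j\<close> steps the two points still share \<open>n - j\<close> letters, so
  the differences decay geometrically towards the start of the word and their sum is bounded
  independently of \<open>n\<close>.\<close>

lemma locally_Holder_distortion:
  assumes "locally_Holder S A \<phi>"
  obtains D where "D \<ge> 0"
    "\<And>n x y. \<lbrakk>x \<in> markov_shift S A; y \<in> markov_shift S A; \<And>i. i < n \<Longrightarrow> x i = y i\<rbrakk>
       \<Longrightarrow> \<bar>birkhoff \<phi> n x - birkhoff \<phi> n y\<bar> \<le> D"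
proof -
  obtain C \<theta> where C: "C > 0" "0 < \<theta>" "\<theta> < 1" and
    H: "\<And>n w x y. \<lbrakk>n \<ge> 1; w \<in> allowed_words S A n; x \<in> cylinder S A w; y \<in> cylinder S A w\<rbrakk>
          \<Longrightarrow> \<bar>\<phi> x - \<phi> y\<bar> \<le> C * \<theta> ^ n"
    using assms unfolding locally_Holder_def by meson
  show ?thesis
  proof (rule that[of "C / (1 - \<theta>)"])
    show "0 \<le> C / (1 - \<theta>)" using C by simp
    fix n and x y :: "nat \<Rightarrow> 'a"
    assume x: "x \<in> markov_shift S A" and y: "y \<in> markov_shift S A" and eq: "\<And>i. i < n \<Longrightarrow> x i = y i"
    have one: "\<bar>\<phi> ((left_shift ^^ j) x) - \<phi> ((left_shift ^^ j) y)\<bar> \<le> C * \<theta> ^ (n - Suc j)" if "j < n" for j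
    proof -
      let ?w = "map x [j..<n]"
      have "?w \<in> allowed_words S A (n - j)"
        using x by (auto simp: allowed_words_def markov_shift_def successively_conv_nth)
      moreover have "(left_shift ^^ j) x \<in> cylinder S A ?w" "(left_shift ^^ j) y \<in> cylinder S A ?w"
        using left_shift_funpow_in[OF x, of j] left_shift_funpow_in[OF y, of j] eq
        by (auto simp: cylinder_def left_shift_funpow add.commute[of j])
      ultimately have "\<bar>\<phi> ((left_shift ^^ j) x) - \<phi> ((left_shift ^^ j) y)\<bar> \<le> C * \<theta> ^ (n - j)"
        using H[of "n - j"] that by simp
      \<comment> \<open>With the exponent lowered by one, reversing the order of summation gives the
        geometric sum over \<open>j < n\<close>.\<close>
      also have "\<dots> \<le> C * \<theta> ^ (n - Suc j)"
        using C by (intro mult_left_mono power_decreasing) auto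
      finally show ?thesis .
    qed
    have "\<bar>birkhoff \<phi> n x - birkhoff \<phi> n y\<bar> \<le> (\<Sum>j<n. C * \<theta> ^ (n - Suc j))"
      unfolding birkhoff_def sum_subtractf[symmetric]
      by (rule order_trans[OF sum_abs]) (auto intro!: sum_mono one)
    also have "\<dots> = C * (\<Sum>j<n. \<theta> ^ j)"
      by (simp add: sum_distrib_left[symmetric] sum.nat_diff_reindex[of "\<lambda>j. \<theta> ^ j"])
    also have "(\<Sum>j<n. \<theta> ^ j) = (1 - \<theta> ^ n) / (1 - \<theta>)"
      using C by (simp add: sum_gp_strict)
    also have "C * ((1 - \<theta> ^ n) / (1 - \<theta>)) \<le> C * (1 / (1 - \<theta>))"
      using C by (intro mult_left_mono divide_right_mono) auto
    finally show "\<bar>birkhoff \<phi> n x - birkhoff \<phi> n y\<bar> \<le> C / (1 - \<theta>)" by simp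
  qed
qed

section \<open>Cylinders as a base of the topology\<close>

lemma prefix_allowed:
  "x \<in> markov_shift S A \<Longrightarrow> map x [0..<n] \<in> allowed_words S A n"
  by (auto simp: allowed_words_def markov_shift_def successively_conv_nth)

lemma mem_cylinder_prefix:
  "y \<in> cylinder S A (map x [0..<n]) \<longleftrightarrow> y \<in> markov_shift S A \<and> (\<forall>i<n. y i = x i)"
  by (auto simp: cylinder_def)

lemma cylinder_eq_prefix:
  "y \<in> cylinder S A w \<Longrightarrow> w = map y [0..<length w]"
  by (auto simp: cylinder_def intro!: nth_equalityI)

text \<open>Cylinders around a common point are nested, so the generating family is already a base.
  On the right \<open>n = 0\<close> is harmless: lengthening the prefix only shrinks the
  cylinder.\<close>

lemma openin_shift_topology:
  "openin (shift_topology S A) U \<longleftrightarrow>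
     U \<subseteq> markov_shift S A \<and> (\<forall>x\<in>U. \<exists>n. cylinder S A (map x [0..<n]) \<subseteq> U)"
proof
  assume "openin (shift_topology S A) U"
  then have "generate_topology_on {cylinder S A w | n w. n \<ge> 1 \<and> w \<in> allowed_words S A n} U"
    by (simp add: shift_topology_def openin_topology_generated_by_iff)
  then show "U \<subseteq> markov_shift S A \<and> (\<forall>x\<in>U. \<exists>n. cylinder S A (map x [0..<n]) \<subseteq> U)"
  proof induction
    case Empty
    then show ?case by simp
  next
    case (Int a b)
    show ?case
    proof (intro conjI ballI)
      fix x assume "x \<in> a \<inter> b"
      then obtain n m where "cylinder S A (map x [0..<n]) \<subseteq> a" "cylinder S A (map x [0..<m]) \<subseteq> b"
        using Int.IH by blast
      then have "cylinder S A (map x [0..<max n m]) \<subseteq> a \<inter> b"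
        unfolding subset_iff mem_cylinder_prefix by auto
      then show "\<exists>n. cylinder S A (map x [0..<n]) \<subseteq> a \<inter> b" by blast
    qed (use Int.IH in blast)
  next
    case (UN K)
    show ?case
    proof (intro conjI ballI)
      show "\<Union> K \<subseteq> markov_shift S A" using UN.IH by (intro Union_least) simp
      fix x assume "x \<in> \<Union> K"
      then obtain k where k: "k \<in> K" "x \<in> k" by auto
      then obtain n where "cylinder S A (map x [0..<n]) \<subseteq> k" using UN.IH[OF k(1)] by auto
      then show "\<exists>n. cylinder S A (map x [0..<n]) \<subseteq> \<Union> K" using k(1) by (intro exI[of _ n]) auto
    qed
  next
    case (Basis s)
    then obtain w where w: "s = cylinder S A w" by blast
    have c: "cylinder S A (map x [0..<length w]) \<subseteq> s" if "x \<in> s" for x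
      using cylinder_eq_prefix[of x S A w] that w by (metis order_refl)
    have "s \<subseteq> markov_shift S A" by (auto simp: w cylinder_def)
    then show ?case using c by metis
  qed
next
  assume U: "U \<subseteq> markov_shift S A \<and> (\<forall>x\<in>U. \<exists>n. cylinder S A (map x [0..<n]) \<subseteq> U)"
  have "\<exists>n\<ge>1. cylinder S A (map x [0..<n]) \<subseteq> U" if x: "x \<in> U" for x
  proof -
    obtain n where "cylinder S A (map x [0..<n]) \<subseteq> U"
      using U x by blast
    then have "cylinder S A (map x [0..<Suc n]) \<subseteq> U"
      unfolding subset_iff mem_cylinder_prefix by auto
    then show ?thesis by (intro exI[of _ "Suc n"]) auto
  qed
  then obtain n where n: "\<And>x. x \<in> U \<Longrightarrow> n x \<ge> 1" "\<And>x. x \<in> U \<Longrightarrow> cylinder S A (map x [0..<n x]) \<subseteq> U"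
    by metis
  have "U = \<Union>((\<lambda>x. cylinder S A (map x [0..<n x])) ` U)"
    using n U by (auto simp: mem_cylinder_prefix)
  moreover have "openin (shift_topology S A) (\<Union>((\<lambda>x. cylinder S A (map x [0..<n x])) ` U))"
  proof (intro openin_Union, safe)
    fix x assume "x \<in> U"
    then have "cylinder S A (map x [0..<n x]) \<in> {cylinder S A w | n w. n \<ge> 1 \<and> w \<in> allowed_words S A n}"
      using n U prefix_allowed[of x S A "n x"] by blast
    then show "openin (shift_topology S A) (cylinder S A (map x [0..<n x]))"
      unfolding shift_topology_def openin_topology_generated_by_iff by (rule generate_topology_on.Basis)
  qed
  ultimately show "openin (shift_topology S A) U" by simp
qed

lemma topspace_shift_topology [simp]: "topspace (shift_topology S A) = markov_shift S A"
proof
  show "topspace (shift_topology S A) \<subseteq> markov_shift S A"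
    using openin_shift_topology openin_topspace by blast
  have "openin (shift_topology S A) (markov_shift S A)"
    unfolding openin_shift_topology by (auto simp: cylinder_def)
  then show "markov_shift S A \<subseteq> topspace (shift_topology S A)"
    by (rule openin_subset)
qed

lemma space_shift_borel [simp]: "space (shift_borel S A) = markov_shift S A"
  unfolding shift_borel_def by (rule space_measure_of) (use openin_shift_topology in blast)

lemma open_in_shift_borel: "openin (shift_topology S A) U \<Longrightarrow> U \<in> sets (shift_borel S A)"
  unfolding shift_borel_def
  by (subst sets_measure_of) (use openin_shift_topology in \<open>blast+\<close>)

text \<open>The unions of cylinders of length \<open>n\<close>, described through points instead of
  words. Such unions are open, hence Borel, and estimates on cylinders extend to them by summation
  over words.\<close>

definition depends_on_prefix :: "'s set \<Rightarrow> ('s \<Rightarrow> 's \<Rightarrow> bool) \<Rightarrow> nat \<Rightarrow> (nat \<Rightarrow> 's) set \<Rightarrow> bool" where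
  "depends_on_prefix S A n E \<longleftrightarrow> E \<subseteq> markov_shift S A \<and>
     (\<forall>x\<in>E. \<forall>y\<in>markov_shift S A. (\<forall>i<n. x i = y i) \<longrightarrow> y \<in> E)"

lemma depends_on_prefix_sets:
  assumes "depends_on_prefix S A n E"
  shows "E \<in> sets (shift_borel S A)"
proof (rule open_in_shift_borel)
  have "cylinder S A (map x [0..<n]) \<subseteq> E" if "x \<in> E" for x
    using assms that by (auto simp: depends_on_prefix_def mem_cylinder_prefix)
  then show "openin (shift_topology S A) E"
    using assms unfolding openin_shift_topology depends_on_prefix_def by blast
qed

lemma depends_on_prefix_cylinder: "depends_on_prefix S A (length w) (cylinder S A w)"
  by (auto simp: depends_on_prefix_def cylinder_def)

lemma cylinder_sets [measurable]: "cylinder S A w \<in> sets (shift_borel S A)"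
  by (rule depends_on_prefix_sets[OF depends_on_prefix_cylinder])

text \<open>The shift is continuous: \<open>n + 1\<close> letters of a point fix \<open>n\<close>
  letters of its image.\<close>

lemma left_shift_measurable [measurable]: "left_shift \<in> measurable (shift_borel S A) (shift_borel S A)"
proof -
  have "left_shift \<in> measurable (shift_borel S A)
          (sigma (markov_shift S A) {U. openin (shift_topology S A) U})"
  proof (rule measurable_sigma_sets[OF refl[THEN trans]])
    show "sets (sigma (markov_shift S A) {U. openin (shift_topology S A) U}) = sigma_sets (markov_shift S A) {U. openin (shift_topology S A) U}"
      by (rule sets_measure_of) (use openin_shift_topology in blast)
    show "{U. openin (shift_topology S A) U} \<subseteq> Pow (markov_shift S A)"
      using openin_shift_topology by blast
    show "left_shift \<in> space (shift_borel S A) \<rightarrow> markov_shift S A"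
      using left_shift_funpow_in[of _ S A 1] by simp
    fix U assume "U \<in> {U. openin (shift_topology S A) U}"
    then have U: "U \<subseteq> markov_shift S A" "\<And>x. x \<in> U \<Longrightarrow> \<exists>n. cylinder S A (map x [0..<n]) \<subseteq> U"
      by (auto simp: openin_shift_topology)
    show "left_shift -` U \<inter> space (shift_borel S A) \<in> sets (shift_borel S A)"
    proof (rule open_in_shift_borel, unfold openin_shift_topology, intro conjI ballI)
      fix x assume x: "x \<in> left_shift -` U \<inter> space (shift_borel S A)"
      then obtain n where n: "cylinder S A (map (left_shift x) [0..<n]) \<subseteq> U" using U(2)[of "left_shift x"] by auto
      have "cylinder S A (map x [0..<Suc n]) \<subseteq> left_shift -` U \<inter> space (shift_borel S A)"
      proof
        fix y assume "y \<in> cylinder S A (map x [0..<Suc n])"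
        then have "y \<in> markov_shift S A" "left_shift y \<in> cylinder S A (map (left_shift x) [0..<n])"
          using left_shift_funpow_in[of y S A 1]
          unfolding mem_cylinder_prefix by (auto simp: left_shift_def)
        then show "y \<in> left_shift -` U \<inter> space (shift_borel S A)" using n by auto
      qed
      then show "\<exists>n. cylinder S A (map x [0..<n]) \<subseteq> left_shift -` U \<inter> space (shift_borel S A)" by blast
    qed auto
  qed
  then show ?thesis by (simp add: shift_borel_def)
qed

section \<open>The cocycle along an orbit\<close>

lemma cocycle_cong:
  "(\<And>i. i < n \<Longrightarrow> x i = y i) \<Longrightarrow> cocycle G \<psi> n x = cocycle G \<psi> n y"
  by (induction n) (auto simp: left_shift_funpow)

lemma (in group) cocycle_closed:
  "\<psi> \<in> S \<rightarrow> carrier G \<Longrightarrow> x \<in> markov_shift S A \<Longrightarrow> cocycle G \<psi> n x \<in> carrier G"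
  by (induction n) (auto simp: left_shift_funpow markov_shift_def Pi_iff)

lemma (in group) cocycle_add:
  assumes "\<psi> \<in> S \<rightarrow> carrier G" "x \<in> markov_shift S A"
  shows "cocycle G \<psi> (n + m) x = cocycle G \<psi> n x \<otimes> cocycle G \<psi> m ((left_shift ^^ n) x)"
proof (induction m)
  case 0
  then show ?case using cocycle_closed[OF assms] by simp
next
  case (Suc m)
  have "\<psi> (x (n + m)) \<in> carrier G" using assms by (auto simp: markov_shift_def)
  then show ?case
    using Suc cocycle_closed[OF assms] cocycle_closed[OF assms(1) left_shift_funpow_in[OF assms(2)]]
    by (simp add: left_shift_funpow m_assoc add.commute[of m])
qed

lemma tilt_diff:
  "x 0 = y 0 \<Longrightarrow> tilt d \<phi> (lattice_map G \<iota> \<psi>) w x - tilt d \<phi> (lattice_map G \<iota> \<psi>) w y = \<phi> x - \<phi> y"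
  by (simp add: tilt_def lattice_map_def)

section \<open>Invariant means of amenable groups\<close>

locale finitely_additive_prob =
  fixes C :: "'g set" and m :: "'g set \<Rightarrow> real"
  assumes m_total: "m C = 1"
    and m_nonneg: "E \<subseteq> C \<Longrightarrow> 0 \<le> m E"
    and m_add: "E \<subseteq> C \<Longrightarrow> F \<subseteq> C \<Longrightarrow> E \<inter> F = {} \<Longrightarrow> m (E \<union> F) = m E + m F"
begin

lemma m_empty: "m {} = 0"
proof -
  have "m ({} \<union> {}) = m {} + m {}" by (rule m_add) auto
  then show ?thesis by (metis Un_empty_right add_cancel_right_right)
qed

lemma C_nonempty: "C \<noteq> {}"
proof
  assume "C = {}"
  then have "m C = m {}" by (rule arg_cong)
  then show False using m_total m_empty by linarith
qed

lemma m_UN: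
  assumes "finite T" "\<And>t. t \<in> T \<Longrightarrow> E t \<subseteq> C" "disjoint_family_on E T"
  shows "m (\<Union>t\<in>T. E t) = (\<Sum>t\<in>T. m (E t))"
  using assms
proof (induction T)
  case (insert t T)
  have d: "E t \<inter> (\<Union>t\<in>T. E t) = {}" "disjoint_family_on E T"
    using insert.prems(2) disjoint_family_on_insert[OF insert.hyps(2)] by metis+
  have "m (E t \<union> (\<Union>t\<in>T. E t)) = m (E t) + m (\<Union>t\<in>T. E t)"
    using insert.prems(1) by (intro m_add d(1) UN_least) simp_all
  then show ?case
    using insert.IH[OF insert.prems(1) d(2)] insert.hyps by simp
qed (simp add: m_empty)

section \<open>Integration of finitely valued functions\<close>

definition simple_mean :: "('g \<Rightarrow> real) \<Rightarrow> real" where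
  "simple_mean s = (\<Sum>c\<in>s ` C. c * m {x\<in>C. s x = c})"

text \<open>Finite additivity of \<open>m\<close> on the fibres of \<open>p\<close> within a level
  set of \<open>s\<close>. Taking for \<open>p\<close> the pair of two functions evaluates both on
  one common partition, which is how sums and order are handled below.\<close>

lemma simple_mean_factor:
  assumes fin: "finite (p ` C)" and s: "\<And>x. x \<in> C \<Longrightarrow> s x = u (p x)"
  shows "simple_mean s = (\<Sum>t\<in>p ` C. u t * m {x\<in>C. p x = t})"
proof -
  have img: "s ` C = u ` p ` C" using s by force
  have "(\<Sum>t\<in>p ` C. u t * m {x\<in>C. p x = t})
      = (\<Sum>c\<in>s ` C. \<Sum>t\<in>{t\<in>p ` C. u t = c}. u t * m {x\<in>C. p x = t})"
    by (rule sum.group[symmetric]) (use fin img in auto)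
  also have "\<dots> = (\<Sum>c\<in>s ` C. c * m {x\<in>C. s x = c})"
  proof (rule sum.cong[OF refl])
    fix c assume "c \<in> s ` C"
    have "{x\<in>C. s x = c} = (\<Union>t\<in>{t\<in>p ` C. u t = c}. {x\<in>C. p x = t})"
      using s by auto
    also have "m \<dots> = (\<Sum>t\<in>{t\<in>p ` C. u t = c}. m {x\<in>C. p x = t})"
      by (rule m_UN) (use fin in \<open>auto simp: disjoint_family_on_def\<close>)
    finally show "(\<Sum>t\<in>{t\<in>p ` C. u t = c}. u t * m {x\<in>C. p x = t}) = c * m {x\<in>C. s x = c}"
      by (simp add: sum_distrib_left)
  qed
  finally show ?thesis by (simp add: simple_mean_def)
qed

lemma finite_image_pair: "finite (s ` C) \<Longrightarrow> finite (t ` C) \<Longrightarrow> finite ((\<lambda>x. (s x, t x)) ` C)"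
  by (rule finite_subset[of _ "s ` C \<times> t ` C"]) auto

lemma simple_mean_add:
  assumes "finite (s ` C)" "finite (t ` C)"
  shows "simple_mean (\<lambda>x. s x + t x) = simple_mean s + simple_mean t"
proof -
  let ?p = "\<lambda>x. (s x, t x)"
  note fin = finite_image_pair[OF assms]
  show ?thesis
    using simple_mean_factor[OF fin, of s fst] simple_mean_factor[OF fin, of t snd]
      simple_mean_factor[OF fin, of "\<lambda>x. s x + t x" "\<lambda>q. fst q + snd q"]
    by (simp add: sum.distrib distrib_right)
qed

lemma simple_mean_mono:
  assumes "finite (s ` C)" "finite (t ` C)" "\<And>x. x \<in> C \<Longrightarrow> s x \<le> t x"
  shows "simple_mean s \<le> simple_mean t"
proof -
  let ?p = "\<lambda>x. (s x, t x)"
  note fin = finite_image_pair[OF assms(1,2)]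
  have "(\<Sum>q\<in>?p ` C. fst q * m {x\<in>C. ?p x = q}) \<le> (\<Sum>q\<in>?p ` C. snd q * m {x\<in>C. ?p x = q})"
    by (intro sum_mono mult_right_mono m_nonneg) (use assms(3) in auto)
  then show ?thesis
    using simple_mean_factor[OF fin, of s fst] simple_mean_factor[OF fin, of t snd] by simp
qed

lemma simple_mean_cmult:
  assumes "finite (s ` C)"
  shows "simple_mean (\<lambda>x. c * s x) = c * simple_mean s"
  using simple_mean_factor[OF assms, of "\<lambda>x. c * s x" "\<lambda>y. c * y"]
  by (simp add: simple_mean_def sum_distrib_left mult.assoc)

lemma simple_mean_const: "simple_mean (\<lambda>_. c) = c"
  using C_nonempty m_total by (simp add: simple_mean_def image_constant_conv)

lemma simple_mean_add_const:
  "finite (s ` C) \<Longrightarrow> simple_mean (\<lambda>x. s x + c) = simple_mean s + c"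
  using simple_mean_add[of s "\<lambda>_. c"] C_nonempty by (simp add: simple_mean_const image_constant_conv)

text \<open>A lower integral. Since \<open>m\<close> is only finitely additive there is no
  convergence theorem; linearity on bounded functions rests on uniform approximation by finitely
  valued ones.\<close>

definition mean :: "('g \<Rightarrow> real) \<Rightarrow> real" where
  "mean f = (SUP s\<in>{s. finite (s ` C) \<and> (\<forall>x\<in>C. s x \<le> f x)}. simple_mean s)"

definition bdd :: "('g \<Rightarrow> real) \<Rightarrow> bool" where
  "bdd f \<longleftrightarrow> (\<exists>B. \<forall>x\<in>C. \<bar>f x\<bar> \<le> B)"

text \<open>Any competitor in the supremum lies below \<open>s + e\<close>, so a finitely valued
  function within \<open>e\<close> below \<open>f\<close> determines \<open>mean f\<close> up to
  \<open>e\<close>. The rules that follow apply this to suitable approximations.\<close>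

lemma mean_approx:
  assumes "finite (s ` C)" "\<And>x. x \<in> C \<Longrightarrow> s x \<le> f x" "\<And>x. x \<in> C \<Longrightarrow> f x \<le> s x + e"
  shows "simple_mean s \<le> mean f" "mean f \<le> simple_mean s + e"
proof -
  have up: "simple_mean t \<le> simple_mean s + e" if "finite (t ` C)" "\<forall>x\<in>C. t x \<le> f x" for t
  proof -
    have "finite ((\<lambda>x. s x + e) ` C)"
      using finite_imageI[OF assms(1), of "\<lambda>y. y + e"] by (simp add: image_image)
    then have "simple_mean t \<le> simple_mean (\<lambda>x. s x + e)"
      by (intro simple_mean_mono that(1)) (use that(2) assms(3) order_trans in blast)+
    then show ?thesis using simple_mean_add_const[OF assms(1)] by simp
  qed
  show "simple_mean s \<le> mean f"
    unfolding mean_def by (rule cSUP_upper) (use assms up in \<open>auto intro!: bdd_aboveI2\<close>)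
  show "mean f \<le> simple_mean s + e"
    unfolding mean_def by (rule cSUP_least) (use assms up in auto)
qed

lemma obtain_approx:
  assumes "bdd f" "e > 0"
  obtains s where "finite (s ` C)" "\<And>x. x \<in> C \<Longrightarrow> s x \<le> f x" "\<And>x. x \<in> C \<Longrightarrow> f x \<le> s x + e"
proof -
  obtain B where B: "\<And>x. x \<in> C \<Longrightarrow> \<bar>f x\<bar> \<le> B" using assms by (auto simp: bdd_def)
  \<comment> \<open>Rounding \<open>f\<close> down to the grid of multiples of \<open>e\<close>;
    boundedness leaves finitely many grid values.\<close>
  define s where "s x = e * of_int \<lfloor>f x / e\<rfloor>" for x
  show ?thesis
  proof (rule that[of s])
    have "s ` C \<subseteq> (\<lambda>j. e * of_int j) ` {\<lfloor>- B / e\<rfloor> .. \<lfloor>B / e\<rfloor>}"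
    proof
      fix y assume "y \<in> s ` C"
      then obtain x where x: "x \<in> C" "y = s x" by auto
      have "- B / e \<le> f x / e" "f x / e \<le> B / e"
        using B[OF x(1)] assms(2) by (intro divide_right_mono; simp)+
      then have "\<lfloor>f x / e\<rfloor> \<in> {\<lfloor>- B / e\<rfloor> .. \<lfloor>B / e\<rfloor>}" using floor_mono by auto
      then show "y \<in> (\<lambda>j. e * of_int j) ` {\<lfloor>- B / e\<rfloor> .. \<lfloor>B / e\<rfloor>}"
        using x s_def by blast
    qed
    then show "finite (s ` C)" by (rule finite_subset) simp
    fix x
    have "e * of_int \<lfloor>f x / e\<rfloor> \<le> e * (f x / e)" "e * (f x / e) \<le> e * (of_int \<lfloor>f x / e\<rfloor> + 1)"
      using assms(2) by (intro mult_left_mono; linarith)+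
    then show "s x \<le> f x" "f x \<le> s x + e"
      using assms(2) by (auto simp: s_def distrib_left)
  qed
qed

lemma mean_eqI:
  assumes "\<And>e. e > 0 \<Longrightarrow> \<bar>mean f - y\<bar> \<le> k * e" "k > 0"
  shows "mean f = y"
proof (rule ccontr)
  assume "mean f \<noteq> y"
  then show False
    using assms(1)[of "\<bar>mean f - y\<bar> / (2 * k)"] assms(2) by simp
qed

lemma mean_add:
  assumes "bdd f" "bdd g"
  shows "mean (\<lambda>x. f x + g x) = mean f + mean g"
proof (rule mean_eqI[of _ _ 4])
  fix e :: real assume e: "e > 0"
  obtain s where s: "finite (s ` C)" "\<And>x. x \<in> C \<Longrightarrow> s x \<le> f x" "\<And>x. x \<in> C \<Longrightarrow> f x \<le> s x + e"
    using obtain_approx[OF assms(1) e] by blast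
  obtain t where t: "finite (t ` C)" "\<And>x. x \<in> C \<Longrightarrow> t x \<le> g x" "\<And>x. x \<in> C \<Longrightarrow> g x \<le> t x + e"
    using obtain_approx[OF assms(2) e] by blast
  have "finite ((\<lambda>x. s x + t x) ` C)"
    using finite_imageI[OF finite_image_pair[OF s(1) t(1)], of "\<lambda>q. fst q + snd q"] by (simp add: image_image)
  note st = mean_approx[OF this, of "\<lambda>x. f x + g x" "2 * e"]
  have "simple_mean (\<lambda>x. s x + t x) \<le> mean (\<lambda>x. f x + g x)"
    by (rule st) (use s t in force)+
  moreover have "mean (\<lambda>x. f x + g x) \<le> simple_mean (\<lambda>x. s x + t x) + 2 * e"
    by (rule st) (use s t in force)+
  ultimately show "\<bar>mean (\<lambda>x. f x + g x) - (mean f + mean g)\<bar> \<le> 4 * e"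
    using mean_approx[OF s] mean_approx[OF t] simple_mean_add[OF s(1) t(1)] e by linarith
qed simp

lemma mean_mono:
  assumes "bdd f" "bdd g" "\<And>x. x \<in> C \<Longrightarrow> f x \<le> g x"
  shows "mean f \<le> mean g"
proof (rule field_le_epsilon)
  fix e :: real assume e: "e > 0"
  obtain s where s: "finite (s ` C)" "\<And>x. x \<in> C \<Longrightarrow> s x \<le> f x" "\<And>x. x \<in> C \<Longrightarrow> f x \<le> s x + e"
    using obtain_approx[OF assms(1) e] by blast
  obtain B where B: "\<And>x. x \<in> C \<Longrightarrow> \<bar>f x\<bar> \<le> B" using assms by (auto simp: bdd_def)
  obtain B' where B': "\<And>x. x \<in> C \<Longrightarrow> \<bar>g x\<bar> \<le> B'" using assms by (auto simp: bdd_def)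
  have "simple_mean s \<le> mean g"
  proof (rule mean_approx(1)[of _ _ "B + B' + e"])
    show "s x \<le> g x" "g x \<le> s x + (B + B' + e)" if "x \<in> C" for x
      using s(2,3)[OF that] assms(3)[OF that] B[OF that] B'[OF that] by linarith+
  qed (rule s)
  then show "mean f \<le> mean g + e" using mean_approx(2)[OF s] by linarith
qed

lemma mean_const: "mean (\<lambda>_. c) = c"
proof -
  have "finite ((\<lambda>_. c) ` C)" by (simp add: image_constant_conv)
  from mean_approx[OF this, of "\<lambda>_. c" 0] show ?thesis by (simp add: simple_mean_const)
qed

lemma mean_cmult:
  assumes "bdd f" "c \<ge> 0"
  shows "mean (\<lambda>x. c * f x) = c * mean f"
proof (rule mean_eqI[of _ _ "2 * c + 1"])
  fix e :: real assume e: "e > 0"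
  obtain s where s: "finite (s ` C)" "\<And>x. x \<in> C \<Longrightarrow> s x \<le> f x" "\<And>x. x \<in> C \<Longrightarrow> f x \<le> s x + e"
    using obtain_approx[OF assms(1) e] by blast
  have "finite ((\<lambda>x. c * s x) ` C)"
    using finite_imageI[OF s(1), of "\<lambda>y. c * y"] by (simp add: image_image)
  note st = mean_approx[OF this, of "\<lambda>x. c * f x" "c * e"]
  have 1: "c * s x \<le> c * f x" "c * f x \<le> c * s x + c * e" if "x \<in> C" for x
    using mult_left_mono[OF s(2)[OF that] assms(2)] mult_left_mono[OF s(3)[OF that] assms(2)]
    by (auto simp: distrib_left)
  have "c * simple_mean s \<le> c * mean f" "c * mean f \<le> c * (simple_mean s + e)"
    using mean_approx[OF s] assms(2) by (auto intro!: mult_left_mono)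
  moreover have "c * (simple_mean s + e) = c * simple_mean s + c * e" by (simp add: distrib_left)
  moreover have "c * e \<ge> 0" using assms(2) e by simp
  moreover have "(2 * c + 1) * e = 2 * (c * e) + e" by (simp add: distrib_right)
  ultimately show "\<bar>mean (\<lambda>x. c * f x) - c * mean f\<bar> \<le> (2 * c + 1) * e"
    using st[OF 1] simple_mean_cmult[OF s(1), of c] e by linarith
qed (use assms in simp)

lemma bdd_add: "bdd f \<Longrightarrow> bdd g \<Longrightarrow> bdd (\<lambda>x. f x + g x)"
  unfolding bdd_def by (meson abs_triangle_ineq add_mono order_trans)

lemma bdd_cmult: "bdd f \<Longrightarrow> bdd (\<lambda>x. c * f x)"
  unfolding bdd_def abs_mult by (meson abs_ge_zero mult_left_mono)

lemma bdd_const: "bdd (\<lambda>_. c)"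
  by (auto simp: bdd_def)

lemma mean_sum:
  assumes "finite F" "\<And>y. y \<in> F \<Longrightarrow> bdd (f y)"
  shows "bdd (\<lambda>x. \<Sum>y\<in>F. f y x) \<and> mean (\<lambda>x. \<Sum>y\<in>F. f y x) = (\<Sum>y\<in>F. mean (f y))"
  using assms
proof (induction F)
  case (insert y F)
  then have "bdd (f y)" "bdd (\<lambda>x. \<Sum>y\<in>F. f y x)" by auto
  with bdd_add[OF this] mean_add[OF this] insert show ?case by simp
qed (simp add: mean_const bdd_const)

text \<open>Jensen's inequality from the tangent line of \<open>exp\<close> at
  \<open>mean f\<close>, whose mean is exactly \<open>exp (mean f)\<close>.\<close>

lemma exp_mean_le:
  assumes "bdd f"
  shows "exp (mean f) \<le> mean (\<lambda>x. exp (f x))"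
proof -
  let ?c = "mean f"
  obtain B where B: "\<And>x. x \<in> C \<Longrightarrow> \<bar>f x\<bar> \<le> B" using assms by (auto simp: bdd_def)
  have bE: "bdd (\<lambda>x. exp (f x))"
    unfolding bdd_def using B by (intro exI[of _ "exp B"]) (auto simp: abs_le_iff)
  have bL: "bdd (\<lambda>x. exp ?c * f x + exp ?c * (1 - ?c))"
    by (intro bdd_add bdd_cmult assms bdd_const)
  have "exp ?c * ?c + exp ?c * (1 - ?c) = mean (\<lambda>x. exp ?c * f x + exp ?c * (1 - ?c))"
    by (subst mean_add) (simp_all add: mean_cmult mean_const assms bdd_cmult bdd_const)
  also have "\<dots> \<le> mean (\<lambda>x. exp (f x))"
  proof (rule mean_mono[OF bL bE])
    fix x
    have "exp ?c * (1 + (f x - ?c)) \<le> exp ?c * exp (f x - ?c)"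
      by (intro mult_left_mono exp_ge_add_one_self) simp
    also have "\<dots> = exp (f x)" by (simp flip: exp_add)
    finally show "exp ?c * f x + exp ?c * (1 - ?c) \<le> exp (f x)" by (simp add: algebra_simps)
  qed
  finally show ?thesis by (simp add: algebra_simps)
qed

end

section \<open>Invariance under right translations\<close>

locale right_invariant_mean = G: group G + finitely_additive_prob "carrier G" m
  for G :: "('g, 'b) monoid_scheme" and m +
  assumes m_inv: "\<gamma> \<in> carrier G \<Longrightarrow> E \<subseteq> carrier G \<Longrightarrow> m (E #>\<^bsub>G\<^esub> \<gamma>) = m E"
begin

lemma r_translate_fibre:
  assumes "\<gamma> \<in> carrier G"
  shows "m {x\<in>carrier G. s (x \<otimes>\<^bsub>G\<^esub> \<gamma>) = c} = m {x\<in>carrier G. s x = c}"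
proof -
  have "{x\<in>carrier G. s x = c} = {x\<in>carrier G. s (x \<otimes>\<^bsub>G\<^esub> \<gamma>) = c} #>\<^bsub>G\<^esub> \<gamma>" (is "?L = ?R")
  proof
    show "?L \<subseteq> ?R"
    proof
      fix x assume x: "x \<in> ?L"
      then have "x \<otimes>\<^bsub>G\<^esub> inv\<^bsub>G\<^esub> \<gamma> \<otimes>\<^bsub>G\<^esub> \<gamma> = x"
        using assms by (simp add: G.m_assoc)
      then show "x \<in> ?R"
        using assms x unfolding r_coset_def
        by (intro UN_I[of "x \<otimes>\<^bsub>G\<^esub> inv\<^bsub>G\<^esub> \<gamma>"]) auto
    qed
  qed (use assms in \<open>auto simp: r_coset_def\<close>)
  then show ?thesis using m_inv[OF assms, of "{x\<in>carrier G. s (x \<otimes>\<^bsub>G\<^esub> \<gamma>) = c}"] by simp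
qed

lemma surj_r_translate:
  assumes "\<gamma> \<in> carrier G"
  shows "(\<lambda>x. x \<otimes>\<^bsub>G\<^esub> \<gamma>) ` carrier G = carrier G"
proof
  show "carrier G \<subseteq> (\<lambda>x. x \<otimes>\<^bsub>G\<^esub> \<gamma>) ` carrier G"
  proof
    fix x assume "x \<in> carrier G"
    then show "x \<in> (\<lambda>x. x \<otimes>\<^bsub>G\<^esub> \<gamma>) ` carrier G"
      using assms by (intro image_eqI[of _ _ "x \<otimes>\<^bsub>G\<^esub> inv\<^bsub>G\<^esub> \<gamma>"]) (auto simp: G.m_assoc)
  qed
qed (use assms in auto)

lemma simple_mean_translate:
  assumes "\<gamma> \<in> carrier G"
  shows "simple_mean (\<lambda>x. s (x \<otimes>\<^bsub>G\<^esub> \<gamma>)) = simple_mean s"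
proof -
  have "(\<lambda>x. s (x \<otimes>\<^bsub>G\<^esub> \<gamma>)) ` carrier G = s ` carrier G"
    using surj_r_translate[OF assms] by (metis image_image)
  then show ?thesis unfolding simple_mean_def r_translate_fibre[OF assms, of s] by simp
qed

lemma mean_translate:
  assumes "bdd f" and \<gamma>: "\<gamma> \<in> carrier G"
  shows "mean (\<lambda>x. f (x \<otimes>\<^bsub>G\<^esub> \<gamma>)) = mean f"
proof (rule mean_eqI[of _ _ 1])
  fix e :: real assume e: "e > 0"
  obtain s where s: "finite (s ` carrier G)" "\<And>x. x \<in> carrier G \<Longrightarrow> s x \<le> f x"
      "\<And>x. x \<in> carrier G \<Longrightarrow> f x \<le> s x + e"
    using obtain_approx[OF assms(1) e] by blast
  have "finite ((\<lambda>x. s (x \<otimes>\<^bsub>G\<^esub> \<gamma>)) ` carrier G)"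
    using surj_r_translate[OF \<gamma>] s(1) by (metis image_image)
  note st = mean_approx[OF this, of "\<lambda>x. f (x \<otimes>\<^bsub>G\<^esub> \<gamma>)" e]
  have "simple_mean s \<le> mean (\<lambda>x. f (x \<otimes>\<^bsub>G\<^esub> \<gamma>))" "mean (\<lambda>x. f (x \<otimes>\<^bsub>G\<^esub> \<gamma>)) \<le> simple_mean s + e"
    unfolding simple_mean_translate[OF \<gamma>, of s, symmetric] by (rule st; use s \<gamma> in simp)+
  then show "\<bar>mean (\<lambda>x. f (x \<otimes>\<^bsub>G\<^esub> \<gamma>)) - mean f\<bar> \<le> 1 * e"
    using mean_approx[OF s] by linarith
qed simp

end

text \<open>Inversion of sets exchanges left and right translations. The right-handed form is the
  useful one because return words are appended on the right of the group coordinate.\<close>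

lemma (in group) amenable_right_invariant_mean:
  assumes "amenable G"
  obtains m where "right_invariant_mean G m"
proof -
  obtain m where m': "m (carrier G) = (1 :: real) \<and> (\<forall>E \<subseteq> carrier G. 0 \<le> m E) \<and>
      (\<forall>E \<subseteq> carrier G. \<forall>F \<subseteq> carrier G. E \<inter> F = {} \<longrightarrow> m (E \<union> F) = m E + m F) \<and>
      (\<forall>g \<in> carrier G. \<forall>E \<subseteq> carrier G. m (g <#\<^bsub>G\<^esub> E) = m E)"
    using assms unfolding amenable_def by (elim exE) (rule that)
  have m: "m (carrier G) = 1" "\<And>E. E \<subseteq> carrier G \<Longrightarrow> 0 \<le> m E"
    "\<And>E F. E \<subseteq> carrier G \<Longrightarrow> F \<subseteq> carrier G \<Longrightarrow> E \<inter> F = {} \<Longrightarrow> m (E \<union> F) = m E + m F"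
    "\<And>g E. g \<in> carrier G \<Longrightarrow> E \<subseteq> carrier G \<Longrightarrow> m (g <#\<^bsub>G\<^esub> E) = m E"
    using m' by simp_all
  have sub: "m_inv G ` E \<subseteq> carrier G" if "E \<subseteq> carrier G" for E using that by auto
  show ?thesis
  proof (rule that[of "\<lambda>E. m (m_inv G ` E)"], unfold_locales)
    have "m_inv G ` carrier G = carrier G"
    proof
      show "carrier G \<subseteq> m_inv G ` carrier G"
      proof
        fix x assume "x \<in> carrier G"
        then show "x \<in> m_inv G ` carrier G" by (intro image_eqI[of _ _ "inv x"]) auto
      qed
    qed auto
    then show "m (m_inv G ` carrier G) = 1" using m(1) by simp
    show "0 \<le> m (m_inv G ` E)" if "E \<subseteq> carrier G" for E by (rule m(2)[OF sub[OF that]])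
    show "m (m_inv G ` (E \<union> F)) = m (m_inv G ` E) + m (m_inv G ` F)"
      if "E \<subseteq> carrier G" "F \<subseteq> carrier G" "E \<inter> F = {}" for E F
    proof -
      have "m_inv G ` E \<inter> m_inv G ` F = {}"
        using inj_on_image_Int[OF inv_inj that(1,2)] that(3) by simp
      then show ?thesis using m(3)[OF sub sub] that by (simp add: image_Un)
    qed
    show "m (m_inv G ` (E #> \<gamma>)) = m (m_inv G ` E)" if "\<gamma> \<in> carrier G" "E \<subseteq> carrier G" for \<gamma> E
    proof -
      have "m_inv G ` (E #> \<gamma>) = inv \<gamma> <# m_inv G ` E"
        using that by (auto simp: r_coset_def l_coset_def inv_mult_group subset_iff image_iff)
      then show ?thesis using m(4)[of "inv \<gamma>" "m_inv G ` E"] that sub by simp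
    qed
  qed
qed

section \<open>Real characters and the free abelianization\<close>

lemma (in comm_group) torsion_part_subgroup: "subgroup (torsion_part G) G"
proof
  show "torsion_part G \<subseteq> carrier G" by (auto simp: torsion_part_def)
  show "\<one> \<in> torsion_part G" by (auto simp: torsion_part_def intro!: exI[of _ 1])
  fix x assume "x \<in> torsion_part G"
  then obtain n :: nat where x: "x \<in> carrier G" "n > 0" "x [^] n = \<one>"
    by (auto simp: torsion_part_def)
  show "inv x \<in> torsion_part G"
    using x by (auto simp: torsion_part_def nat_pow_inv intro!: exI[of _ n])
  fix y assume "y \<in> torsion_part G"
  then obtain m :: nat where y: "y \<in> carrier G" "m > 0" "y [^] m = \<one>"
    by (auto simp: torsion_part_def)
  have "x [^] (n * m) = \<one>" using x by (simp flip: nat_pow_pow)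
  moreover have "y [^] (m * n) = \<one>" using y by (simp flip: nat_pow_pow)
  ultimately have "(x \<otimes> y) [^] (n * m) = \<one>"
    using x y by (simp add: nat_pow_distrib mult.commute)
  then show "x \<otimes> y \<in> torsion_part G"
    using x y unfolding torsion_part_def by (intro CollectI conjI exI[of _ "n * m"]) auto
qed

context group begin

lemma abelianization_comm: "comm_group (abelianization G)"
  unfolding abelianization_def by (rule derived_quot_is_comm_group)

lemma torsion_part_normal: "torsion_part (abelianization G) \<lhd> abelianization G"
  using abelianization_comm comm_group.torsion_part_subgroup comm_group.subgroup_imp_normal by blast

lemma abelianization_coset_hom:
  "(\<lambda>g. derived G (carrier G) #> g) \<in> hom G (abelianization G)"
  unfolding abelianization_def by (rule normal.r_coset_hom_Mod[OF derived_self_is_normal])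

lemma free_ab_proj_hom: "free_ab_proj G \<in> hom G (free_abelianization G)"
proof -
  have "free_ab_proj G = (\<lambda>x. torsion_part (abelianization G) #>\<^bsub>abelianization G\<^esub> x) \<circ> (\<lambda>g. derived G (carrier G) #> g)"
    by (auto simp: free_ab_proj_def)
  then show ?thesis
    unfolding free_abelianization_def
    using Group.hom_compose[OF abelianization_coset_hom normal.r_coset_hom_Mod[OF torsion_part_normal]]
    by simp
qed

lemma free_ab_proj_surj: "free_ab_proj G ` carrier G = carrier (free_abelianization G)"
proof -
  have "carrier (abelianization G) = (\<lambda>g. derived G (carrier G) #> g) ` carrier G"
    by (auto simp: abelianization_def carrier_FactGroup)
  then show ?thesis
    unfolding free_abelianization_def carrier_FactGroup by (simp add: image_image free_ab_proj_def)
qed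

text \<open>A trivial class modulo torsion means torsion in the abelianization, so a power of
  \<open>g\<close> falls into the derived subgroup.\<close>

lemma free_ab_proj_kernel:
  assumes g: "g \<in> carrier G" and one: "free_ab_proj G g = \<one>\<^bsub>free_abelianization G\<^esub>"
  obtains n :: nat where "n > 0" "g [^] n \<in> derived G (carrier G)"
proof -
  let ?H = "abelianization G" and ?D = "derived G (carrier G)"
  let ?T = "torsion_part ?H"
  interpret H: comm_group ?H by (rule abelianization_comm)
  interpret T: normal ?T ?H by (rule torsion_part_normal)
  interpret D: normal ?D G by (rule derived_self_is_normal)
  interpret q: group_hom G ?H "\<lambda>g. ?D #> g"
    by unfold_locales (rule abelianization_coset_hom)
  have x: "?D #> g \<in> carrier ?H" using g by (rule q.hom_closed)
  have "?T #>\<^bsub>?H\<^esub> (?D #> g) = ?T"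
    using one by (simp add: free_ab_proj_def free_abelianization_def)
  then have "?D #> g \<in> ?T"
    using H.rcos_self[OF x T.subgroup_axioms] by simp
  then obtain n :: nat where n: "n > 0" "(?D #> g) [^]\<^bsub>?H\<^esub> n = \<one>\<^bsub>?H\<^esub>"
    unfolding torsion_part_def mem_Collect_eq by (elim conjE exE) (rule that)
  have "?D #> (g [^] n) = ?D"
    using q.hom_nat_pow[OF g, of n] n(2) by (simp add: abelianization_def)
  then have "g [^] n \<in> ?D"
    using rcos_self[of "g [^] n" ?D] D.subgroup_axioms g by simp
  then show ?thesis using that n(1) by blast
qed

end

locale real_valued_hom = group G for G :: "('g, 'm) monoid_scheme" (structure) +
  fixes \<rho> :: "'g \<Rightarrow> real"
  assumes \<rho>: "g \<in> carrier G \<Longrightarrow> h \<in> carrier G \<Longrightarrow> \<rho> (g \<otimes> h) = \<rho> g + \<rho> h"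
begin

lemma real_hom_one: "\<rho> \<one> = 0"
  using \<rho>[of \<one> \<one>] by simp

lemma real_hom_inv: "g \<in> carrier G \<Longrightarrow> \<rho> (inv g) = - \<rho> g"
  using \<rho>[of g "inv g"] real_hom_one by simp

lemma real_hom_pow: "g \<in> carrier G \<Longrightarrow> \<rho> (g [^] (n::nat)) = real n * \<rho> g"
  by (induction n) (auto simp: real_hom_one \<rho> algebra_simps)

lemma real_hom_derived: "g \<in> derived G (carrier G) \<Longrightarrow> \<rho> g = 0"
  unfolding derived_def
proof (induction rule: generate.induct)
  case one
  then show ?case by (rule real_hom_one)
next
  case (incl h)
  then show ?case by (auto simp: \<rho> real_hom_inv)
next
  case (inv h)
  then show ?case by (auto simp: \<rho> real_hom_inv)
next
  case (eng h1 h2)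
  then have "h1 \<in> carrier G" "h2 \<in> carrier G"
    using generate_in_carrier[OF derived_set_in_carrier] by auto
  then show ?case using eng \<rho> by simp
qed

text \<open>A power of \<open>g\<close> lies in the derived subgroup, where \<open>\<rho>\<close>
  vanishes, and the reals have no torsion.\<close>

lemma real_hom_kernel:
  "g \<in> carrier G \<Longrightarrow> free_ab_proj G g = \<one>\<^bsub>free_abelianization G\<^esub> \<Longrightarrow> \<rho> g = 0"
  using free_ab_proj_kernel[of g] real_hom_derived real_hom_pow
  by (metis mult_eq_0_iff of_nat_0_eq_iff less_numeral_extra(3))

end

section \<open>Characters in lattice coordinates\<close>

locale lattice_identification = group G for G :: "('g, 'm) monoid_scheme" (structure) +
  fixes \<iota> :: "'g set set \<Rightarrow> nat \<Rightarrow> int" and d :: nat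
  assumes \<iota>: "\<iota> \<in> iso (free_abelianization G) (int_lattice d)"
begin

definition lattice_proj :: "'g \<Rightarrow> nat \<Rightarrow> int" where
  "lattice_proj g = \<iota> (free_ab_proj G g)"

lemma lattice_proj_hom: "lattice_proj \<in> hom G (int_lattice d)"
proof -
  have "\<iota> \<in> hom (free_abelianization G) (int_lattice d)" using \<iota> by (simp add: iso_def)
  then have "\<iota> \<circ> free_ab_proj G \<in> hom G (int_lattice d)"
    by (rule Group.hom_compose[OF free_ab_proj_hom])
  then show ?thesis by (simp add: lattice_proj_def[abs_def] comp_def)
qed

lemma lattice_proj_mult:
  "g \<in> carrier G \<Longrightarrow> h \<in> carrier G \<Longrightarrow> i < d \<Longrightarrow>
     lattice_proj (g \<otimes> h) i = lattice_proj g i + lattice_proj h i"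
  using hom_mult[OF lattice_proj_hom, of g h] by simp

lemma lattice_proj_one: "i < d \<Longrightarrow> lattice_proj \<one> i = 0"
  using lattice_proj_mult[of \<one> \<one> i] by simp

lemma lattice_proj_inv: "g \<in> carrier G \<Longrightarrow> i < d \<Longrightarrow> lattice_proj (inv g) i = - lattice_proj g i"
  using lattice_proj_mult[of g "inv g" i] lattice_proj_one[of i] by simp

lemma lattice_proj_surj:
  assumes "v \<in> carrier (int_lattice d)"
  obtains g where "g \<in> carrier G" "lattice_proj g = v"
proof -
  have "v \<in> \<iota> ` carrier (free_abelianization G)"
    using \<iota> assms by (auto simp: iso_def bij_betw_def)
  then have "v \<in> \<iota> ` free_ab_proj G ` carrier G" by (simp only: free_ab_proj_surj)
  then obtain g where "g \<in> carrier G" "v = \<iota> (free_ab_proj G g)" by auto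
  then show ?thesis using that[of g] by (simp add: lattice_proj_def)
qed

lemma lattice_proj_kernel:
  assumes "g \<in> carrier G" "\<And>i. i < d \<Longrightarrow> lattice_proj g i = 0"
  shows "free_ab_proj G g = \<one>\<^bsub>free_abelianization G\<^esub>"
proof -
  have gr: "group (free_abelianization G)"
    unfolding free_abelianization_def
    using normal.factorgroup_is_group[OF torsion_part_normal] by simp
  have gi: "group (int_lattice d)" by (auto intro: product_group group_integer_group)
  have h: "\<iota> \<in> hom (free_abelianization G) (int_lattice d)" and inj: "inj_on \<iota> (carrier (free_abelianization G))"
    using \<iota> by (auto simp: iso_def bij_betw_def)
  have 1: "free_ab_proj G g \<in> carrier (free_abelianization G)"
    using assms(1) free_ab_proj_surj by blast
  have "lattice_proj g \<in> carrier (int_lattice d)"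
    using lattice_proj_hom assms(1) by (rule hom_in_carrier)
  then have "lattice_proj g = \<one>\<^bsub>int_lattice d\<^esub>"
    using assms(2) by (auto simp: fun_eq_iff PiE_def extensional_def)
  also have "\<dots> = \<iota> \<one>\<^bsub>free_abelianization G\<^esub>"
    using hom_one[OF h gr gi] by simp
  finally show ?thesis
    using inj 1 group.is_monoid[OF gr, THEN monoid.one_closed] by (auto simp: lattice_proj_def inj_on_def)
qed

text \<open>\<open>\<rho>\<close> vanishes on the kernel of \<open>lattice_proj\<close>, so its
  value at \<open>g\<close> may be computed at any \<open>h\<close> with the same lattice
  coordinates, here one assembled from lifts of the unit vectors.\<close>

theorem real_hom_factors:
  fixes \<rho> :: "'g \<Rightarrow> real"
  assumes \<rho>: "\<And>g h. g \<in> carrier G \<Longrightarrow> h \<in> carrier G \<Longrightarrow> \<rho> (g \<otimes> h) = \<rho> g + \<rho> h"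
  obtains w where "\<And>i. i \<ge> d \<Longrightarrow> w i = 0"
    "\<And>g. g \<in> carrier G \<Longrightarrow> \<rho> g = inner_d d w (\<lambda>i. real_of_int (lattice_proj g i))"
proof -
  interpret \<rho>: real_valued_hom G \<rho> by unfold_locales (rule \<rho>)
  have "\<exists>e\<in>carrier G. \<forall>i<d. lattice_proj e i = (if i = k then 1 else 0)" for k
  proof -
    have "restrict (\<lambda>i. if i = k then 1 else 0) {..<d} \<in> carrier (int_lattice d)" by simp
    then obtain g where "g \<in> carrier G" "lattice_proj g = restrict (\<lambda>i. if i = k then 1 else 0) {..<d}"
      by (rule lattice_proj_surj)
    then show ?thesis by (intro bexI[of _ g]) auto
  qed
  then obtain e where e: "\<And>k. e k \<in> carrier G"
    "\<And>k i. i < d \<Longrightarrow> lattice_proj (e k) i = (if i = k then 1 else 0)" by metis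
  \<comment> \<open>The zeros beyond \<open>d\<close> place \<open>w\<close> in the Euclidean space
    of dimension \<open>d\<close>.\<close>
  define w where "w i = (if i < d then \<rho> (e i) else 0)" for i
  \<comment> \<open>A relation between lattice vectors and values rather than a function, because
    lifts are not unique; closure under sums and negation suffices to reach every integer
    combination.\<close>
  define L where "L v c \<longleftrightarrow> (\<exists>h\<in>carrier G. (\<forall>i<d. lattice_proj h i = v i) \<and> \<rho> h = c)" for v c
  have L0: "L (\<lambda>_. 0) 0"
    unfolding L_def by (intro bexI[of _ \<one>]) (auto simp: lattice_proj_one \<rho>.real_hom_one)
  have Ladd: "L (\<lambda>i. v i + v' i) (c + c')" if "L v c" "L v' c'" for v v' c c'
  proof -
    obtain h h' where "h \<in> carrier G" "\<forall>i<d. lattice_proj h i = v i" "\<rho> h = c"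
      "h' \<in> carrier G" "\<forall>i<d. lattice_proj h' i = v' i" "\<rho> h' = c'"
      using \<open>L v c\<close> \<open>L v' c'\<close> unfolding L_def by blast
    then show ?thesis unfolding L_def
      by (intro bexI[of _ "h \<otimes> h'"]) (auto simp: lattice_proj_mult \<rho>)
  qed
  have Lneg: "L (\<lambda>i. - v i) (- c)" if v: "L v c" for v c
  proof -
    obtain h where "h \<in> carrier G" "\<forall>i<d. lattice_proj h i = v i" "\<rho> h = c"
      using v unfolding L_def by blast
    then show ?thesis unfolding L_def
      by (intro bexI[of _ "inv h"]) (auto simp: lattice_proj_inv \<rho>.real_hom_inv)
  qed
  have Lnat: "L (\<lambda>i. int n * (if i = k then 1 else 0)) (real n * \<rho> (e k))" for n k
  proof (induction n)
    case 0
    then show ?case using L0 by simp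
  next
    case (Suc n)
    have "L (\<lambda>i. if i = k then 1 else 0) (\<rho> (e k))"
      unfolding L_def using e by (intro bexI[of _ "e k"]) auto
    from Ladd[OF Suc this] show ?case by (simp add: distrib_right add.commute)
  qed
  have Lint: "L (\<lambda>i. z * (if i = k then 1 else 0)) (real_of_int z * \<rho> (e k))" for z k
  proof (cases z)
    case (nonneg n)
    then show ?thesis using Lnat[of n k] by simp
  next
    case (neg n)
    have "(\<lambda>i. - (int (Suc n) * (if i = k then 1 else 0))) = (\<lambda>i. z * (if i = k then 1 else 0))"
      using neg by (intro ext) (simp only: minus_mult_left)
    moreover have "- (real (Suc n) * \<rho> (e k)) = real_of_int z * \<rho> (e k)"
      using neg by (simp only: minus_mult_left of_int_minus of_int_of_nat_eq)
    ultimately show ?thesis using Lneg[OF Lnat[of "Suc n" k]] by simp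
  qed
  have Lsum: "L (\<lambda>i. \<Sum>k<m. z k * (if i = k then 1 else 0)) (\<Sum>k<m. real_of_int (z k) * \<rho> (e k))" for m z
  proof (induction m)
    case (Suc m)
    from Ladd[OF Suc Lint[of "z m" m]] show ?case by simp
  qed (simp add: L0)
  show ?thesis
  proof (rule that[of w])
    show "w i = 0" if "i \<ge> d" for i using that by (simp add: w_def)
    fix g assume g: "g \<in> carrier G"
    obtain h where h: "h \<in> carrier G"
      "\<And>i. i < d \<Longrightarrow> lattice_proj h i = (\<Sum>k<d. lattice_proj g k * (if i = k then 1 else 0))"
      "\<rho> h = (\<Sum>k<d. real_of_int (lattice_proj g k) * \<rho> (e k))"
      using Lsum[of "lattice_proj g" d] unfolding L_def by blast
    have "lattice_proj (g \<otimes> inv h) i = 0" if "i < d" for i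
      using g h(1) h(2)[OF that] that by (simp add: lattice_proj_mult lattice_proj_inv if_distrib cong: if_cong)
    then have "\<rho> (g \<otimes> inv h) = 0"
      using g h(1) by (intro \<rho>.real_hom_kernel lattice_proj_kernel) auto
    then have "\<rho> g = \<rho> h" using g h(1) by (simp add: \<rho> \<rho>.real_hom_inv)
    then show "\<rho> g = inner_d d w (\<lambda>i. real_of_int (lattice_proj g i))"
      unfolding h(3) inner_d_def w_def by (simp add: mult.commute)
  qed
qed

text \<open>Since \<open>lattice_proj\<close> is a homomorphism, summing \<open>f\<close> along an
  orbit gives the lattice class of the cocycle. The tilt is thus invisible on words with trivial
  cocycle, and in general it multiplies the weight by a character of the cocycle.\<close>

lemma birkhoff_tilt:
  assumes "\<psi> \<in> S \<rightarrow> carrier G" "x \<in> markov_shift S A"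
  shows "birkhoff (tilt d \<phi> (lattice_map G \<iota> \<psi>) w) n x
       = birkhoff \<phi> n x + inner_d d w (\<lambda>i. real_of_int (lattice_proj (cocycle G \<psi> n x) i))"
proof (induction n)
  case 0
  then show ?case by (simp add: birkhoff_def inner_d_def lattice_proj_one)
next
  case (Suc n)
  let ?y = "(left_shift ^^ n) x"
  have y: "(left_shift ^^ k) x \<in> markov_shift S A" for k
    using assms(2) by (induction k) (auto simp: left_shift_def markov_shift_def)
  have cl: "cocycle G \<psi> n x \<in> carrier G"
    by (induction n) (use y assms(1) in \<open>auto simp: markov_shift_def Pi_iff\<close>)
  have "\<psi> (?y 0) \<in> carrier G" using y[of n] assms(1) by (auto simp: markov_shift_def)
  then have "inner_d d w (\<lambda>i. real_of_int (lattice_proj (cocycle G \<psi> (Suc n) x) i))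
      = inner_d d w (\<lambda>i. real_of_int (lattice_proj (cocycle G \<psi> n x) i))
      + inner_d d w (\<lambda>i. real_of_int (lattice_proj (\<psi> (?y 0)) i))"
    using cl by (simp add: inner_d_def lattice_proj_mult distrib_left sum.distrib)
  then show ?case
    using Suc by (simp add: birkhoff_def tilt_def lattice_map_def lattice_proj_def)
qed

end

section \<open>Group extensions and masses of return words\<close>

lemma summable_on_ennreal [simp]: "f summable_on A" for f :: "'a \<Rightarrow> ennreal"
  by (rule nonneg_summable_on_complete) simp

lemma infsum_ennreal_SUP: "infsum f A = (SUP F\<in>{F. finite F \<and> F \<subseteq> A}. sum f F)"
  for f :: "'a \<Rightarrow> ennreal"
  by (rule nonneg_infsum_complete) simp

lemma sum_le_infsum_ennreal: "finite F \<Longrightarrow> F \<subseteq> A \<Longrightarrow> sum f F \<le> infsum f A"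
  for f :: "'a \<Rightarrow> ennreal"
  unfolding infsum_ennreal_SUP by (rule SUP_upper) simp

lemma infsum_le_ennreal: "(\<And>F. finite F \<Longrightarrow> F \<subseteq> A \<Longrightarrow> sum f F \<le> B) \<Longrightarrow> infsum f A \<le> B"
  for f :: "'a \<Rightarrow> ennreal"
  unfolding infsum_ennreal_SUP by (rule SUP_least) auto

lemma infsum_subset_ennreal: "A \<subseteq> B \<Longrightarrow> infsum f A \<le> infsum f B"
  for f :: "'a \<Rightarrow> ennreal"
  by (rule infsum_le_ennreal) (auto intro: sum_le_infsum_ennreal)

lemma infsum_cmult_ennreal: "infsum (\<lambda>x. c * f x) A = c * infsum f A"
  for f :: "'a \<Rightarrow> ennreal"
proof -
  have "{F. finite F \<and> F \<subseteq> A} \<noteq> {}" by auto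
  then show ?thesis
    unfolding infsum_ennreal_SUP by (simp add: SUP_mult_left_ennreal sum_distrib_left)
qed

lemma infsum_UN_disjoint_ennreal:
  fixes f :: "'a \<Rightarrow> ennreal"
  assumes "finite I" "disjoint_family_on J I"
  shows "(\<Sum>i\<in>I. infsum f (J i)) = infsum f (\<Union>i\<in>I. J i)"
  using assms
proof (induction I)
  case (insert i I)
  then have "J i \<inter> (\<Union>i\<in>I. J i) = {}" "disjoint_family_on J I"
    using disjoint_family_on_insert[OF insert.hyps(2)] by metis+
  then show ?case
    using insert infsum_Un_disjoint[of f "J i" "\<Union>i\<in>I. J i"] by simp
qed simp

section \<open>Paths with prescribed cocycle and their weights\<close>

locale group_extension = group G for G :: "('g, 'm) monoid_scheme" (structure) +
  fixes S :: "'s set" and A :: "'s \<Rightarrow> 's \<Rightarrow> bool" and \<psi> :: "'s \<Rightarrow> 'g"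
    and \<phi> :: "(nat \<Rightarrow> 's) \<Rightarrow> real" and D :: real
  assumes \<psi>: "\<psi> \<in> S \<rightarrow> carrier G"
    and mixing: "topologically_mixing (S \<times> carrier G) (skew_transition A G \<psi>)"
    and D_nonneg: "D \<ge> 0"
    and distortion: "\<lbrakk>x \<in> markov_shift S A; y \<in> markov_shift S A; \<And>i. i < n \<Longrightarrow> x i = y i\<rbrakk>
       \<Longrightarrow> \<bar>birkhoff \<phi> n x - birkhoff \<phi> n y\<bar> \<le> D"
begin

abbreviation "X \<equiv> markov_shift S A"

text \<open>Mixing of the extension, unpacked. A word of length \<open>n\<close> strictly between
  the two endpoints gives \<open>n + 1\<close> steps, hence the endpoint at \<open>Suc n\<close>;
  \<open>p\<close> records the group coordinate along the path.\<close>

lemma skew_path: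
  assumes "s \<in> S" "t \<in> S" "g \<in> carrier G"
  obtains N where "\<And>n. n \<ge> N \<Longrightarrow> \<exists>f p. f 0 = s \<and> f (Suc n) = t \<and> p 0 = \<one> \<and> p (Suc n) = g
     \<and> (\<forall>i\<le>n. f i \<in> S \<and> A (f i) (f (Suc i)) \<and> p (Suc i) = p i \<otimes> \<psi> (f i))"
proof -
  have "(s, \<one>) \<in> S \<times> carrier G" "(t, g) \<in> S \<times> carrier G" using assms by auto
  then obtain N where N: "\<And>n. n \<ge> N \<Longrightarrow> \<exists>w \<in> allowed_words (S \<times> carrier G) (skew_transition A G \<psi>) n.
      successively (skew_transition A G \<psi>) ((s, \<one>) # w @ [(t, g)])"
    using mixing unfolding topologically_mixing_def by meson
  show ?thesis
  proof (rule that[of N])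
    fix n assume "n \<ge> N"
    then obtain w where w: "w \<in> allowed_words (S \<times> carrier G) (skew_transition A G \<psi>) n"
      "successively (skew_transition A G \<psi>) ((s, \<one>) # w @ [(t, g)])" using N by blast
    define q where "q = (s, \<one>) # w @ [(t, g)]"
    have len: "length w = n" "length q = n + 2" using w(1) by (auto simp: allowed_words_def q_def)
    have set_q: "set q \<subseteq> S \<times> carrier G" using w(1) assms by (auto simp: allowed_words_def q_def)
    have step: "skew_transition A G \<psi> (q ! i) (q ! Suc i)" if "i \<le> n" for i
      using w(2) that len unfolding q_def[symmetric] successively_conv_nth by auto
    have "q ! i \<in> S \<times> carrier G" if "i \<le> n" for i using set_q that len by auto
    then have "\<forall>i\<le>n. fst (q ! i) \<in> S \<and> A (fst (q ! i)) (fst (q ! Suc i)) \<and> snd (q ! Suc i) = snd (q ! i) \<otimes> \<psi> (fst (q ! i))"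
      using step by (auto simp: skew_transition_def mem_Times_iff)
    moreover have "q ! 0 = (s, \<one>)" "q ! Suc n = (t, g)" using len by (auto simp: q_def nth_append)
    ultimately show "\<exists>f p. f 0 = s \<and> f (Suc n) = t \<and> p 0 = \<one> \<and> p (Suc n) = g
     \<and> (\<forall>i\<le>n. f i \<in> S \<and> A (f i) (f (Suc i)) \<and> p (Suc i) = p i \<otimes> \<psi> (f i))"
      by (intro exI[of _ "\<lambda>i. fst (q ! i)"] exI[of _ "\<lambda>i. snd (q ! i)"]) simp
  qed
qed

text \<open>A loop at \<open>s\<close>, supplied by mixing, is repeated forever.\<close>

lemma point_through:
  assumes "s \<in> S"
  obtains x where "x \<in> X" "x 0 = s"
proof -
  obtain N where "\<exists>f p. f 0 = s \<and> f (Suc N) = s \<and> p 0 = \<one> \<and> p (Suc N) = \<one>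
     \<and> (\<forall>i\<le>N. f i \<in> S \<and> A (f i) (f (Suc i)) \<and> p (Suc i) = p i \<otimes> \<psi> (f i))"
    using skew_path[OF assms assms one_closed] by (metis le_refl)
  then obtain f where f: "f 0 = s" "f (Suc N) = s" "\<And>i. i \<le> N \<Longrightarrow> f i \<in> S \<and> A (f i) (f (Suc i))"
    by blast
  have "periodize (Suc N) f \<in> X" by (rule periodize_path) (use f in auto)
  then show ?thesis using that[of "periodize (Suc N) f"] f(1) by (simp add: periodize_def)
qed

lemma connecting_point:
  assumes "s \<in> S" "t \<in> S" "g \<in> carrier G"
  obtains N where "\<And>n. n \<ge> N \<Longrightarrow> \<exists>x\<in>X. x 0 = s \<and> x n = t \<and> cocycle G \<psi> n x = g"
proof -
  obtain z where z: "z \<in> X" "z 0 = t" by (rule point_through[OF assms(2)])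
  obtain N where N: "\<And>n. n \<ge> N \<Longrightarrow> \<exists>f p. f 0 = s \<and> f (Suc n) = t \<and> p 0 = \<one> \<and> p (Suc n) = g
     \<and> (\<forall>i\<le>n. f i \<in> S \<and> A (f i) (f (Suc i)) \<and> p (Suc i) = p i \<otimes> \<psi> (f i))"
    using skew_path[OF assms] by metis
  show ?thesis
  proof (rule that[of "Suc N"])
    fix n' assume "n' \<ge> Suc N"
    then obtain n where n: "n' = Suc n" "n \<ge> N" by (cases n') auto
    obtain f p where f: "f 0 = s" "f (Suc n) = t" "p 0 = \<one>" "p (Suc n) = g"
     "\<And>i. i \<le> n \<Longrightarrow> f i \<in> S \<and> A (f i) (f (Suc i)) \<and> p (Suc i) = p i \<otimes> \<psi> (f i)"
      using N[OF n(2)] by metis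
    let ?x = "graft n' f z"
    have "?x \<in> X" by (rule graft_path) (use f z n in auto)
    moreover have "?x 0 = s" "?x n' = t" using f z n by (auto simp: graft_def)
    moreover have c: "k \<le> n' \<Longrightarrow> cocycle G \<psi> k ?x = p k" for k
    proof (induction k)
      case (Suc k)
      then show ?case using f(5)[of k] n by (simp add: left_shift_funpow)
    qed (simp add: f)
    moreover have "cocycle G \<psi> n' ?x = g" using c[of n'] f(4) n(1) by (simp del: cocycle.simps)
    ultimately show "\<exists>x\<in>X. x 0 = s \<and> x n' = t \<and> cocycle G \<psi> n' x = g" by blast
  qed
qed

text \<open>A lower bound on the total weight of the words of length \<open>n\<close> from
  \<open>s\<close> to \<open>t\<close> with cocycle \<open>g\<close>. The points of \<open>F\<close>
  stand for distinct words and may have any tails. A bound in place of a value avoids sums that may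
  be infinite.\<close>

definition mass :: "nat \<Rightarrow> 's \<Rightarrow> 's \<Rightarrow> 'g \<Rightarrow> real \<Rightarrow> bool" where
  "mass n s t g r \<longleftrightarrow> (\<exists>F. finite F \<and> F \<subseteq> {x\<in>X. x 0 = s \<and> x n = t \<and> cocycle G \<psi> n x = g}
     \<and> (\<forall>x\<in>F. \<forall>y\<in>F. (\<forall>i<n. x i = y i) \<longrightarrow> x = y) \<and> r \<le> (\<Sum>x\<in>F. exp (birkhoff \<phi> n x)))"

lemma massE:
  assumes "mass n s t g r"
  obtains F where "finite F" "F \<subseteq> {x\<in>X. x 0 = s \<and> x n = t \<and> cocycle G \<psi> n x = g}"
     "\<And>x y. x \<in> F \<Longrightarrow> y \<in> F \<Longrightarrow> \<forall>i<n. x i = y i \<Longrightarrow> x = y" "r \<le> (\<Sum>x\<in>F. exp (birkhoff \<phi> n x))"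
proof -
  obtain F where F: "finite F \<and> F \<subseteq> {x\<in>X. x 0 = s \<and> x n = t \<and> cocycle G \<psi> n x = g}
     \<and> (\<forall>x\<in>F. \<forall>y\<in>F. (\<forall>i<n. x i = y i) \<longrightarrow> x = y) \<and> r \<le> (\<Sum>x\<in>F. exp (birkhoff \<phi> n x))"
    using assms unfolding mass_def by (elim exE) (rule that)
  show thesis
  proof (rule that[of F])
    show "x = y" if "x \<in> F" "y \<in> F" "\<forall>i<n. x i = y i" for x y using F that by blast
  qed (use F in simp_all)
qed

lemma mass_mono: "mass n s t g r \<Longrightarrow> r' \<le> r \<Longrightarrow> mass n s t g r'"
  unfolding mass_def by (meson order_trans)

lemma mass_point:
  assumes "x \<in> X"
  shows "mass n (x 0) (x n) (cocycle G \<psi> n x) (exp (birkhoff \<phi> n x))"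
  unfolding mass_def by (rule exI[of _ "{x}"]) (use assms in auto)

lemma birkhoff_graft_ge:
  assumes "x \<in> X" "y \<in> X" "x n = y 0"
  shows "birkhoff \<phi> (n + m) (graft n x y) \<ge> birkhoff \<phi> n x + birkhoff \<phi> m y - D"
  using distortion[OF graft_in[OF assms] assms(1), of n] birkhoff_add[of \<phi> n m "graft n x y"] by simp

lemma cocycle_graft:
  assumes "x \<in> X" "y \<in> X" "x n = y 0"
  shows "cocycle G \<psi> (n + m) (graft n x y) = cocycle G \<psi> n x \<otimes> cocycle G \<psi> m y"
  using cocycle_add[OF \<psi> graft_in[OF assms], of n m] cocycle_cong[of n "graft n x y" x G \<psi>] by simp

text \<open>Concatenation of words. Only the first factor has its tail replaced, so a single factor
  \<open>exp (- D)\<close> is lost; the second block keeps its Birkhoff sum exactly.\<close>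

lemma mass_mult:
  assumes "mass n s t g r" "mass m t u h r'" "r \<ge> 0" "r' \<ge> 0"
  shows "mass (n + m) s u (g \<otimes> h) (exp (- D) * (r * r'))"
proof -
  obtain F where F: "finite F" "F \<subseteq> {x\<in>X. x 0 = s \<and> x n = t \<and> cocycle G \<psi> n x = g}"
     "\<And>x y. x \<in> F \<Longrightarrow> y \<in> F \<Longrightarrow> \<forall>i<n. x i = y i \<Longrightarrow> x = y" "r \<le> (\<Sum>x\<in>F. exp (birkhoff \<phi> n x))"
    by (rule massE[OF assms(1)]) (rule that)
  obtain F' where F': "finite F'" "F' \<subseteq> {x\<in>X. x 0 = t \<and> x m = u \<and> cocycle G \<psi> m x = h}"
     "\<And>x y. x \<in> F' \<Longrightarrow> y \<in> F' \<Longrightarrow> \<forall>i<m. x i = y i \<Longrightarrow> x = y" "r' \<le> (\<Sum>x\<in>F'. exp (birkhoff \<phi> m x))"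
    by (rule massE[OF assms(2)]) (rule that)
  let ?j = "\<lambda>(x, y). graft n x y"
  have P: "x \<in> X" "y \<in> X" "x n = y 0" "x 0 = s" "y m = u" "cocycle G \<psi> n x = g" "cocycle G \<psi> m y = h"
    if "x \<in> F" "y \<in> F'" for x y using that F(2) F'(2) by auto
  have sep: "x = x' \<and> y = y'" if "x \<in> F" "y \<in> F'" "x' \<in> F" "y' \<in> F'" "\<forall>i<n+m. graft n x y i = graft n x' y' i"
    for x y x' y'
  proof
    have "x i = x' i" if "i < n" for i
      using \<open>\<forall>i<n+m. graft n x y i = graft n x' y' i\<close>[rule_format, of i] that by simp
    then show "x = x'" by (intro F(3)[OF that(1,3)]) auto
    have "y i = y' i" if "i < m" for i
      using \<open>\<forall>i<n+m. graft n x y i = graft n x' y' i\<close>[rule_format, of "n + i"] that by (simp add: graft_def)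
    then show "y = y'" by (intro F'(3)[OF that(2,4)]) auto
  qed
  have "exp (- D) * (r * r') \<le> exp (- D) * ((\<Sum>x\<in>F. exp (birkhoff \<phi> n x)) * (\<Sum>y\<in>F'. exp (birkhoff \<phi> m y)))"
    using F(4) F'(4) assms(3,4) by (intro mult_left_mono mult_mono) (auto intro: sum_nonneg)
  also have "\<dots> = (\<Sum>(x, y)\<in>F \<times> F'. exp (birkhoff \<phi> n x + birkhoff \<phi> m y - D))"
    by (simp only: sum_product sum.cartesian_product, simp only: sum_distrib_left)
       (auto simp: exp_add exp_diff exp_minus field_simps intro!: sum.cong)
  also have "\<dots> \<le> (\<Sum>(x, y)\<in>F \<times> F'. exp (birkhoff \<phi> (n + m) (graft n x y)))"
  proof (rule sum_mono)
    fix z assume "z \<in> F \<times> F'"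
    then obtain x y where z: "z = (x, y)" and xy: "x \<in> F" "y \<in> F'" by auto
    show "(case z of (x, y) \<Rightarrow> exp (birkhoff \<phi> n x + birkhoff \<phi> m y - D))
        \<le> (case z of (x, y) \<Rightarrow> exp (birkhoff \<phi> (n + m) (graft n x y)))"
      using birkhoff_graft_ge[OF P(1-3)[OF xy], of m] z by simp
  qed
  also have "\<dots> = (\<Sum>z\<in>?j ` (F \<times> F'). exp (birkhoff \<phi> (n + m) z))"
  proof -
    have "inj_on ?j (F \<times> F')" using sep by (auto simp: inj_on_def)
    then show ?thesis by (simp add: sum.reindex case_prod_unfold)
  qed
  finally have "exp (- D) * (r * r') \<le> (\<Sum>z\<in>?j ` (F \<times> F'). exp (birkhoff \<phi> (n + m) z))" .
  moreover have "?j ` (F \<times> F') \<subseteq> {x\<in>X. x 0 = s \<and> x (n + m) = u \<and> cocycle G \<psi> (n + m) x = g \<otimes> h}"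
    using P by (auto simp: cocycle_graft graft_in graft_0) (auto simp: graft_def)
  moreover have "\<forall>z\<in>?j ` (F \<times> F'). \<forall>z'\<in>?j ` (F \<times> F'). (\<forall>i<n+m. z i = z' i) \<longrightarrow> z = z'"
  proof (intro ballI impI)
    fix z z' assume "z \<in> ?j ` (F \<times> F')" "z' \<in> ?j ` (F \<times> F')" and eq: "\<forall>i<n+m. z i = z' i"
    then obtain x y x' y' where z: "z = graft n x y" "z' = graft n x' y'"
      and m: "x \<in> F" "y \<in> F'" "x' \<in> F" "y' \<in> F'" by auto
    then show "z = z'" using sep[OF m eq[unfolded z]] by simp
  qed
  ultimately show ?thesis
    unfolding mass_def using F(1) F'(1) by (intro exI[of _ "?j ` (F \<times> F')"]) auto
qed

text \<open>The surplus factor \<open>exp D\<close> pays for the distortion of each concatenation,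
  so that no constant accumulates.\<close>

lemma mass_power:
  assumes "s \<in> S" "mass n s s \<one> (exp D * r)" "r \<ge> 0"
  shows "mass (q * n) s s \<one> (r ^ q)"
proof (induction q)
  case 0
  obtain x where "x \<in> X" "x 0 = s" by (rule point_through[OF assms(1)])
  then show ?case using mass_point[of x 0] by (simp add: birkhoff_def)
next
  case (Suc q)
  have "exp (- D) * (exp D * r * r ^ q) = (exp (- D) * exp D) * r ^ Suc q" by simp
  also have "exp (- D) * exp D = 1" by (simp only: mult_exp_exp) simp
  finally have e: "exp (- D) * (exp D * r * r ^ q) = r ^ Suc q" by simp
  have "mass (n + q * n) s s (\<one> \<otimes> \<one>) (exp (- D) * (exp D * r * r ^ q))"
    using assms(3) by (intro mass_mult[OF assms(2) Suc]) auto
  then show ?case unfolding e by simp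
qed

text \<open>One length \<open>k\<close> with enough mass yields all its multiples. Connecting words
  with trivial cocycle move the base state from \<open>b\<close> to \<open>a\<close>, and those at
  the right end are taken with lengths in every residue class modulo \<open>k\<close>.\<close>

lemma mass_all_large:
  assumes "b \<in> S" "a \<in> S" "\<And>M. \<exists>k\<ge>1. mass k b b \<one> (M * exp (s * real k))"
  obtains \<kappa> n\<^sub>0 where "\<kappa> > 0" "\<And>n. n \<ge> n\<^sub>0 \<Longrightarrow> mass n a a \<one> (\<kappa> * exp (s * real n))"
proof -
  \<comment> \<open>The constant \<open>M = exp D\<close> is the surplus that
    \<open>mass_power\<close> consumes.\<close>
  obtain k where k: "k \<ge> 1" "mass k b b \<one> (exp D * exp (s * real k))" using assms(3) by blast
  have pow: "mass (q * k) b b \<one> (exp (s * real (q * k)))" for q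
    using mass_power[OF assms(1) k(2), of q] by (simp add: exp_of_nat_mult[symmetric] mult_ac)
  obtain N where N: "\<exists>x\<in>X. x 0 = a \<and> x N = b \<and> cocycle G \<psi> N x = \<one>"
    using connecting_point[OF assms(2,1) one_closed] by (metis le_refl)
  then obtain u where u: "u \<in> X" "u 0 = a" "u N = b" "cocycle G \<psi> N u = \<one>" by blast
  obtain N' where N': "\<And>n. n \<ge> N' \<Longrightarrow> \<exists>x\<in>X. x 0 = b \<and> x n = a \<and> cocycle G \<psi> n x = \<one>"
    using connecting_point[OF assms(1,2) one_closed] by metis
  then obtain v where v: "\<And>n. n \<ge> N' \<Longrightarrow> v n \<in> X \<and> v n 0 = b \<and> v n n = a \<and> cocycle G \<psi> n (v n) = \<one>"
    by metis
  \<comment> \<open>Weights of the two connecting words, two distortion losses, and the factor that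
    compensates for the length \<open>N + r\<close> they occupy.\<close>
  define c where "c r = exp (- D) * (exp (birkhoff \<phi> N u) * (exp (- D) * exp (birkhoff \<phi> r (v r)))) * exp (- s * real (N + r))" for r
  define \<kappa> where "\<kappa> = Min (c ` {N'..<N' + k})"
  have ne: "c ` {N'..<N' + k} \<noteq> {}" using k(1) by auto
  show ?thesis
  proof (rule that[of \<kappa> "N + N'"])
    show "\<kappa> > 0" unfolding \<kappa>_def using ne by (subst Min_gr_iff) (auto simp: c_def)
    fix n assume n: "n \<ge> N + N'"
    \<comment> \<open>What exceeds the fixed lengths is divided by \<open>k\<close>; the residue
      goes into the last connecting word.\<close>
    define q where "q = (n - (N + N')) div k"
    define r where "r = N' + (n - (N + N')) mod k"
    have r: "r \<in> {N'..<N' + k}" using k(1) by (auto simp: r_def)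
    have "n - (N + N') = q * k + (r - N')" unfolding q_def r_def by simp
    then have nn: "n = N + (q * k + r)" using n r by auto
    have mv: "mass r b a \<one> (exp (birkhoff \<phi> r (v r)))"
      using mass_point[of "v r" r] v[of r] r by auto
    have mu: "mass N a b \<one> (exp (birkhoff \<phi> N u))"
      using mass_point[of u N] u by auto
    have "mass n a a (\<one> \<otimes> (\<one> \<otimes> \<one>)) (exp (- D) * (exp (birkhoff \<phi> N u) * (exp (- D) * (exp (s * real (q * k)) * exp (birkhoff \<phi> r (v r))))))"
      unfolding nn using mass_mult[OF mu mass_mult[OF pow[of q] mv]] by simp
    moreover have "exp (- D) * (exp (birkhoff \<phi> N u) * (exp (- D) * (exp (s * real (q * k)) * exp (birkhoff \<phi> r (v r)))))
        = c r * exp (s * real n)"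
      unfolding c_def nn by (simp add: exp_add[symmetric] algebra_simps)
    moreover have "\<kappa> \<le> c r" unfolding \<kappa>_def using r by (intro Min_le) auto
    ultimately show "mass n a a \<one> (\<kappa> * exp (s * real n))"
      by (auto elim!: mass_mono intro!: mult_right_mono)
  qed
qed

end

section \<open>The Green function and twisting by a character\<close>

context group_extension begin

text \<open>Return words to the state \<open>z 0\<close>, all completed by the same tail
  \<open>z\<close>. Each word has exactly one representative, so summing over points counts words
  once.\<close>

definition preimages :: "(nat \<Rightarrow> 's) \<Rightarrow> nat \<Rightarrow> (nat \<Rightarrow> 's) set" where
  "preimages z n = {x\<in>X. x 0 = z 0 \<and> (left_shift ^^ n) x = z}"

definition green_index :: "(nat \<Rightarrow> 's) \<Rightarrow> 'g \<Rightarrow> (nat \<times> (nat \<Rightarrow> 's)) set" where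
  "green_index z g = {(n, x). n \<ge> 1 \<and> x \<in> preimages z n \<and> cocycle G \<psi> n x = g}"

definition green :: "(nat \<Rightarrow> 's) \<Rightarrow> real \<Rightarrow> 'g \<Rightarrow> ennreal" where
  "green z s g = (\<Sum>\<^sub>\<infinity>(n, x)\<in>green_index z g. ennreal (exp (birkhoff \<phi> n x - s * real n)))"

lemma preimages_end: "x \<in> preimages z n \<Longrightarrow> x n = z 0"
  by (auto simp: preimages_def left_shift_funpow)

lemma preimages_graft:
  assumes "x \<in> preimages z k" "y \<in> preimages z n"
  shows "graft k x y \<in> preimages z (k + n)"
proof -
  have "x k = y 0" using preimages_end[OF assms(1)] assms(2) by (auto simp: preimages_def)
  moreover have "(left_shift ^^ (k + n)) (graft k x y) = z"
    using assms(2) left_shift_funpow_add[of n k "graft k x y"] by (simp add: preimages_def)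
  ultimately show ?thesis
    using assms by (auto simp: preimages_def graft_in graft_0)
qed

text \<open>Appending a fixed return word of length \<open>n\<close> embeds the index sets of the Green function.\<close>

lemma green_harnack:
  assumes z: "z \<in> X" and F: "finite F" "F \<subseteq> preimages z n" and g: "g \<in> carrier G"
  shows "(\<Sum>y\<in>F. ennreal (exp (birkhoff \<phi> n y - s * real n)) * green z s (g \<otimes> inv (cocycle G \<psi> n y)))
      \<le> ennreal (exp D) * green z s g"
proof -
  let ?W = "\<lambda>(k, x). ennreal (exp (birkhoff \<phi> k x - s * real k))"
  let ?T = "\<lambda>y. green_index z (g \<otimes> inv (cocycle G \<psi> n y))"
  let ?j = "\<lambda>y (k, x). (k + n, graft k x y)"
  have inX: "y \<in> X" if "y \<in> F" for y using that F(2) by (auto simp: preimages_def)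
  have cl: "cocycle G \<psi> n y \<in> carrier G" if "y \<in> F" for y using cocycle_closed[OF \<psi> inX[OF that]] .
  have one: "ennreal (exp (birkhoff \<phi> n y - s * real n)) * green z s (g \<otimes> inv (cocycle G \<psi> n y))
      \<le> ennreal (exp D) * infsum ?W (?j y ` ?T y)" if y: "y \<in> F" for y
  proof -
    have inj: "inj_on (?j y) (?T y)"
    proof (rule inj_onI, clarsimp)
      fix k x x' assume kx: "(k, x) \<in> ?T y" "(k, x') \<in> ?T y" "graft k x y = graft k x' y"
      then have "x i = x' i" if "i < k" for i using that by (metis graft_less)
      then show "x = x'"
        using kx(1,2) by (intro preimage_eqI[of k x z x']) (auto simp: green_index_def preimages_def)
    qed
    have le: "ennreal (exp (birkhoff \<phi> n y - s * real n)) * ?W p \<le> ennreal (exp D) * ?W (?j y p)"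
      if "p \<in> ?T y" for p
    proof -
      obtain k x where p: "p = (k, x)" by (cases p)
      have x: "x \<in> X" "x k = y 0"
        using that y F(2) preimages_end[of x z k] by (auto simp: p green_index_def preimages_def)
      have "(birkhoff \<phi> n y - s * real n) + (birkhoff \<phi> k x - s * real k)
          \<le> D + (birkhoff \<phi> (k + n) (graft k x y) - s * real (k + n))"
        using birkhoff_graft_ge[OF x(1) inX[OF y] x(2), of n] by (simp add: algebra_simps)
      then show ?thesis
        by (simp add: p ennreal_mult[symmetric] mult_exp_exp)
    qed
    have "ennreal (exp (birkhoff \<phi> n y - s * real n)) * green z s (g \<otimes> inv (cocycle G \<psi> n y))
        = infsum (\<lambda>p. ennreal (exp (birkhoff \<phi> n y - s * real n)) * ?W p) (?T y)"
      unfolding green_def infsum_cmult_ennreal[symmetric] by (simp add: case_prod_unfold)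
    also have "\<dots> \<le> infsum (\<lambda>p. ennreal (exp D) * ?W (?j y p)) (?T y)"
      by (rule infsum_mono) (use le in auto)
    also have "\<dots> = ennreal (exp D) * infsum ?W (?j y ` ?T y)"
      unfolding infsum_cmult_ennreal infsum_reindex[OF inj] comp_def by simp
    finally show ?thesis .
  qed
  \<comment> \<open>The total length determines \<open>k\<close>, and shifting off \<open>k\<close>
    letters of the glued point recovers \<open>y\<close>.\<close>
  have disj: "disjoint_family_on (\<lambda>y. ?j y ` ?T y) F"
    unfolding disjoint_family_on_def
  proof (intro ballI impI equals0I)
    fix y y' p assume y: "y \<in> F" "y' \<in> F" "y \<noteq> y'" and "p \<in> ?j y ` ?T y \<inter> ?j y' ` ?T y'"
    then obtain q q' where "p = ?j y q" "p = ?j y' q'" by (elim IntE imageE) (rule that)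
    then have "graft (fst q) (snd q) y = graft (fst q) (snd q') y'" by (auto simp: case_prod_unfold)
    then show False using y(3) by (metis left_shift_graft)
  qed
  have sub: "(\<Union>y\<in>F. ?j y ` ?T y) \<subseteq> green_index z g"
  proof (intro UN_least subsetI)
    fix y p assume y: "y \<in> F" and "p \<in> ?j y ` ?T y"
    then obtain k x where p: "p = (k + n, graft k x y)" and kx: "(k, x) \<in> ?T y" by auto
    then have x: "k \<ge> 1" "x \<in> preimages z k" "cocycle G \<psi> k x = g \<otimes> inv (cocycle G \<psi> n y)"
      by (auto simp: green_index_def)
    have yz: "y \<in> preimages z n" using y F(2) by auto
    have "x \<in> X" "x k = y 0" using x(2) preimages_end[OF x(2)] yz by (auto simp: preimages_def)
    then have "cocycle G \<psi> (k + n) (graft k x y) = g"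
      using cocycle_graft[of x y k n] inX[OF y] x(3) cl[OF y] g by (simp add: m_assoc)
    then show "p \<in> green_index z g"
      using preimages_graft[OF x(2) yz] x(1) by (simp add: p green_index_def)
  qed
  have "(\<Sum>y\<in>F. ennreal (exp (birkhoff \<phi> n y - s * real n)) * green z s (g \<otimes> inv (cocycle G \<psi> n y)))
      \<le> (\<Sum>y\<in>F. ennreal (exp D) * infsum ?W (?j y ` ?T y))"
    by (rule sum_mono) (rule one)
  also have "\<dots> = ennreal (exp D) * infsum ?W (\<Union>y\<in>F. ?j y ` ?T y)"
    by (simp only: sum_distrib_left[symmetric] infsum_UN_disjoint_ennreal[OF F(1) disj])
  also have "\<dots> \<le> ennreal (exp D) * green z s g"
    unfolding green_def by (intro mult_left_mono infsum_subset_ennreal sub) simp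
  finally show ?thesis .
qed

lemma return_point:
  assumes "z \<in> X" "g \<in> carrier G"
  obtains n y where "n \<ge> 1" "y \<in> preimages z n" "cocycle G \<psi> n y = g"
proof -
  have "z 0 \<in> S" using assms(1) by (auto simp: markov_shift_def)
  then obtain N where N: "\<And>n. n \<ge> N \<Longrightarrow> \<exists>x\<in>X. x 0 = z 0 \<and> x n = z 0 \<and> cocycle G \<psi> n x = g"
    using connecting_point[of "z 0" "z 0" g] assms(2) by metis
  obtain n where n: "n \<ge> 1" "n \<ge> N" using max.cobounded1 max.cobounded2 by blast
  obtain x where x: "x \<in> X" "x 0 = z 0" "x n = z 0" "cocycle G \<psi> n x = g" using N[OF n(2)] by auto
  have "graft n x z \<in> preimages z n"
    using x assms(1) by (auto simp: preimages_def graft_in graft_0)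
  moreover have "cocycle G \<psi> n (graft n x z) = g"
    using cocycle_cong[of n "graft n x z" x G \<psi>] x(4) by simp
  ultimately show ?thesis using that[of n] n(1) by simp
qed

lemma green_pos:
  assumes "z \<in> X" "g \<in> carrier G"
  shows "green z s g > 0"
proof -
  obtain n y where y: "n \<ge> 1" "y \<in> preimages z n" "cocycle G \<psi> n y = g"
    using return_point[OF assms] .
  have "0 < ennreal (exp (birkhoff \<phi> n y - s * real n))" by simp
  also have "\<dots> = (\<Sum>(n, x)\<in>{(n, y)}. ennreal (exp (birkhoff \<phi> n x - s * real n)))" by simp
  also have "\<dots> \<le> green z s g"
    unfolding green_def by (rule sum_le_infsum_ennreal) (use y in \<open>auto simp: green_index_def\<close>)
  finally show ?thesis .
qed

text \<open>
  The mean over \<open>g\<close> of the logarithmic increments \<open>ln (green (g \<gamma>)) - ln (green g)\<close> is additive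
  in \<open>\<gamma>\<close>; Jensen's inequality turns superharmonicity of the Green function into the bound.
\<close>

theorem amenable_twist:
  assumes am: "amenable G" and z: "z \<in> X" and fin: "green z s \<one> < \<infinity>"
  obtains \<rho> :: "'g \<Rightarrow> real" where
    "\<And>g h. g \<in> carrier G \<Longrightarrow> h \<in> carrier G \<Longrightarrow> \<rho> (g \<otimes> h) = \<rho> g + \<rho> h"
    "\<And>n F. finite F \<Longrightarrow> F \<subseteq> preimages z n \<Longrightarrow>
       (\<Sum>y\<in>F. exp (birkhoff \<phi> n y - s * real n + \<rho> (cocycle G \<psi> n y))) \<le> exp D"
proof -
  obtain m where "right_invariant_mean G m" by (rule amenable_right_invariant_mean[OF am])
  then interpret M: right_invariant_mean G m .
  \<comment> \<open>Finiteness at the identity spreads to \<open>g\<close> by appending one return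
    word with cocycle \<open>inv g\<close>.\<close>
  have fin_all: "green z s g < \<infinity>" if g: "g \<in> carrier G" for g
  proof -
    obtain n y where y: "n \<ge> 1" "y \<in> preimages z n" "cocycle G \<psi> n y = inv g"
      using return_point[OF z inv_closed[OF g]] .
    have "ennreal (exp (birkhoff \<phi> n y - s * real n)) * green z s g \<le> ennreal (exp D) * green z s \<one>"
      using green_harnack[OF z, of "{y}" n \<one> s] y g by simp
    also have "\<dots> < \<infinity>" using fin by (simp add: ennreal_mult_less_top)
    finally show ?thesis by (auto simp: ennreal_mult_less_top)
  qed
  define h where "h g = enn2real (green z s g)" for g
  define L where "L g = ln (h g)" for g
  have h_pos: "h g > 0" if "g \<in> carrier G" for g
    unfolding h_def using green_pos[OF z that, of s] fin_all[OF that] by (simp add: enn2real_positive_iff)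
  have green_h: "green z s g = ennreal (h g)" if "g \<in> carrier G" for g
    unfolding h_def using fin_all[OF that] by simp
  have cl: "cocycle G \<psi> n y \<in> carrier G" if "y \<in> preimages z n" for n y
    using that cocycle_closed[OF \<psi>] by (auto simp: preimages_def)
  have harnack: "(\<Sum>y\<in>F. exp (birkhoff \<phi> n y - s * real n) * exp (L (g \<otimes> inv (cocycle G \<psi> n y)) - L g)) \<le> exp D"
    if F: "finite F" "F \<subseteq> preimages z n" and g: "g \<in> carrier G" for F n g
  proof -
    have gy: "g \<otimes> inv (cocycle G \<psi> n y) \<in> carrier G" if "y \<in> F" for y
      using g cl that F(2) by auto
    have "ennreal (\<Sum>y\<in>F. exp (birkhoff \<phi> n y - s * real n) * h (g \<otimes> inv (cocycle G \<psi> n y)))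
        = (\<Sum>y\<in>F. ennreal (exp (birkhoff \<phi> n y - s * real n)) * green z s (g \<otimes> inv (cocycle G \<psi> n y)))"
      using h_pos[OF gy] by (subst sum_ennreal[symmetric]) (auto simp: ennreal_mult green_h[OF gy] less_imp_le intro!: sum.cong)
    also have "\<dots> \<le> ennreal (exp D * h g)"
      using green_harnack[OF z F g, of s] h_pos[OF g] by (simp add: green_h[OF g] ennreal_mult less_imp_le)
    finally have "(\<Sum>y\<in>F. exp (birkhoff \<phi> n y - s * real n) * h (g \<otimes> inv (cocycle G \<psi> n y))) \<le> exp D * h g"
      using h_pos[OF g] by (subst (asm) ennreal_le_iff) auto
    then have "(\<Sum>y\<in>F. exp (birkhoff \<phi> n y - s * real n) * h (g \<otimes> inv (cocycle G \<psi> n y))) / h g \<le> exp D"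
      using h_pos[OF g] by (simp add: divide_le_eq)
    moreover have "exp (L (g \<otimes> inv (cocycle G \<psi> n y)) - L g) = h (g \<otimes> inv (cocycle G \<psi> n y)) / h g" if "y \<in> F" for y
      unfolding L_def exp_diff using h_pos[OF gy[OF that]] h_pos[OF g] by simp
    ultimately show ?thesis by (simp add: sum_divide_distrib)
  qed
  \<comment> \<open>A single return word bounds the increment from above; the lower bound is the
    upper bound for \<open>inv \<gamma>\<close> at the point
    \<open>g \<otimes> \<gamma>\<close>.\<close>
  have bdd: "M.bdd (\<lambda>g. L (g \<otimes> \<gamma>) - L g)" if \<gamma>: "\<gamma> \<in> carrier G" for \<gamma>
  proof -
    have up: "\<exists>K. \<forall>g\<in>carrier G. L (g \<otimes> \<gamma>) - L g \<le> K" if \<gamma>: "\<gamma> \<in> carrier G" for \<gamma>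
    proof -
      obtain n y where y: "n \<ge> 1" "y \<in> preimages z n" "cocycle G \<psi> n y = inv \<gamma>"
        using return_point[OF z inv_closed[OF \<gamma>]] .
      have "L (g \<otimes> \<gamma>) - L g \<le> D - (birkhoff \<phi> n y - s * real n)" if "g \<in> carrier G" for g
      proof -
        have "exp ((birkhoff \<phi> n y - s * real n) + (L (g \<otimes> \<gamma>) - L g)) \<le> exp D"
          using harnack[of "{y}" n g] y that \<gamma> by (simp add: mult_exp_exp)
        then show ?thesis by simp
      qed
      then show ?thesis by blast
    qed
    obtain K where K: "\<And>g. g \<in> carrier G \<Longrightarrow> L (g \<otimes> \<gamma>) - L g \<le> K" using up[OF \<gamma>] by blast
    obtain K' where K': "\<And>g. g \<in> carrier G \<Longrightarrow> L (g \<otimes> inv \<gamma>) - L g \<le> K'" using up[OF inv_closed[OF \<gamma>]] by blast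
    have "\<bar>L (g \<otimes> \<gamma>) - L g\<bar> \<le> max K K'" if g: "g \<in> carrier G" for g
    proof -
      have "g \<otimes> \<gamma> \<otimes> inv \<gamma> = g" using g \<gamma> by (simp add: m_assoc)
      then have "L g - L (g \<otimes> \<gamma>) \<le> K'" using K'[of "g \<otimes> \<gamma>"] g \<gamma> by simp
      then show ?thesis using K[OF g] by linarith
    qed
    then show ?thesis unfolding M.bdd_def by blast
  qed
  define \<rho>' where "\<rho>' \<gamma> = M.mean (\<lambda>g. L (g \<otimes> \<gamma>) - L g)" for \<gamma>
  have mean_cong: "M.mean f = M.mean f'" if "\<And>g. g \<in> carrier G \<Longrightarrow> f g = f' g" for f f'
    unfolding M.mean_def using that by (metis (mono_tags, lifting))
  \<comment> \<open>The increment along \<open>\<gamma> \<otimes> \<gamma>'\<close> splits in two,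
    and the second part is a right translate of the increment function of \<open>\<gamma>'\<close>.
    Here the invariance of the mean enters.\<close>
  have hom: "\<rho>' (\<gamma> \<otimes> \<gamma>') = \<rho>' \<gamma> + \<rho>' \<gamma>'" if \<gamma>: "\<gamma> \<in> carrier G" "\<gamma>' \<in> carrier G" for \<gamma> \<gamma>'
  proof -
    have b: "M.bdd (\<lambda>g. L (g \<otimes> \<gamma> \<otimes> \<gamma>') - L (g \<otimes> \<gamma>))"
      using bdd[OF \<gamma>(2)] \<gamma>(1) unfolding M.bdd_def by (meson m_closed)
    have "\<rho>' (\<gamma> \<otimes> \<gamma>') = M.mean (\<lambda>g. (L (g \<otimes> \<gamma>) - L g) + (L (g \<otimes> \<gamma> \<otimes> \<gamma>') - L (g \<otimes> \<gamma>)))"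
      unfolding \<rho>'_def by (rule mean_cong) (use \<gamma> in \<open>simp add: m_assoc\<close>)
    also have "\<dots> = \<rho>' \<gamma> + M.mean (\<lambda>g. L (g \<otimes> \<gamma> \<otimes> \<gamma>') - L (g \<otimes> \<gamma>))"
      unfolding \<rho>'_def by (rule M.mean_add[OF bdd[OF \<gamma>(1)] b])
    also have "M.mean (\<lambda>g. L (g \<otimes> \<gamma> \<otimes> \<gamma>') - L (g \<otimes> \<gamma>)) = \<rho>' \<gamma>'"
      unfolding \<rho>'_def by (rule M.mean_translate[OF bdd[OF \<gamma>(2)] \<gamma>(1)])
    finally show ?thesis .
  qed
  interpret \<rho>': group_hom G "\<lparr>carrier = UNIV, mult = (+), one = (0::real)\<rparr>" \<rho>'
  proof unfold_locales
  qed (auto simp: hom_def hom Units_def intro: exI[of _ "- _"])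
  show ?thesis
  \<comment> \<open>The Harnack bound involves inverses of cocycles, so the required character is
    \<open>\<rho>'\<close> composed with inversion.\<close>
  proof (rule that[of "\<lambda>g. \<rho>' (inv g)"])
    show "\<rho>' (inv (g \<otimes> k)) = \<rho>' (inv g) + \<rho>' (inv k)" if "g \<in> carrier G" "k \<in> carrier G" for g k
      using that by (simp add: inv_mult_group hom)
    fix n F assume F: "finite F" "F \<subseteq> preimages z n"
    let ?c = "\<lambda>y. exp (birkhoff \<phi> n y - s * real n)"
    let ?l = "\<lambda>y g. L (g \<otimes> inv (cocycle G \<psi> n y)) - L g"
    have b: "M.bdd (?l y)" if "y \<in> F" for y
      by (rule bdd) (use that F(2) cl in auto)
    have bE: "M.bdd (\<lambda>g. exp (?l y g))" if y: "y \<in> F" for y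
    proof -
      obtain B where "\<And>g. g \<in> carrier G \<Longrightarrow> \<bar>?l y g\<bar> \<le> B" using b[OF y] by (auto simp: M.bdd_def)
      then show ?thesis unfolding M.bdd_def by (intro exI[of _ "exp B"]) (auto simp: abs_le_iff)
    qed
    have "(\<Sum>y\<in>F. exp (birkhoff \<phi> n y - s * real n + \<rho>' (inv (cocycle G \<psi> n y))))
        = (\<Sum>y\<in>F. ?c y * exp (M.mean (?l y)))"
      by (simp add: exp_add \<rho>'_def)
    also have "\<dots> \<le> (\<Sum>y\<in>F. ?c y * M.mean (\<lambda>g. exp (?l y g)))"
      by (intro sum_mono mult_left_mono M.exp_mean_le b) auto
    also have "\<dots> = (\<Sum>y\<in>F. M.mean (\<lambda>g. ?c y * exp (?l y g)))"
      by (intro sum.cong refl M.mean_cmult[symmetric] bE) auto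
    also have "\<dots> = M.mean (\<lambda>g. \<Sum>y\<in>F. ?c y * exp (?l y g))"
      using M.mean_sum[OF F(1), of "\<lambda>y g. ?c y * exp (?l y g)"] M.bdd_cmult[OF bE] by simp
    also have "\<dots> \<le> M.mean (\<lambda>_. exp D)"
      using M.mean_sum[OF F(1), of "\<lambda>y g. ?c y * exp (?l y g)"] M.bdd_cmult[OF bE] harnack[OF F]
      by (intro M.mean_mono M.bdd_const) auto
    finally show "(\<Sum>y\<in>F. exp (birkhoff \<phi> n y - s * real n + \<rho>' (inv (cocycle G \<psi> n y)))) \<le> exp D"
      by (simp add: M.mean_const)
  qed
qed

text \<open>Words of length \<open>k\<close> have total weight at most
  \<open>K * exp (s * k)\<close>, so at the larger parameter \<open>s'\<close> the series is
  dominated by a geometric one of ratio \<open>exp (s - s')\<close>.\<close>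

lemma green_finite:
  assumes z: "z \<in> X" and small: "\<And>k. k \<ge> 1 \<Longrightarrow> \<not> mass k (z 0) (z 0) \<one> (K * exp (s * real k))"
    and "s < s'"
  shows "green z s' \<one> < \<infinity>"
proof -
  let ?r = "exp (s - s')"
  have r: "0 < ?r" "?r < 1" using assms(3) by auto
  have small': "(\<Sum>x\<in>F. exp (birkhoff \<phi> k x)) \<le> K * exp (s * real k)"
    if "k \<ge> 1" "finite F" "F \<subseteq> {x\<in>preimages z k. cocycle G \<psi> k x = \<one>}" for k F
  proof (rule ccontr)
    assume n: "\<not> ?thesis"
    have "mass k (z 0) (z 0) \<one> (K * exp (s * real k))"
      unfolding mass_def
    proof (intro exI[of _ F] conjI ballI impI)
      show "F \<subseteq> {x \<in> X. x 0 = z 0 \<and> x k = z 0 \<and> cocycle G \<psi> k x = \<one>}"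
      proof
        fix x assume "x \<in> F"
        then have x: "x \<in> preimages z k" "cocycle G \<psi> k x = \<one>" using that(3) by auto
        then show "x \<in> {x \<in> X. x 0 = z 0 \<and> x k = z 0 \<and> cocycle G \<psi> k x = \<one>}"
          using preimages_end[OF x(1)] by (simp add: preimages_def)
      qed
      fix x y assume "x \<in> F" "y \<in> F" and eq: "\<forall>i<k. x i = y i"
      then have "x \<in> preimages z k" "y \<in> preimages z k" using that(3) by auto
      then show "x = y" using eq by (intro preimage_eqI[of k x z y]) (auto simp: preimages_def)
    qed (use that(2) n in auto)
    then show False using small[OF that(1)] by contradiction
  qed
  \<comment> \<open>The bound applies to the empty family, which forces the sign of
    \<open>K\<close>.\<close>
  have K: "K \<ge> 0"
  proof -
    have "0 \<le> K * exp (s * real 1)" using small'[of 1 "{}"] by simp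
    then show ?thesis by (simp add: zero_le_mult_iff)
  qed
  have "green z s' \<one> \<le> ennreal (K * (1 / (1 - ?r)))"
    unfolding green_def
  proof (rule infsum_le_ennreal)
    fix P assume P: "finite P" "P \<subseteq> green_index z \<one>"
    let ?w = "\<lambda>p. exp (birkhoff \<phi> (fst p) (snd p) - s' * real (fst p))"
    have inner: "(\<Sum>p\<in>{p\<in>P. fst p = k}. ?w p) \<le> K * ?r ^ k" if "k \<in> fst ` P" for k
    proof -
      have k: "k \<ge> 1" using that P(2) by (auto simp: green_index_def)
      have "(\<Sum>p\<in>{p\<in>P. fst p = k}. ?w p) = (\<Sum>x\<in>snd ` {p\<in>P. fst p = k}. exp (birkhoff \<phi> k x - s' * real k))"
        by (subst sum.reindex) (auto simp: inj_on_def prod_eq_iff)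
      also have "\<dots> = (\<Sum>x\<in>snd ` {p\<in>P. fst p = k}. exp (birkhoff \<phi> k x)) * exp (- s' * real k)"
        by (simp add: sum_distrib_right mult_exp_exp)
      also have "\<dots> \<le> (K * exp (s * real k)) * exp (- s' * real k)"
        using P k by (intro mult_right_mono small') (auto simp: green_index_def)
      also have "\<dots> = K * ?r ^ k"
        by (simp add: exp_of_nat_mult[symmetric] mult_exp_exp mult.assoc algebra_simps)
      finally show ?thesis .
    qed
    have "(\<Sum>p\<in>P. ?w p) = (\<Sum>k\<in>fst ` P. \<Sum>p\<in>{p\<in>P. fst p = k}. ?w p)"
      by (rule sum.group[symmetric]) (use P in auto)
    also have "\<dots> \<le> (\<Sum>k\<in>fst ` P. K * ?r ^ k)" by (rule sum_mono) (rule inner)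
    also have "\<dots> = K * (\<Sum>k\<in>fst ` P. ?r ^ k)" by (simp add: sum_distrib_left)
    also have "(\<Sum>k\<in>fst ` P. ?r ^ k) \<le> (\<Sum>k. ?r ^ k)"
      using r P(1) by (intro sum_le_suminf summable_geometric) auto
    also have "(\<Sum>k. ?r ^ k) = 1 / (1 - ?r)" using r by (intro suminf_geometric) auto
    finally have le: "(\<Sum>p\<in>P. ?w p) \<le> K * (1 / (1 - ?r))" using K by (simp add: mult_left_mono)
    have "(\<Sum>p\<in>P. case p of (n, x) \<Rightarrow> ennreal (exp (birkhoff \<phi> n x - s' * real n))) = ennreal (\<Sum>p\<in>P. ?w p)"
      by (subst sum_ennreal[symmetric]) (auto simp: case_prod_unfold)
    also have "\<dots> \<le> ennreal (K * (1 / (1 - ?r)))" by (rule ennreal_leI[OF le])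
    finally show "(\<Sum>p\<in>P. case p of (n, x) \<Rightarrow> ennreal (exp (birkhoff \<phi> n x - s' * real n)))
        \<le> ennreal (K * (1 / (1 - ?r)))" .
  qed
  also have "\<dots> < \<infinity>" by simp
  finally show ?thesis .
qed

end

section \<open>Comparison with the pressure minimum\<close>

definition periodic_points :: "'s set \<Rightarrow> ('s \<Rightarrow> 's \<Rightarrow> bool) \<Rightarrow> 's \<Rightarrow> nat \<Rightarrow> (nat \<Rightarrow> 's) set" where
  "periodic_points S A a n = {x \<in> markov_shift S A. (left_shift ^^ n) x = x \<and> x 0 = a}"

lemma infsum_ennreal_le_iff:
  assumes "\<And>x. f x \<ge> 0" "r \<ge> 0"
  shows "(\<Sum>\<^sub>\<infinity>x\<in>A. ennreal (f x)) \<le> ennreal r \<longleftrightarrow> (\<forall>F. finite F \<and> F \<subseteq> A \<longrightarrow> sum f F \<le> r)"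
proof
  assume le: "(\<Sum>\<^sub>\<infinity>x\<in>A. ennreal (f x)) \<le> ennreal r"
  show "\<forall>F. finite F \<and> F \<subseteq> A \<longrightarrow> sum f F \<le> r"
  proof (intro allI impI)
    fix F assume F: "finite F \<and> F \<subseteq> A"
    have "ennreal (sum f F) = (\<Sum>x\<in>F. ennreal (f x))" using assms by simp
    also have "\<dots> \<le> ennreal r" using F le by (intro order_trans[OF sum_le_infsum_ennreal le]) auto
    finally show "sum f F \<le> r" using assms(2) by (simp add: ennreal_le_iff)
  qed
next
  assume "\<forall>F. finite F \<and> F \<subseteq> A \<longrightarrow> sum f F \<le> r"
  then show "(\<Sum>\<^sub>\<infinity>x\<in>A. ennreal (f x)) \<le> ennreal r"
    using assms by (intro infsum_le_ennreal) (auto intro!: ennreal_leI)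
qed

lemma ext_ln_le: "t \<le> ennreal (exp r) \<Longrightarrow> ext_ln t \<le> ereal r"
proof -
  assume t: "t \<le> ennreal (exp r)"
  then have fin: "t \<noteq> \<infinity>" by (auto simp: top_unique)
  show ?thesis
  proof (cases "t = 0")
    case False
    then have "enn2real t > 0" "enn2real t \<le> exp r"
      using fin t by (auto simp: enn2real_positive_iff less_top zero_less_iff_neq_zero intro: enn2real_leI)
    then have "ln (enn2real t) \<le> r" by (metis exp_gt_zero ln_exp ln_le_cancel_iff)
    then show ?thesis using False fin by (simp add: ext_ln_def)
  qed (simp add: ext_ln_def)
qed

lemma le_exp_of_ext_ln_le: "ext_ln t \<le> ereal r \<Longrightarrow> t \<le> ennreal (exp r)"
proof -
  assume le: "ext_ln t \<le> ereal r"
  then have fin: "t \<noteq> \<infinity>" by (auto simp: ext_ln_def split: if_splits)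
  show ?thesis
  proof (cases "t = 0")
    case False
    then have pos: "enn2real t > 0"
      using fin by (auto simp: enn2real_positive_iff less_top zero_less_iff_neq_zero)
    have "ln (enn2real t) \<le> r" using le False fin by (simp add: ext_ln_def)
    then have "exp (ln (enn2real t)) \<le> exp r" by simp
    then have "enn2real t \<le> exp r" using pos by simp
    then have "ennreal (enn2real t) \<le> ennreal (exp r)" by (rule ennreal_leI)
    then show ?thesis using fin by (simp add: less_top)
  qed simp
qed

text \<open>The constant \<open>c\<close> disappears after division by \<open>n\<close>. With its
  converse below, this replaces the limsup of extended logarithms by inequalities between finite
  sums, where empty or infinite partition sums need no separate treatment.\<close>

lemma Gurevich_pressure_le:
  assumes "\<forall>\<^sub>F n in sequentially. \<forall>F. finite F \<and> F \<subseteq> periodic_points S A a n \<longrightarrow>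
      (\<Sum>x\<in>F. exp (birkhoff \<phi> n x)) \<le> exp (c + s * real n)"
  shows "Gurevich_pressure S A a \<phi> \<le> ereal s"
proof -
  let ?Z = "\<lambda>n. \<Sum>\<^sub>\<infinity>x\<in>periodic_points S A a n. ennreal (exp (birkhoff \<phi> n x))"
  have "\<forall>\<^sub>F n in sequentially. ext_ln (?Z n) / ereal (real n) \<le> ereal (c / real n + s)"
    using assms eventually_gt_at_top[of 0]
  proof eventually_elim
    case (elim n)
    then have "?Z n \<le> ennreal (exp (c + s * real n))"
      by (subst infsum_ennreal_le_iff) auto
    then have "ext_ln (?Z n) \<le> ereal (c + s * real n)" by (rule ext_ln_le)
    then have "ext_ln (?Z n) / ereal (real n) \<le> ereal (c + s * real n) / ereal (real n)"
      using elim(2) by (intro ereal_divide_right_mono) auto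
    also have "\<dots> = ereal (c / real n + s)" using elim(2) by (simp add: add_divide_distrib)
    finally show ?case .
  qed
  then have "limsup (\<lambda>n. ext_ln (?Z n) / ereal (real n)) \<le> limsup (\<lambda>n. ereal (c / real n + s))"
    by (rule Limsup_mono)
  also have "(\<lambda>n. ereal (c / real n + s)) \<longlonglongrightarrow> ereal (0 + s)"
    by (intro tendsto_intros lim_const_over_n)
  then have "limsup (\<lambda>n. ereal (c / real n + s)) = ereal (0 + s)"
    by (intro lim_imp_Limsup) auto
  finally show ?thesis by (simp add: Gurevich_pressure_def periodic_points_def)
qed

lemma Gurevich_pressure_less:
  assumes "Gurevich_pressure S A a \<phi> < ereal t"
  shows "\<forall>\<^sub>F n in sequentially. \<forall>F. finite F \<and> F \<subseteq> periodic_points S A a n \<longrightarrow>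
      (\<Sum>x\<in>F. exp (birkhoff \<phi> n x)) \<le> exp (t * real n)"
proof -
  let ?Z = "\<lambda>n. \<Sum>\<^sub>\<infinity>x\<in>periodic_points S A a n. ennreal (exp (birkhoff \<phi> n x))"
  have "limsup (\<lambda>n. ext_ln (?Z n) / ereal (real n)) < ereal t"
    using assms by (simp add: Gurevich_pressure_def periodic_points_def)
  then have "\<forall>\<^sub>F n in sequentially. ext_ln (?Z n) / ereal (real n) < ereal t"
    by (rule Limsup_lessD)
  then show ?thesis
    using eventually_gt_at_top[of 0]
  proof eventually_elim
    case (elim n)
    have "ext_ln (?Z n) \<le> ereal (t * real n)"
    proof (cases "ext_ln (?Z n)")
      case (real r)
      then have "r / real n < t" using elim by simp
      then show ?thesis using elim(2) real by (simp add: divide_less_eq)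
    next
      case PInf
      then show ?thesis using elim by simp
    qed simp
    then have "?Z n \<le> ennreal (exp (t * real n))" by (rule le_exp_of_ext_ln_le)
    then show ?case by (subst (asm) infsum_ennreal_le_iff) auto
  qed
qed

text \<open>\<open>\<delta>\<close> may be infinite and \<open>w\<close> arbitrarily long, so a real
  radius \<open>r\<close> strictly between \<open>norm_d d \<xi>\<close> and \<open>\<delta>\<close>
  is fixed and the step \<open>t\<close> is scaled to the remaining room.\<close>

lemma ball_d_segment:
  assumes "\<xi> \<in> ball_d d \<delta>" "\<And>i. i \<ge> d \<Longrightarrow> w i = 0"
  obtains t where "0 < t" "t \<le> 1" "(\<lambda>i. (1 - t) * \<xi> i + t * w i) \<in> ball_d d \<delta>"
proof -
  have \<xi>: "\<And>i. i \<ge> d \<Longrightarrow> \<xi> i = 0" "ereal (norm_d d \<xi>) < \<delta>"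
    using assms(1) by (auto simp: ball_d_def topspace_Euclidean_space)
  obtain r where r: "ereal (norm_d d \<xi>) < ereal r" "ereal r < \<delta>"
    using ereal_dense2[OF \<xi>(2)] by blast
  define N where "N = norm_d d w"
  have N: "N \<ge> 0" by (simp add: N_def norm_d_def)
  \<comment> \<open>The summand \<open>1\<close> keeps the denominator positive when
    \<open>w\<close> vanishes.\<close>
  define t where "t = min 1 ((r - norm_d d \<xi>) / (N + 1))"
  have t: "0 < t" "t \<le> 1" using r N by (auto simp: t_def)
  have "norm_d d (\<lambda>i. (1 - t) * \<xi> i + t * w i) \<le> L2_set (\<lambda>i. (1 - t) * \<xi> i) {..<d} + L2_set (\<lambda>i. t * w i) {..<d}"
    unfolding norm_d_def by (rule L2_set_triangle_ineq)
  also have "\<dots> = (1 - t) * norm_d d \<xi> + t * N"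
    using t unfolding norm_d_def N_def by (simp add: L2_set_right_distrib)
  also have "\<dots> \<le> norm_d d \<xi> + (r - norm_d d \<xi>)"
  proof (rule add_mono)
    have "0 \<le> norm_d d \<xi>" by (simp add: norm_d_def)
    then show "(1 - t) * norm_d d \<xi> \<le> norm_d d \<xi>" using t by (simp add: mult_left_le_one_le)
    have "t * N \<le> (r - norm_d d \<xi>) / (N + 1) * N"
      using N by (intro mult_right_mono) (auto simp: t_def)
    also have "\<dots> \<le> (r - norm_d d \<xi>) / (N + 1) * (N + 1)"
      using N r(1) by (intro mult_left_mono) auto
    finally show "t * N \<le> r - norm_d d \<xi>" using N by simp
  qed
  finally have "norm_d d (\<lambda>i. (1 - t) * \<xi> i + t * w i) \<le> r" by simp
  then have "ereal (norm_d d (\<lambda>i. (1 - t) * \<xi> i + t * w i)) < \<delta>"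
    using r(2) le_less_trans[of "ereal (norm_d d (\<lambda>i. (1 - t) * \<xi> i + t * w i))" "ereal r" \<delta>] by simp
  then show ?thesis
    using that[OF t] \<xi>(1) assms(2) by (simp add: ball_d_def topspace_Euclidean_space)
qed

lemma birkhoff_tilt_convex:
  "birkhoff (tilt d \<phi> f (\<lambda>i. (1 - t) * v i + t * w i)) n x
     = (1 - t) * birkhoff (tilt d \<phi> f v) n x + t * birkhoff (tilt d \<phi> f w) n x"
proof -
  have "tilt d \<phi> f (\<lambda>i. (1 - t) * v i + t * w i) y = (1 - t) * tilt d \<phi> f v y + t * tilt d \<phi> f w y" for y
    by (simp add: tilt_def inner_d_def algebra_simps sum.distrib sum_distrib_left sum_subtractf)
  then show ?thesis by (simp add: birkhoff_def sum.distrib sum_distrib_left)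
qed

lemma exp_convex_combination:
  assumes "0 \<le> t" "t \<le> 1"
  shows "exp ((1 - t) * a + t * b) \<le> (1 - t) * exp a + t * exp (b::real)"
  using convex_onD[OF exp_convex, of t a b] assms by (simp add: scaleR_conv_of_real)

text \<open>
  The bound at \<open>w\<close> may lie far outside the ball; log-convexity of the partition sums carries it
  to a point of the ball on the segment from \<open>\<xi>\<close> to \<open>w\<close>.
\<close>

theorem pressure_minimum_le:
  assumes min: "unique_minimum_on (ball_d d \<delta>) (\<lambda>w. Gurevich_pressure S A a (tilt d \<phi> f w)) \<xi>"
    and P: "Gurevich_pressure S A a (tilt d \<phi> f \<xi>) = ereal P"
    and w: "\<And>i. i \<ge> d \<Longrightarrow> w i = 0"
    and bound: "\<And>n F. n \<ge> 1 \<Longrightarrow> finite F \<Longrightarrow> F \<subseteq> periodic_points S A a n \<Longrightarrow>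
      (\<Sum>x\<in>F. exp (birkhoff (tilt d \<phi> f w) n x)) \<le> exp (c + s * real n)"
  shows "P \<le> s"
proof -
  obtain t where t: "0 < t" "t \<le> 1" "(\<lambda>i. (1 - t) * \<xi> i + t * w i) \<in> ball_d d \<delta>"
    using ball_d_segment[of \<xi> d \<delta> w] min w unfolding unique_minimum_on_def by blast
  let ?v = "\<lambda>i. (1 - t) * \<xi> i + t * w i"
  have Pv: "ereal P \<le> Gurevich_pressure S A a (tilt d \<phi> f ?v)"
    using min t(3) P unfolding unique_minimum_on_def by (cases "?v = \<xi>") (auto simp: less_imp_le)
  \<comment> \<open>The pressure at \<open>\<xi>\<close> bounds the sums only up to an excess rate
    \<open>\<epsilon>\<close>, which is removed at the end.\<close>
  have le: "P \<le> (1 - t) * (P + \<epsilon>) + t * s" if \<epsilon>: "\<epsilon> > 0" for \<epsilon>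
  proof -
    let ?k = "(1 - t) * (P + \<epsilon>) + t * s"
    have "Gurevich_pressure S A a (tilt d \<phi> f \<xi>) < ereal (P + \<epsilon>)" using P \<epsilon> by simp
    from Gurevich_pressure_less[OF this]
    have "\<forall>\<^sub>F n in sequentially. \<forall>F. finite F \<and> F \<subseteq> periodic_points S A a n \<longrightarrow>
      (\<Sum>x\<in>F. exp (birkhoff (tilt d \<phi> f ?v) n x)) \<le> exp (\<bar>c\<bar> + ?k * real n)"
      using eventually_ge_at_top[of 1]
    proof eventually_elim
      case (elim n)
      show ?case
      proof (intro allI impI)
        fix F assume F: "finite F \<and> F \<subseteq> periodic_points S A a n"
        let ?a = "\<lambda>x. birkhoff (tilt d \<phi> f \<xi>) n x" and ?b = "\<lambda>x. birkhoff (tilt d \<phi> f w) n x"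
        \<comment> \<open>Dividing by the two growth rates first brings both sums to bounded size,
          so that pointwise convexity of \<open>exp\<close> does the work of Hoelder's
          inequality.\<close>
        have "(\<Sum>x\<in>F. exp (birkhoff (tilt d \<phi> f ?v) n x))
            = exp (?k * real n) * (\<Sum>x\<in>F. exp ((1 - t) * (?a x - (P + \<epsilon>) * real n) + t * (?b x - s * real n)))"
          unfolding birkhoff_tilt_convex sum_distrib_left mult_exp_exp
          by (intro sum.cong refl arg_cong[of _ _ exp]) (simp add: algebra_simps)
        also have "\<dots> \<le> exp (?k * real n) * (\<Sum>x\<in>F. (1 - t) * exp (?a x - (P + \<epsilon>) * real n) + t * exp (?b x - s * real n))"
          using t by (intro mult_left_mono sum_mono exp_convex_combination) auto
        also have "(\<Sum>x\<in>F. (1 - t) * exp (?a x - (P + \<epsilon>) * real n) + t * exp (?b x - s * real n))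
            = (1 - t) * ((\<Sum>x\<in>F. exp (?a x)) / exp ((P + \<epsilon>) * real n)) + t * ((\<Sum>x\<in>F. exp (?b x)) / exp (s * real n))"
          by (simp add: sum.distrib sum_distrib_left sum_divide_distrib exp_diff)
        also have "\<dots> \<le> (1 - t) * exp \<bar>c\<bar> + t * exp \<bar>c\<bar>"
        proof (intro add_mono mult_left_mono)
          have "(\<Sum>x\<in>F. exp (?a x)) \<le> exp ((P + \<epsilon>) * real n)" using elim(1) F by blast
          then have "(\<Sum>x\<in>F. exp (?a x)) / exp ((P + \<epsilon>) * real n) \<le> 1" by (simp add: divide_le_eq)
          also have "\<dots> \<le> exp \<bar>c\<bar>" by simp
          finally show "(\<Sum>x\<in>F. exp (?a x)) / exp ((P + \<epsilon>) * real n) \<le> exp \<bar>c\<bar>" .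
          have "(\<Sum>x\<in>F. exp (?b x)) \<le> exp c * exp (s * real n)"
            using bound[of n F] elim(2) F by (simp add: mult_exp_exp)
          then have "(\<Sum>x\<in>F. exp (?b x)) / exp (s * real n) \<le> exp c" by (simp add: divide_le_eq)
          also have "\<dots> \<le> exp \<bar>c\<bar>" by simp
          finally show "(\<Sum>x\<in>F. exp (?b x)) / exp (s * real n) \<le> exp \<bar>c\<bar>" .
        qed (use t in auto)
        also have "\<dots> = exp \<bar>c\<bar>" by (simp add: algebra_simps)
        finally show "(\<Sum>x\<in>F. exp (birkhoff (tilt d \<phi> f ?v) n x)) \<le> exp (\<bar>c\<bar> + ?k * real n)"
          by (simp add: exp_add mult.commute)
      qed
    qed
    then have "Gurevich_pressure S A a (tilt d \<phi> f ?v) \<le> ereal ?k" by (rule Gurevich_pressure_le)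
    with Pv have "ereal P \<le> ereal ?k" by (rule order_trans)
    then show ?thesis by simp
  qed
  \<comment> \<open>The part \<open>(1 - t) * P\<close> cancels as the excess tends to zero; the
    factor \<open>t\<close> is positive and can be divided out.\<close>
  have "t * P \<le> t * s"
  proof (rule field_le_epsilon)
    fix e :: real assume e: "e > 0"
    have "(1 - t) * (P + e) \<le> (1 - t) * P + e"
      using t e by (simp add: distrib_left mult_left_le_one_le)
    then show "t * P \<le> t * s + e" using le[OF e] by (simp add: algebra_simps)
  qed
  then show ?thesis using t(1) by simp
qed

text \<open>\<open>lattice_map\<close> reads a single letter, so the tilt contributes equally to
  both sums and one distortion constant serves for every \<open>w\<close>.\<close>

lemma birkhoff_tilt_distortion:
  assumes "\<And>i. i < n \<Longrightarrow> x i = y i"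
  shows "birkhoff (tilt d \<phi> (lattice_map G \<iota> \<psi>) w) n x - birkhoff (tilt d \<phi> (lattice_map G \<iota> \<psi>) w) n y
       = birkhoff \<phi> n x - birkhoff \<phi> n y"
  unfolding birkhoff_def sum_subtractf[symmetric]
  by (rule sum.cong[OF refl], rule tilt_diff) (use assms in \<open>simp add: left_shift_funpow\<close>)

theorem (in group_extension) return_mass_growth:
  assumes \<iota>: "\<iota> \<in> iso (free_abelianization G) (int_lattice d)" and am: "amenable G"
    and b: "b \<in> S" and a: "a \<in> S"
    and min: "unique_minimum_on (ball_d d \<delta>) (\<lambda>w. Gurevich_pressure S A b (tilt d \<phi> (lattice_map G \<iota> \<psi>) w)) \<xi>"
    and P: "Gurevich_pressure S A b (tilt d \<phi> (lattice_map G \<iota> \<psi>) \<xi>) = ereal P"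
    and s: "s < P"
  obtains \<kappa> n\<^sub>0 where "\<kappa> > 0" "\<And>n. n \<ge> n\<^sub>0 \<Longrightarrow> mass n a a \<one> (\<kappa> * exp (s * real n))"
proof (rule mass_all_large[OF b a])
  interpret lattice_identification G \<iota> d by unfold_locales (rule \<iota>)
  fix M
  show "\<exists>k\<ge>1. mass k b b \<one> (M * exp (s * real k))"
  proof (rule ccontr)
    assume no: "\<not> ?thesis"
    obtain z where z: "z \<in> X" "z 0 = b" by (rule point_through[OF b])
    \<comment> \<open>Both gaps are used: from \<open>s\<close> to \<open>s'\<close> for convergence
      of the Green function, from \<open>s'\<close> to \<open>P\<close> for the
      contradiction.\<close>
    define s' where "s' = (s + P) / 2"
    have s': "s < s'" "s' < P" using s by (auto simp: s'_def)
    have "green z s' \<one> < \<infinity>" by (rule green_finite[OF z(1) _ s'(1)]) (use no z(2) in auto)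
    then obtain \<rho> where \<rho>: "\<And>g h. g \<in> carrier G \<Longrightarrow> h \<in> carrier G \<Longrightarrow> \<rho> (g \<otimes> h) = \<rho> g + \<rho> h"
      "\<And>n F. finite F \<Longrightarrow> F \<subseteq> preimages z n \<Longrightarrow>
       (\<Sum>y\<in>F. exp (birkhoff \<phi> n y - s' * real n + \<rho> (cocycle G \<psi> n y))) \<le> exp D"
      by (rule amenable_twist[OF am z(1)]) (rule that)
    obtain w where w: "\<And>i. i \<ge> d \<Longrightarrow> w i = 0"
      "\<And>g. g \<in> carrier G \<Longrightarrow> \<rho> g = inner_d d w (\<lambda>i. real_of_int (lattice_proj g i))"
      by (rule real_hom_factors[of \<rho>]) (rule \<rho>(1), assumption+, rule that)
    let ?f = "lattice_map G \<iota> \<psi>"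
    have "P \<le> s'"
    proof (rule pressure_minimum_le[OF min P w(1)])
      fix n F assume n: "n \<ge> 1" and F: "finite F" "F \<subseteq> periodic_points S A b n"
      have FX: "x \<in> X" "x n = z 0" "x 0 = z 0" if "x \<in> F" for x
      proof -
        have "x \<in> X" "x 0 = b" "(left_shift ^^ n) x = x" using F(2) that by (auto simp: periodic_points_def)
        then show "x \<in> X" "x n = z 0" "x 0 = z 0" using z(2) by (auto simp: left_shift_funpow dest: fun_cong[of _ _ 0])
      qed
      \<comment> \<open>Pressure sums run over periodic points, the twisted bound over preimages of
        \<open>z\<close>. Keeping the first \<open>n\<close> letters and exchanging the tail is
        injective and costs one factor \<open>exp D\<close>; a second one comes from the twisted
        bound.\<close>
      have inj: "inj_on (\<lambda>x. graft n x z) F"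
      proof (rule inj_onI)
        fix x y assume xy: "x \<in> F" "y \<in> F" "graft n x z = graft n y z"
        show "x = y"
        proof (rule periodic_eqI[OF _ _ n])
          show "x i = y i" if "i < n" for i using xy(3) that by (metis graft_less)
        qed (use xy F(2) in \<open>auto simp: periodic_points_def\<close>)
      qed
      have pre: "(\<lambda>x. graft n x z) ` F \<subseteq> preimages z n"
        using FX z(1) by (auto simp: preimages_def graft_in graft_0)
      have "(\<Sum>x\<in>F. exp (birkhoff (tilt d \<phi> ?f w) n x))
          \<le> (\<Sum>x\<in>F. exp (D + s' * real n) * exp (birkhoff \<phi> n (graft n x z) - s' * real n + \<rho> (cocycle G \<psi> n (graft n x z))))"
      proof (rule sum_mono)
        fix x assume x: "x \<in> F"
        let ?y = "graft n x z"
        have y: "?y \<in> X" using graft_in[of x S A z n] FX[OF x] z(1) by simp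
        have "birkhoff (tilt d \<phi> ?f w) n x \<le> D + birkhoff (tilt d \<phi> ?f w) n ?y"
          using birkhoff_tilt_distortion[of n x ?y d \<phi> G \<iota> \<psi> w] distortion[OF FX(1)[OF x] y, of n] by simp
        also have "birkhoff (tilt d \<phi> ?f w) n ?y = birkhoff \<phi> n ?y + \<rho> (cocycle G \<psi> n ?y)"
          using birkhoff_tilt[OF \<psi> y] w(2) cocycle_closed[OF \<psi> y] by simp
        finally show "exp (birkhoff (tilt d \<phi> ?f w) n x)
            \<le> exp (D + s' * real n) * exp (birkhoff \<phi> n ?y - s' * real n + \<rho> (cocycle G \<psi> n ?y))"
          by (simp add: mult_exp_exp)
      qed
      also have "\<dots> = exp (D + s' * real n) * (\<Sum>y\<in>(\<lambda>x. graft n x z) ` F. exp (birkhoff \<phi> n y - s' * real n + \<rho> (cocycle G \<psi> n y)))"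
        by (simp add: sum.reindex[OF inj] sum_distrib_left)
      also have "\<dots> \<le> exp (D + s' * real n) * exp D"
        using F(1) pre by (intro mult_left_mono \<rho>(2)) auto
      finally show "(\<Sum>x\<in>F. exp (birkhoff (tilt d \<phi> ?f w) n x)) \<le> exp (2 * D + s' * real n)"
        by (simp add: mult_exp_exp algebra_simps)
    qed
    then show False using s'(2) by simp
  qed
qed (use that in blast)

section \<open>A mean ergodic theorem\<close>

locale measure_preserving_system = prob_space M for M :: "'a measure" +
  fixes T :: "'a \<Rightarrow> 'a" and B :: "'a set"
  assumes T_meas [measurable]: "T \<in> M \<rightarrow>\<^sub>M M"
    and T_inv: "distr M M T = M"
    and B_sets [measurable]: "B \<in> sets M"
begin

definition f :: "'a \<Rightarrow> real" where "f x = indicator B x - measure M B"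

definition avg :: "nat \<Rightarrow> 'a \<Rightarrow> real" where "avg m x = (\<Sum>j<m. f ((T ^^ j) x)) / real m"

lemma T_pow_meas [measurable]: "(T ^^ j) \<in> M \<rightarrow>\<^sub>M M"
  by (induction j) auto

lemma f_meas [measurable]: "f \<in> borel_measurable M"
  unfolding f_def[abs_def] by measurable

lemma avg_meas [measurable]: "avg m \<in> borel_measurable M"
  unfolding avg_def[abs_def] by measurable

lemma distr_T_pow: "distr M M (T ^^ j) = M"
proof (induction j)
  case (Suc j)
  have "distr (distr M M (T ^^ j)) M T = distr M M (T \<circ> T ^^ j)"
    by (rule distr_distr) auto
  then show ?case by (simp only: Suc T_inv funpow.simps)
qed (simp add: id_def distr_id)

lemma integral_T_pow:
  fixes u :: "'a \<Rightarrow> real"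
  assumes [measurable]: "u \<in> borel_measurable M"
  shows "(\<integral>x. u ((T ^^ j) x) \<partial>M) = (\<integral>x. u x \<partial>M)"
  using integral_distr[of "T ^^ j" M M u] by (simp add: distr_T_pow)

lemma integrable_bounded: "u \<in> borel_measurable M \<Longrightarrow> (\<And>x. \<bar>u x\<bar> \<le> K) \<Longrightarrow> integrable M u"
  for u :: "'a \<Rightarrow> real"
  by (rule integrable_const_bound[of _ K]) auto

lemma f_bound: "\<bar>f x\<bar> \<le> 1"
  using measure_nonneg[of M B] prob_le_1[of B] by (auto simp: f_def indicator_def)

lemma avg_bound: "\<bar>avg m x\<bar> \<le> 1"
proof (cases "m = 0")
  case False
  have "\<bar>\<Sum>j<m. f ((T ^^ j) x)\<bar> \<le> (\<Sum>j<m. 1)"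
    by (rule order_trans[OF sum_abs]) (intro sum_mono f_bound)
  then show ?thesis using False by (simp add: avg_def divide_le_eq)
qed (simp add: avg_def)

lemma integral_f: "(\<integral>x. f x \<partial>M) = 0"
proof -
  have "(\<integral>x. f x \<partial>M) = (\<integral>x. indicator B x \<partial>M) - (\<integral>x. measure M B \<partial>M)"
    unfolding f_def by (rule Bochner_Integration.integral_diff) (auto intro: integrable_bounded[of _ 1])
  then show ?thesis by (simp add: prob_space)
qed

lemma integral_avg: "(\<integral>x. avg m x \<partial>M) = 0"
proof -
  have "(\<integral>x. avg m x \<partial>M) = (\<Sum>j<m. (\<integral>x. f ((T ^^ j) x) \<partial>M)) / real m"
    unfolding avg_def
    by (subst integral_divide_zero, subst Bochner_Integration.integral_sum) (auto intro!: integrable_bounded f_bound)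
  then show ?thesis by (simp add: integral_T_pow integral_f)
qed

lemma avg_T: "n \<ge> 1 \<Longrightarrow> \<bar>avg n (T x) - avg n x\<bar> \<le> 2 / real n"
proof -
  assume n: "n \<ge> 1"
  have "(\<Sum>j<n. f ((T ^^ j) (T x))) - (\<Sum>j<n. f ((T ^^ j) x)) = f ((T ^^ n) x) - f x" for n
    by (induction n) (auto simp: funpow_swap1)
  then have "avg n (T x) - avg n x = (f ((T ^^ n) x) - f x) / real n"
    by (simp add: avg_def diff_divide_distrib[symmetric])
  moreover have "\<bar>f ((T ^^ n) x) - f x\<bar> \<le> 2"
    using f_bound[of "(T ^^ n) x"] f_bound[of x] by linarith
  ultimately show ?thesis using n by (simp add: divide_right_mono)
qed

lemma avg_T_pow: "n \<ge> 1 \<Longrightarrow> \<bar>avg n ((T ^^ h) x) - avg n x\<bar> \<le> 2 * real h / real n"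
proof (induction h)
  case (Suc h)
  then show ?case
    using avg_T[of n "(T ^^ h) x"] by (simp add: add_divide_distrib distrib_left)
qed simp

text \<open>Exchanging the two summations turns a time average of \<open>avg m\<close> into an
  average of \<open>avg n\<close> over \<open>m\<close> shifts, and \<open>avg n\<close> changes by
  at most \<open>2 * j / n\<close> under \<open>j\<close> shifts.\<close>

lemma sum_avg_shift:
  assumes "n \<ge> 1" "m \<ge> 1"
  shows "\<bar>(\<Sum>i<n. avg m ((T ^^ i) x)) / real n - avg n x\<bar> \<le> 2 * real m / real n"
proof -
  have "(\<Sum>i<n. avg m ((T ^^ i) x)) / real n = (\<Sum>i<n. \<Sum>j<m. f ((T ^^ i) ((T ^^ j) x))) / real m / real n"
    unfolding avg_def
    by (simp add: sum_divide_distrib[symmetric] funpow_add[symmetric, THEN fun_cong, unfolded comp_def] add.commute)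
  also have "(\<Sum>i<n. \<Sum>j<m. f ((T ^^ i) ((T ^^ j) x))) = (\<Sum>j<m. \<Sum>i<n. f ((T ^^ i) ((T ^^ j) x)))"
    by (rule sum.swap)
  also have "\<dots> / real m / real n = (\<Sum>j<m. avg n ((T ^^ j) x)) / real m"
    by (simp add: avg_def sum_divide_distrib mult.commute)
  finally have e: "(\<Sum>i<n. avg m ((T ^^ i) x)) / real n - avg n x = (\<Sum>j<m. avg n ((T ^^ j) x) - avg n x) / real m"
    using assms by (simp add: sum_subtractf diff_divide_distrib)
  have "\<bar>\<Sum>j<m. avg n ((T ^^ j) x) - avg n x\<bar> \<le> (\<Sum>j<m. 2 * real m / real n)"
  proof (rule order_trans[OF sum_abs], rule sum_mono)
    fix j assume "j \<in> {..<m}"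
    then have "2 * real j / real n \<le> 2 * real m / real n" by (intro divide_right_mono) auto
    then show "\<bar>avg n ((T ^^ j) x) - avg n x\<bar> \<le> 2 * real m / real n"
      using avg_T_pow[OF assms(1), of j x] by linarith
  qed
  then show ?thesis unfolding e using assms(2) by (simp add: divide_le_eq mult.commute)
qed

section \<open>Second moments and the Cauchy property in L2\<close>

definition q :: "nat \<Rightarrow> real" where "q m = (\<integral>x. (avg m x)\<^sup>2 \<partial>M)"

lemma avg_sq_bound: "\<bar>(avg m x)\<^sup>2\<bar> \<le> 1"
  using avg_bound[of m x] by (simp add: abs_square_le_1)

lemma q_nonneg: "q m \<ge> 0"
  unfolding q_def by simp

lemma square_mean_le:
  assumes "N \<ge> 1"
  shows "((\<Sum>i<N. a i) / real N)\<^sup>2 \<le> (\<Sum>i<N. (a i)\<^sup>2) / real N"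
proof -
  have "(\<Sum>i<N. a i)\<^sup>2 \<le> real N * (\<Sum>i<N. (a i)\<^sup>2)"
    using Cauchy_Schwarz_ineq_sum[of "\<lambda>_. 1" a "{..<N}"] by simp
  then show ?thesis using assms by (simp add: divide_simps power2_eq_square mult.commute)
qed

text \<open>Averaging contracts the second moment, and it moves any convex combination of ergodic averages to \<open>avg N\<close>.\<close>

lemma q_le_mix:
  assumes "m \<ge> 1" "n \<ge> 1" "N \<ge> 1"
  shows "q N \<le> (\<integral>x. ((avg m x + avg n x) / 2)\<^sup>2 \<partial>M) + 4 * real (max m n) / real N"
proof -
  let ?w = "\<lambda>x. (avg m x + avg n x) / 2"
  let ?A = "\<lambda>x. (\<Sum>i<N. ?w ((T ^^ i) x)) / real N"
  let ?e = "2 * real (max m n) / real N"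
  have w1: "\<bar>?w x\<bar> \<le> 1" for x
    using avg_bound[of m x] avg_bound[of n x] unfolding abs_le_iff by simp
  have w2: "\<bar>(?w x)\<^sup>2\<bar> \<le> 1" for x using w1[of x] by (simp add: abs_square_le_1)
  have A1: "\<bar>?A x\<bar> \<le> 1" for x
  proof -
    have "\<bar>\<Sum>i<N. ?w ((T ^^ i) x)\<bar> \<le> (\<Sum>i<N. 1)"
      by (rule order_trans[OF sum_abs]) (intro sum_mono w1)
    then show ?thesis using assms(3) by (simp add: divide_le_eq)
  qed
  have close: "\<bar>?A x - avg N x\<bar> \<le> ?e" for x
  proof -
    have half: "\<bar>(u + v) / 2\<bar> \<le> e" if "\<bar>u\<bar> \<le> e" "\<bar>v\<bar> \<le> e" for u v e :: real
      using that by (auto simp: abs_le_iff field_simps)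
    have "2 * real m / real N \<le> ?e" "2 * real n / real N \<le> ?e"
      by (intro divide_right_mono; simp)+
    then have "\<bar>(\<Sum>i<N. avg m ((T ^^ i) x)) / real N - avg N x\<bar> \<le> ?e"
      "\<bar>(\<Sum>i<N. avg n ((T ^^ i) x)) / real N - avg N x\<bar> \<le> ?e"
      using sum_avg_shift[OF assms(3,1), of x] sum_avg_shift[OF assms(3,2), of x] by (meson order_trans)+
    from half[OF this] show ?thesis
      by (simp add: sum.distrib sum_divide_distrib[symmetric] add_divide_distrib diff_divide_distrib)
  qed
  \<comment> \<open>A difference of squares; both quantities are bounded by one, so their sum is at
    most two.\<close>
  have pt: "(avg N x)\<^sup>2 \<le> (?A x)\<^sup>2 + 2 * ?e" for x
  proof -
    have "(avg N x)\<^sup>2 - (?A x)\<^sup>2 = (avg N x - ?A x) * (avg N x + ?A x)" by (simp add: power2_eq_square algebra_simps)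
    also have "\<dots> \<le> \<bar>avg N x - ?A x\<bar> * \<bar>avg N x + ?A x\<bar>" by (simp add: abs_mult[symmetric])
    also have "\<dots> \<le> ?e * 2"
      using close[of x] A1[of x] avg_bound[of N x] by (intro mult_mono) linarith+
    finally show ?thesis by simp
  qed
  have i1: "integrable M (\<lambda>x. (?w ((T ^^ i) x))\<^sup>2)" for i
    by (rule integrable_bounded[of _ 1]) (use w2 in auto)
  have "q N \<le> (\<integral>x. (\<Sum>i<N. (?w ((T ^^ i) x))\<^sup>2) / real N + 2 * ?e \<partial>M)"
    unfolding q_def
  proof (rule integral_mono)
    show "integrable M (\<lambda>x. (avg N x)\<^sup>2)"
      by (rule integrable_bounded[of _ 1]) (use avg_sq_bound in auto)
    show "integrable M (\<lambda>x. (\<Sum>i<N. (?w ((T ^^ i) x))\<^sup>2) / real N + 2 * ?e)"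
      using i1 by auto
    show "(avg N x)\<^sup>2 \<le> (\<Sum>i<N. (?w ((T ^^ i) x))\<^sup>2) / real N + 2 * ?e" for x
      using pt[of x] square_mean_le[OF assms(3), of "\<lambda>i. ?w ((T ^^ i) x)"] by linarith
  qed
  also have "\<dots> = (\<Sum>i<N. (\<integral>x. (?w ((T ^^ i) x))\<^sup>2 \<partial>M)) / real N + 2 * ?e"
    using i1 by (simp add: prob_space)
  also have "(\<Sum>i<N. (\<integral>x. (?w ((T ^^ i) x))\<^sup>2 \<partial>M)) = real N * (\<integral>x. (?w x)\<^sup>2 \<partial>M)"
    using integral_T_pow[of "\<lambda>x. (?w x)\<^sup>2"] by simp
  finally show ?thesis using assms(3) by simp
qed

lemma q_decay: "m \<ge> 1 \<Longrightarrow> N \<ge> 1 \<Longrightarrow> q N \<le> q m + 4 * real m / real N"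
  using q_le_mix[of m m N] by (simp add: q_def)

definition q_inf :: real where "q_inf = (INF m\<in>{1..}. q m)"

lemma q_inf_le: "m \<ge> 1 \<Longrightarrow> q_inf \<le> q m"
  unfolding q_inf_def by (rule cINF_lower) (use q_nonneg in \<open>auto intro!: bdd_belowI2\<close>)

lemma q_inf_approx: "e > 0 \<Longrightarrow> \<exists>m\<ge>1. q m \<le> q_inf + e"
proof (rule ccontr)
  assume e: "e > 0" and no: "\<not> (\<exists>m\<ge>1. q m \<le> q_inf + e)"
  have "q_inf + e \<le> q m" if "m \<ge> 1" for m using no that by (meson less_imp_le not_le)
  then have "q_inf + e \<le> (INF m\<in>{1..}. q m)" by (intro cINF_greatest) auto
  then show False using e by (simp add: q_inf_def)
qed

text \<open>Von Neumann's argument: by the parallelogram law, elements of nearly minimal norm in a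
  convex set are close. The midpoint need not be an ergodic average, but its second moment is at
  least \<open>q_inf\<close> because its own long averages approach \<open>avg N\<close>.\<close>

lemma L2_close:
  assumes "m \<ge> 1" "n \<ge> 1"
  shows "(\<integral>x. (avg m x - avg n x)\<^sup>2 \<partial>M) \<le> 2 * (q m - q_inf) + 2 * (q n - q_inf)"
proof -
  let ?w = "\<lambda>x. (avg m x + avg n x) / 2"
  have w1: "\<bar>?w x\<bar> \<le> 1" for x
    using avg_bound[of m x] avg_bound[of n x] unfolding abs_le_iff by simp
  have w2: "\<bar>(?w x)\<^sup>2\<bar> \<le> 1" for x using w1[of x] by (simp add: abs_square_le_1)
  have "q_inf \<le> (\<integral>x. (?w x)\<^sup>2 \<partial>M) + e" if e: "e > 0" for e
  proof -
    obtain N :: nat where "N > 4 * real (max m n) / e" using reals_Archimedean2 by blast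
    then have N: "real (Suc N) > 4 * real (max m n) / e" by simp
    have "4 * real (max m n) / real (Suc N) \<le> e"
      using N e by (simp add: field_simps)
    then show ?thesis using q_inf_le[of "Suc N"] q_le_mix[OF assms, of "Suc N"] by linarith
  qed
  then have w: "q_inf \<le> (\<integral>x. (?w x)\<^sup>2 \<partial>M)" by (rule field_le_epsilon)
  have "(\<integral>x. (avg m x - avg n x)\<^sup>2 \<partial>M) = (\<integral>x. 2 * (avg m x)\<^sup>2 + 2 * (avg n x)\<^sup>2 - 4 * (?w x)\<^sup>2 \<partial>M)"
    by (rule Bochner_Integration.integral_cong) (auto simp: power2_eq_square field_simps)
  also have "\<dots> = 2 * q m + 2 * q n - 4 * (\<integral>x. (?w x)\<^sup>2 \<partial>M)"
  proof -
    have "integrable M (\<lambda>x. (avg k x)\<^sup>2)" for k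
      by (rule integrable_bounded[of _ 1]) (use avg_sq_bound in auto)
    moreover have "integrable M (\<lambda>x. (?w x)\<^sup>2)"
      by (rule integrable_bounded[of _ 1]) (use w2 in auto)
    ultimately show ?thesis by (simp add: q_def)
  qed
  finally show ?thesis using w by simp
qed

text \<open>For a bounded variable of mean zero, one-sided control suffices: pointwise
  \<open>W\<close> is at most \<open>s\<close>, plus one where it reaches \<open>s\<close>, minus
  \<open>\<eta>\<close> where it is below \<open>- \<eta>\<close>. Integration bounds the
  probability of the last event.\<close>

lemma prob_deviation_le:
  fixes W :: "'a \<Rightarrow> real"
  assumes [measurable]: "W \<in> borel_measurable M" and W: "\<And>x. \<bar>W x\<bar> \<le> 1" "(\<integral>x. W x \<partial>M) = 0"
    and s: "0 < s" "s \<le> \<eta>" and r: "prob {x\<in>space M. W x \<ge> s} \<le> r"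
  shows "prob {x\<in>space M. \<bar>W x\<bar> \<ge> \<eta>} \<le> r + (s + r) / \<eta>"
proof -
  let ?P = "{x\<in>space M. W x \<ge> s}" and ?Q = "{x\<in>space M. W x \<le> - \<eta>}"
  have i: "integrable M (indicator ?P :: 'a \<Rightarrow> real)" "integrable M (indicator ?Q :: 'a \<Rightarrow> real)"
    by (rule integrable_bounded[of _ 1]; auto simp: indicator_def)+
  have "0 \<le> (\<integral>x. s + indicator ?P x - \<eta> * indicator ?Q x \<partial>M)"
    unfolding W(2)[symmetric]
  proof (rule integral_mono)
    show "integrable M W" by (rule integrable_bounded[of _ 1]) (use W in auto)
    fix x assume "x \<in> space M"
    then show "W x \<le> s + indicator ?P x - \<eta> * indicator ?Q x"
      using W(1)[of x] s by (auto simp: indicator_def)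
  qed (use i in auto)
  also have "\<dots> = s + prob ?P - \<eta> * prob ?Q"
    using i by (simp add: prob_space)
  finally have "\<eta> * prob ?Q \<le> s + r" using r by simp
  then have Q: "prob ?Q \<le> (s + r) / \<eta>" using s by (simp add: le_divide_eq mult.commute)
  have "prob {x\<in>space M. \<bar>W x\<bar> \<ge> \<eta>} \<le> prob (?P \<union> ?Q)"
    by (rule finite_measure_mono) (use s in auto)
  also have "\<dots> \<le> prob ?P + prob ?Q" by (rule measure_Un_le) auto
  finally show ?thesis using r Q by simp
qed

text \<open>A quantitative substitute for ergodicity. Averages that are close in L2 seldom lie
  clearly on opposite sides of zero, whereas the gap hypothesis bounds the probability of that below
  by a multiple of the product of two one-sided probabilities; hence one of these is small. It
  matters that \<open>c\<close> does not depend on \<open>m\<close>.\<close>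

theorem small_deviation_probability:
  assumes c: "c > 0"
    and gap: "\<And>m. m \<ge> 1 \<Longrightarrow> \<exists>h. \<forall>n\<ge>1. \<forall>s t.
       c * prob {x\<in>space M. avg m x \<ge> s} * prob {x\<in>space M. avg n x \<le> t}
         \<le> prob {x\<in>space M. avg m x \<ge> s \<and> avg n ((T ^^ h) x) \<le> t}"
    and \<eta>: "\<eta> > 0" and \<kappa>: "\<kappa> > 0"
  shows "\<exists>m\<ge>max 1 m\<^sub>0. prob {x\<in>space M. \<bar>avg m x\<bar> \<ge> \<eta>} \<le> \<kappa>"
proof -
  \<comment> \<open>With these choices of \<open>s\<close> and \<open>r\<close> the bound
    \<open>r + (s + r) / \<eta>\<close> from \<open>prob_deviation_le\<close> stays below
    \<open>\<kappa>\<close>.\<close>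
  define s where "s = min \<eta> (\<kappa> / 4 * \<eta>)"
  define r where "r = min (\<kappa> / 4) (\<kappa> / 4 * \<eta>)"
  have s: "0 < s" "s \<le> \<eta>" "s / \<eta> \<le> \<kappa> / 4" and r: "0 < r" "r \<le> \<kappa> / 4" "r / \<eta> \<le> \<kappa> / 4"
    using \<eta> \<kappa> by (auto simp: s_def r_def divide_le_eq)
  \<comment> \<open>Chosen so that Markov's inequality, with second moment at most
    \<open>8 * \<epsilon>\<close>, gives exactly \<open>c * (r * r)\<close>.\<close>
  define \<epsilon> where "\<epsilon> = c * s\<^sup>2 * r\<^sup>2 / 8"
  have \<epsilon>: "\<epsilon> > 0" using c s r by (simp add: \<epsilon>_def)
  obtain m\<^sub>1 where m\<^sub>1: "m\<^sub>1 \<ge> 1" "q m\<^sub>1 \<le> q_inf + \<epsilon>" using q_inf_approx[OF \<epsilon>] by blast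
  have late: "\<exists>n\<ge>k. n \<ge> 1 \<and> K / real n \<le> e" if e: "e > 0" for k K e
  proof -
    obtain N :: nat where "N > K / e" using reals_Archimedean2 by blast
    then have "real (N + k + 1) > K / e" by simp
    then show ?thesis using e by (intro exI[of _ "N + k + 1"]) (auto simp: field_simps)
  qed
  obtain m where m: "m \<ge> m\<^sub>0" "m \<ge> 1" "4 * real m\<^sub>1 / real m \<le> \<epsilon>"
    using late[OF \<epsilon>, of m\<^sub>0 "4 * real m\<^sub>1"] by blast
  obtain h where h: "\<And>n s t. n \<ge> 1 \<Longrightarrow>
       c * prob {x\<in>space M. avg m x \<ge> s} * prob {x\<in>space M. avg n x \<le> t}
         \<le> prob {x\<in>space M. avg m x \<ge> s \<and> avg n ((T ^^ h) x) \<le> t}"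
    using gap[OF m(2)] by blast
  \<comment> \<open>The gap length \<open>h\<close> depends on \<open>m\<close>, so \<open>n\<close>
    is chosen after it, large enough that shifting by \<open>h\<close> moves \<open>avg n\<close> by
    at most \<open>s\<close>.\<close>
  obtain n where n: "n \<ge> m" "n \<ge> 1" "2 * real h / real n \<le> s"
    using late[OF s(1), of m "2 * real h"] by blast
  have qm: "q m \<le> q_inf + 2 * \<epsilon>" using q_decay[OF m\<^sub>1(1) m(2)] m\<^sub>1(2) m(3) by linarith
  have "4 * real m\<^sub>1 / real n \<le> 4 * real m\<^sub>1 / real m"
    using n(1) m(2) by (intro divide_left_mono) auto
  then have qn: "q n \<le> q_inf + 2 * \<epsilon>" using q_decay[OF m\<^sub>1(1) n(2)] m\<^sub>1(2) m(3) by linarith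
  have L2: "(\<integral>x. (avg m x - avg n x)\<^sup>2 \<partial>M) \<le> 8 * \<epsilon>" 
  proof (rule order_trans[OF L2_close[OF m(2) n(2)]])
    show "2 * (q m - q_inf) + 2 * (q n - q_inf) \<le> 8 * \<epsilon>" using qm qn by simp
  qed
  let ?a = "prob {x\<in>space M. avg m x \<ge> s}" and ?b = "prob {x\<in>space M. avg n x \<le> - s}"
  have "c * ?a * ?b \<le> prob {x\<in>space M. avg m x \<ge> s \<and> avg n ((T ^^ h) x) \<le> - s}"
    by (rule h[OF n(2)])
  also have "\<dots> \<le> prob {x\<in>space M. s\<^sup>2 \<le> (avg m x - avg n x)\<^sup>2}"
  proof (rule finite_measure_mono)
    show "{x\<in>space M. avg m x \<ge> s \<and> avg n ((T ^^ h) x) \<le> - s} \<subseteq> {x\<in>space M. s\<^sup>2 \<le> (avg m x - avg n x)\<^sup>2}"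
    proof safe
      fix x assume "avg m x \<ge> s" "avg n ((T ^^ h) x) \<le> - s"
      then have "s \<le> avg m x - avg n x" using avg_T_pow[OF n(2), of h x] n(3) by linarith
      then show "s\<^sup>2 \<le> (avg m x - avg n x)\<^sup>2" using s(1) by (intro power_mono) auto
    qed
  qed measurable
  also have "\<dots> \<le> (\<integral>x. (avg m x - avg n x)\<^sup>2 \<partial>M) / s\<^sup>2"
  proof (rule integral_Markov_inequality_measure[where A = "{}"])
    have "\<bar>(avg m x - avg n x)\<^sup>2\<bar> \<le> 2\<^sup>2" for x
      unfolding abs_power2 using avg_bound[of m x] avg_bound[of n x]
      by (subst power2_abs[symmetric], intro power_mono) linarith+
    then show "integrable M (\<lambda>x. (avg m x - avg n x)\<^sup>2)" by (intro integrable_bounded) auto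
  qed (use s(1) in auto)
  also have "\<dots> \<le> 8 * \<epsilon> / s\<^sup>2" by (intro divide_right_mono L2) simp
  also have "\<dots> = c * (r * r)" using s(1) by (simp add: \<epsilon>_def power2_eq_square)
  finally have "?a * ?b \<le> r * r" using c by (simp add: mult.assoc)
  have "?a \<le> r \<or> ?b \<le> r"
  proof (rule ccontr)
    assume "\<not> ?thesis"
    then have "r * r < ?a * ?b" using r(1) by (intro mult_strict_mono) auto
    with \<open>?a * ?b \<le> r * r\<close> show False by simp
  qed
  moreover have fin: "r + (s + r) / \<eta> \<le> \<kappa>"
  proof -
    have "(s + r) / \<eta> = s / \<eta> + r / \<eta>" by (rule add_divide_distrib)
    then show ?thesis using s r \<kappa> by linarith
  qed
  ultimately show ?thesis
  \<comment> \<open>If the lower event for \<open>avg n\<close> is the rare one, the conclusion is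
    drawn at \<open>n\<close>, by way of \<open>- avg n\<close>; the choice \<open>n \<ge> m\<close>
    respects the lower bound \<open>m\<^sub>0\<close>, written \<open>m\<^sub>0\<close> in the
    claim.\<close>
  proof (elim disjE)
    assume "?a \<le> r"
    from prob_deviation_le[OF avg_meas avg_bound integral_avg s(1,2) this] fin m show ?thesis
      by (intro exI[of _ m]) auto
  next
    assume "?b \<le> r"
    then have "prob {x\<in>space M. - avg n x \<ge> s} \<le> r" by (simp add: le_minus_iff)
    from prob_deviation_le[OF _ _ _ s(1,2) this] fin n m show ?thesis
      by (intro exI[of _ n]) (auto simp: avg_bound integral_avg)
  qed
qed

end

section \<open>Gibbs measures\<close>

lemma prefix_image_countable:
  assumes "countable S" "E \<subseteq> markov_shift S A"
  shows "countable ((\<lambda>x. map x [0..<n]) ` E)"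
proof (rule countable_subset)
  show "(\<lambda>x. map x [0..<n]) ` E \<subseteq> lists S"
    using assms(2) unfolding markov_shift_def by (fastforce simp: subset_iff)
  show "countable (lists S)" using assms(1) by (rule countable_lists)
qed

text \<open>The letter \<open>x n\<close> is overwritten by \<open>y 0\<close>, so an allowed
  transition takes the place of equality of letters.\<close>

lemma graft_link:
  assumes "x \<in> markov_shift S A" "y \<in> markov_shift S A" "n \<ge> 1" "A (x (n - 1)) (y 0)"
  shows "graft n x y \<in> markov_shift S A"
proof -
  have "graft n x y = graft n (x(n := y 0)) y" by (auto simp: graft_def fun_eq_iff)
  moreover have "graft n (x(n := y 0)) y \<in> markov_shift S A"
  proof (rule graft_path)
    fix i assume "i < n"
    then show "(x(n := y 0)) i \<in> S \<and> A ((x(n := y 0)) i) ((x(n := y 0)) (Suc i))"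
      using assms by (cases "Suc i = n") (auto simp: markov_shift_def)
  qed (use assms in auto)
  ultimately show ?thesis by simp
qed

locale gibbs_shift = prob_space \<mu> for \<mu> :: "(nat \<Rightarrow> 's) measure" +
  fixes S :: "'s set" and A :: "'s \<Rightarrow> 's \<Rightarrow> bool" and \<Phi> :: "(nat \<Rightarrow> 's) \<Rightarrow> real"
    and P A' B' :: real
  assumes countable_S: "countable S"
    and sets_\<mu>: "sets \<mu> = sets (shift_borel S A)"
    and invariant: "distr \<mu> \<mu> left_shift = \<mu>"
    and A'_pos: "A' > 0" and B'_pos: "B' > 0"
    and gibbs_lower: "n \<ge> 1 \<Longrightarrow> x \<in> markov_shift S A \<Longrightarrow>
       A' * exp (birkhoff \<Phi> n x - real n * P) \<le> measure \<mu> (cylinder S A (map x [0..<n]))"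
    and gibbs_upper: "n \<ge> 1 \<Longrightarrow> x \<in> markov_shift S A \<Longrightarrow>
       measure \<mu> (cylinder S A (map x [0..<n])) \<le> B' * exp (birkhoff \<Phi> n x - real n * P)"
begin

abbreviation "X \<equiv> markov_shift S A"

abbreviation "cyl n x \<equiv> cylinder S A (map x [0..<n])"

lemma space_\<mu> [simp]: "space \<mu> = X"
  using sets_eq_imp_space_eq[OF sets_\<mu>] by simp

lemma left_shift_meas [measurable]: "left_shift \<in> \<mu> \<rightarrow>\<^sub>M \<mu>"
  using left_shift_measurable[of S A] by (simp add: measurable_cong_sets[OF sets_\<mu> sets_\<mu>])

lemma funpow_meas [measurable]: "(left_shift ^^ n) \<in> \<mu> \<rightarrow>\<^sub>M \<mu>"
  by (induction n) auto

lemma prefix_sets: "depends_on_prefix S A n E \<Longrightarrow> E \<in> sets \<mu>"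
  unfolding sets_\<mu> by (rule depends_on_prefix_sets)

lemma cyl_sets [measurable]: "cylinder S A w \<in> sets \<mu>"
  unfolding sets_\<mu> by (rule cylinder_sets)

section \<open>Invariance and decomposition into cylinders\<close>

definition pull :: "nat \<Rightarrow> (nat \<Rightarrow> 's) set \<Rightarrow> (nat \<Rightarrow> 's) set" where
  "pull h E = {x\<in>X. (left_shift ^^ h) x \<in> E}"

lemma pull_sets [measurable]:
  assumes "E \<in> sets \<mu>"
  shows "pull h E \<in> sets \<mu>"
proof -
  have "pull h E = (left_shift ^^ h) -` E \<inter> space \<mu>" by (auto simp: pull_def)
  then show ?thesis using measurable_sets[OF funpow_meas assms] by simp
qed

lemma distr_funpow: "distr \<mu> \<mu> (left_shift ^^ h) = \<mu>"
proof (induction h)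
  case (Suc j)
  have "distr (distr \<mu> \<mu> (left_shift ^^ j)) \<mu> left_shift = distr \<mu> \<mu> (left_shift \<circ> left_shift ^^ j)"
    by (rule distr_distr) auto
  then show ?case by (simp only: Suc invariant funpow.simps)
qed (simp add: id_def distr_id)

lemma emeasure_pull: "E \<in> sets \<mu> \<Longrightarrow> emeasure \<mu> (pull h E) = emeasure \<mu> E"
proof -
  assume E: "E \<in> sets \<mu>"
  have "emeasure \<mu> E = emeasure (distr \<mu> \<mu> (left_shift ^^ h)) E" by (simp add: distr_funpow)
  also have "\<dots> = emeasure \<mu> ((left_shift ^^ h) -` E \<inter> space \<mu>)"
    by (rule emeasure_distr) (use E in auto)
  also have "(left_shift ^^ h) -` E \<inter> space \<mu> = pull h E" by (auto simp: pull_def)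
  finally show ?thesis by simp
qed

text \<open>Countability of \<open>S\<close> enters here: \<open>F\<close> is a disjoint union of
  countably many cylinders.\<close>

lemma pull_decomposition:
  assumes F: "depends_on_prefix S A k F" and Q: "Q \<in> sets \<mu>"
  shows "emeasure \<mu> (Q \<inter> pull h F)
    = (\<integral>\<^sup>+ w. emeasure \<mu> (Q \<inter> pull h (cylinder S A w)) \<partial>count_space ((\<lambda>x. map x [0..<k]) ` F))"
proof -
  let ?I = "(\<lambda>x. map x [0..<k]) ` F"
  have sub: "F \<subseteq> X" using F by (simp add: depends_on_prefix_def)
  have "Q \<inter> pull h F = (\<Union>w\<in>?I. Q \<inter> pull h (cylinder S A w))"
    using F sub left_shift_funpow_in[of _ S A h]
    by (auto simp: pull_def depends_on_prefix_def mem_cylinder_prefix)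
  moreover have "emeasure \<mu> (\<Union>w\<in>?I. Q \<inter> pull h (cylinder S A w))
      = (\<integral>\<^sup>+ w. emeasure \<mu> (Q \<inter> pull h (cylinder S A w)) \<partial>count_space ?I)"
  proof (rule emeasure_UN_countable)
    show "countable ?I" by (rule prefix_image_countable[OF countable_S sub])
    show "disjoint_family_on (\<lambda>w. Q \<inter> pull h (cylinder S A w)) ?I"
      unfolding disjoint_family_on_def
    proof (intro ballI impI equals0I)
      fix w v y assume "w \<in> ?I" "v \<in> ?I" "w \<noteq> v"
        and y: "y \<in> (Q \<inter> pull h (cylinder S A w)) \<inter> (Q \<inter> pull h (cylinder S A v))"
      then have "length w = length v" by auto
      moreover have "w = map ((left_shift ^^ h) y) [0..<length w]" "v = map ((left_shift ^^ h) y) [0..<length v]"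
        using y cylinder_eq_prefix[of "(left_shift ^^ h) y" S A] by (auto simp: pull_def)
      ultimately show False using \<open>w \<noteq> v\<close> by metis
    qed
  qed (use Q in auto)
  ultimately show ?thesis by simp
qed

lemma pull_0: "E \<subseteq> X \<Longrightarrow> pull 0 E = E"
  by (auto simp: pull_def)

lemma prefix_decomposition:
  assumes "depends_on_prefix S A n E" "Q \<in> sets \<mu>"
  shows "emeasure \<mu> (E \<inter> Q) = (\<integral>\<^sup>+ w. emeasure \<mu> (cylinder S A w \<inter> Q) \<partial>count_space ((\<lambda>x. map x [0..<n]) ` E))"
proof -
  have "E \<subseteq> X" "\<And>w. cylinder S A w \<subseteq> X"
    using assms(1) by (auto simp: depends_on_prefix_def cylinder_def)
  then show ?thesis using pull_decomposition[OF assms, of 0] by (simp add: pull_0 Int_commute)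
qed

lemma emeasure_prefix_sum:
  assumes "depends_on_prefix S A n E"
  shows "emeasure \<mu> E = (\<integral>\<^sup>+ w. emeasure \<mu> (cylinder S A w) \<partial>count_space ((\<lambda>x. map x [0..<n]) ` E))"
proof -
  have "E \<subseteq> X" "\<And>w. cylinder S A w \<subseteq> X"
    using assms by (auto simp: depends_on_prefix_def cylinder_def)
  then show ?thesis
    using prefix_decomposition[OF assms, of X] sets.top[of \<mu>] by (simp add: Int_absorb2)
qed

text \<open>Summation over the words of \<open>F\<close> and then over those of \<open>E\<close>;
  with extended nonnegative values no convergence has to be verified. The lower bound after it is
  obtained in the same way.\<close>

lemma prefix_product_le:
  assumes cyl: "\<And>x y. x \<in> X \<Longrightarrow> y \<in> X \<Longrightarrow>
      emeasure \<mu> (cyl n x \<inter> pull h (cyl k y)) \<le> C * emeasure \<mu> (cyl n x) * emeasure \<mu> (cyl k y)"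
    and E: "depends_on_prefix S A n E" and F: "depends_on_prefix S A k F"
  shows "emeasure \<mu> (E \<inter> pull h F) \<le> C * emeasure \<mu> E * emeasure \<mu> F"
proof -
  have sub: "E \<subseteq> X" "F \<subseteq> X" using E F by (auto simp: depends_on_prefix_def)
  have one: "emeasure \<mu> (cyl n x \<inter> pull h F) \<le> (C * emeasure \<mu> (cyl n x)) * emeasure \<mu> F" if x: "x \<in> X" for x
    unfolding pull_decomposition[OF F cyl_sets] emeasure_prefix_sum[OF F]
    by (subst nn_integral_cmult[symmetric], simp, rule nn_integral_mono) (use cyl[OF x] sub(2) in auto)
  have "emeasure \<mu> (E \<inter> pull h F) \<le> (C * emeasure \<mu> F) * emeasure \<mu> E"
    unfolding prefix_decomposition[OF E pull_sets[OF prefix_sets[OF F]]] emeasure_prefix_sum[OF E]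
    by (subst nn_integral_cmult[symmetric], simp, rule nn_integral_mono) (use one sub(1) in \<open>auto simp: mult_ac\<close>)
  then show ?thesis by (simp add: mult_ac)
qed

lemma prefix_product_ge:
  assumes cyl: "\<And>x y. x \<in> X \<Longrightarrow> y \<in> X \<Longrightarrow>
      C * emeasure \<mu> (cyl n x) * emeasure \<mu> (cyl k y) \<le> emeasure \<mu> (cyl n x \<inter> pull h (cyl k y))"
    and E: "depends_on_prefix S A n E" and F: "depends_on_prefix S A k F"
  shows "C * emeasure \<mu> E * emeasure \<mu> F \<le> emeasure \<mu> (E \<inter> pull h F)"
proof -
  have sub: "E \<subseteq> X" "F \<subseteq> X" using E F by (auto simp: depends_on_prefix_def)
  have one: "(C * emeasure \<mu> (cyl n x)) * emeasure \<mu> F \<le> emeasure \<mu> (cyl n x \<inter> pull h F)" if x: "x \<in> X" for x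
    unfolding pull_decomposition[OF F cyl_sets] emeasure_prefix_sum[OF F]
    by (subst nn_integral_cmult[symmetric], simp, rule nn_integral_mono) (use cyl[OF x] sub(2) in auto)
  have "(C * emeasure \<mu> F) * emeasure \<mu> E \<le> emeasure \<mu> (E \<inter> pull h F)"
    unfolding prefix_decomposition[OF E pull_sets[OF prefix_sets[OF F]]] emeasure_prefix_sum[OF E]
    by (subst nn_integral_cmult[symmetric], simp, rule nn_integral_mono) (use one sub(1) in \<open>auto simp: mult_ac\<close>)
  then show ?thesis by (simp add: mult_ac)
qed

lemma ennreal_product_prob:
  "C \<ge> 0 \<Longrightarrow> ennreal C * emeasure \<mu> E * emeasure \<mu> F = ennreal (C * prob E * prob F)"
  by (simp add: emeasure_eq_measure ennreal_mult[symmetric])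

text \<open>Upper half of the quasi-Bernoulli property. The constant combines one upper Gibbs bound
  for the long word with two lower ones for its parts.\<close>

lemma prob_prefix_product_le:
  assumes "n \<ge> 1" "k \<ge> 1" "depends_on_prefix S A n E" "depends_on_prefix S A k F"
  shows "prob (E \<inter> pull n F) \<le> B' / A'\<^sup>2 * prob E * prob F"
proof -
  have C: "B' / A'\<^sup>2 \<ge> 0" using A'_pos B'_pos by simp
  have "emeasure \<mu> (E \<inter> pull n F) \<le> ennreal (B' / A'\<^sup>2) * emeasure \<mu> E * emeasure \<mu> F"
  proof (rule prefix_product_le[OF _ assms(3,4)])
    fix x y assume xy: "x \<in> X" "y \<in> X"
    have "prob (cyl n x \<inter> pull n (cyl k y)) \<le> B' / A'\<^sup>2 * prob (cyl n x) * prob (cyl k y)"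
    proof (cases "cyl n x \<inter> pull n (cyl k y) = {}")
      case False
      \<comment> \<open>One point \<open>z\<close> of the intersection serves in all three Gibbs
        estimates, so its Birkhoff sum splits exactly and no distortion constant appears.\<close>
      then obtain z where z: "z \<in> cyl n x" "z \<in> pull n (cyl k y)" by blast
      have zX: "z \<in> X" "(left_shift ^^ n) z \<in> X"
        using z left_shift_funpow_in[of z S A n] by (auto simp: pull_def)
      have eq: "map z [0..<n] = map x [0..<n]" "map ((left_shift ^^ n) z) [0..<k] = map y [0..<k]"
        using z by (auto simp: pull_def mem_cylinder_prefix)
      have "cyl n x \<inter> pull n (cyl k y) \<subseteq> cyl (n + k) z"
      proof
        fix u assume "u \<in> cyl n x \<inter> pull n (cyl k y)"
        then have u: "u \<in> X" "\<And>i. i < n \<Longrightarrow> u i = x i" "\<And>i. i < k \<Longrightarrow> u (i + n) = y i"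
          by (auto simp: pull_def mem_cylinder_prefix left_shift_funpow)
        have z': "\<And>i. i < n \<Longrightarrow> z i = x i" "\<And>i. i < k \<Longrightarrow> z (i + n) = y i"
          using z by (auto simp: pull_def mem_cylinder_prefix left_shift_funpow)
        have "u i = z i" if "i < n + k" for i
          using u(2)[of i] z'(1)[of i] u(3)[of "i - n"] z'(2)[of "i - n"] that by (cases "i < n") auto
        then show "u \<in> cyl (n + k) z" using u(1) by (simp add: mem_cylinder_prefix)
      qed
      then have "prob (cyl n x \<inter> pull n (cyl k y)) \<le> prob (cyl (n + k) z)"
        by (intro finite_measure_mono) auto
      also have "\<dots> \<le> B' * exp (birkhoff \<Phi> (n + k) z - real (n + k) * P)"
        using gibbs_upper[of "n + k" z] assms(1) zX by simp
      also have "\<dots> = B' * (exp (birkhoff \<Phi> n z - real n * P) * exp (birkhoff \<Phi> k ((left_shift ^^ n) z) - real k * P))"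
        unfolding mult_exp_exp birkhoff_add by (simp add: algebra_simps)
      also have "\<dots> \<le> B' * ((prob (cyl n x) / A') * (prob (cyl k y) / A'))"
        using gibbs_lower[OF assms(1) zX(1)] gibbs_lower[OF assms(2) zX(2)] A'_pos B'_pos
        unfolding eq by (intro mult_left_mono mult_mono) (auto simp: le_divide_eq mult.commute)
      finally show ?thesis by (simp add: power2_eq_square)
    qed (use A'_pos B'_pos in \<open>auto intro!: mult_nonneg_nonneg divide_nonneg_nonneg\<close>)
    then show "emeasure \<mu> (cyl n x \<inter> pull n (cyl k y)) \<le> ennreal (B' / A'\<^sup>2) * emeasure \<mu> (cyl n x) * emeasure \<mu> (cyl k y)"
      unfolding ennreal_product_prob[OF C] unfolding emeasure_eq_measure by (rule ennreal_leI)
  qed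
  then show ?thesis
    unfolding ennreal_product_prob[OF C] unfolding emeasure_eq_measure
    by (subst (asm) ennreal_le_iff) (use A'_pos B'_pos in \<open>auto intro!: mult_nonneg_nonneg divide_nonneg_nonneg\<close>)
qed

text \<open>Any two words are joined through one of finitely many connecting words of a common
  length \<open>K\<close>. The joined word carries measure comparable to the product, with a gap and
  a constant independent of both words.\<close>

lemma prob_prefix_product_ge:
  assumes W: "finite W" "W \<subseteq> X" "K \<ge> 1"
    "\<And>s t. s \<in> S \<Longrightarrow> t \<in> S \<Longrightarrow> \<exists>m\<in>W. A s (m 0) \<and> A (m (K - 1)) t"
  obtains c where "c > 0"
    "\<And>n k E F. n \<ge> 1 \<Longrightarrow> k \<ge> 1 \<Longrightarrow> depends_on_prefix S A n E \<Longrightarrow> depends_on_prefix S A k F \<Longrightarrow>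
       c * prob E * prob F \<le> prob (E \<inter> pull (n + K) F)"
proof -
  \<comment> \<open>The inserted \<open>1\<close> keeps the minimum meaningful for empty
    \<open>W\<close>.\<close>
  define c\<^sub>0 where "c\<^sub>0 = Min (insert 1 ((\<lambda>m. prob (cyl K m)) ` W))"
  have pos: "prob (cyl K m) > 0" if "m \<in> W" for m
  proof -
    have "0 < A' * exp (birkhoff \<Phi> K m - real K * P)" using A'_pos by simp
    also have "\<dots> \<le> prob (cyl K m)" using gibbs_lower[OF W(3)] that W(2) by auto
    finally show ?thesis .
  qed
  have c0: "c\<^sub>0 > 0" "\<And>m. m \<in> W \<Longrightarrow> c\<^sub>0 \<le> prob (cyl K m)"
    using W(1) pos by (auto simp: c\<^sub>0_def)
  \<comment> \<open>One lower Gibbs bound for the joined word, three upper ones for its pieces, and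
    \<open>c\<^sub>0\<close> for the connecting word.\<close>
  define c where "c = A' * c\<^sub>0 / B' ^ 3"
  have c: "c > 0" using A'_pos B'_pos c0 by (simp add: c_def)
  show ?thesis
  proof (rule that[OF c])
    fix n k E F assume nk: "n \<ge> (1::nat)" "k \<ge> (1::nat)" and E: "depends_on_prefix S A n E" and F: "depends_on_prefix S A k F"
    have "ennreal c * emeasure \<mu> E * emeasure \<mu> F \<le> emeasure \<mu> (E \<inter> pull (n + K) F)"
    proof (rule prefix_product_ge[OF _ E F])
      fix x y assume xy: "x \<in> X" "y \<in> X"
      then have "x (n - 1) \<in> S" "y 0 \<in> S" by (auto simp: markov_shift_def)
      then obtain m where m: "m \<in> W" "A (x (n - 1)) (m 0)" "A (m (K - 1)) (y 0)" using W(4) by blast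
      have mX: "m \<in> X" using m(1) W(2) by auto
      let ?v = "graft K m y"
      let ?z = "graft n x ?v"
      have v: "?v \<in> X" by (rule graft_link[OF mX xy(2) W(3) m(3)])
      have "?v 0 = m 0" using W(3) by (simp add: graft_def)
      then have z: "?z \<in> X" using graft_link[OF xy(1) v nk(1)] m(2) by simp
      have "cyl (n + K + k) ?z \<subseteq> cyl n x \<inter> pull (n + K) (cyl k y)"
      proof
        fix u assume "u \<in> cyl (n + K + k) ?z"
        then have u: "u \<in> X" "\<And>i. i < n + K + k \<Longrightarrow> u i = ?z i" by (auto simp: mem_cylinder_prefix)
        have "u i = x i" if "i < n" for i using u(2)[of i] that by simp
        moreover have "u (i + (n + K)) = y i" if "i < k" for i using u(2)[of "i + (n + K)"] that by (simp add: graft_def)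
        ultimately show "u \<in> cyl n x \<inter> pull (n + K) (cyl k y)"
          using u(1) left_shift_funpow_in[OF u(1), of "n + K"]
          by (simp add: pull_def mem_cylinder_prefix) (simp add: left_shift_funpow)
      qed
      then have le: "prob (cyl (n + K + k) ?z) \<le> prob (cyl n x \<inter> pull (n + K) (cyl k y))"
        by (intro finite_measure_mono) auto
      have eq: "map ?z [0..<n] = map x [0..<n]" "map ?v [0..<K] = map m [0..<K]" by auto
      have "(left_shift ^^ (n + K)) ?z = y"
        using left_shift_funpow_add[of K n ?z] by simp
      then have "birkhoff \<Phi> (n + K + k) ?z = birkhoff \<Phi> n ?z + birkhoff \<Phi> K ?v + birkhoff \<Phi> k y"
        by (simp add: birkhoff_add)
      then have "exp (birkhoff \<Phi> (n + K + k) ?z - real (n + K + k) * P)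
          = exp (birkhoff \<Phi> n ?z - real n * P) * exp (birkhoff \<Phi> K ?v - real K * P) * exp (birkhoff \<Phi> k y - real k * P)"
        by (simp only: mult_exp_exp) (simp add: algebra_simps)
      moreover have "prob (cyl n x) / B' \<le> exp (birkhoff \<Phi> n ?z - real n * P)"
        using gibbs_upper[OF nk(1) z] B'_pos unfolding eq by (simp add: divide_le_eq mult.commute)
      moreover have "c\<^sub>0 / B' \<le> exp (birkhoff \<Phi> K ?v - real K * P)"
        using gibbs_upper[OF W(3) v] c0(2)[OF m(1)] B'_pos unfolding eq by (simp add: divide_le_eq mult.commute)
      moreover have "prob (cyl k y) / B' \<le> exp (birkhoff \<Phi> k y - real k * P)"
        using gibbs_upper[OF nk(2) xy(2)] B'_pos by (simp add: divide_le_eq mult.commute)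
      ultimately have "(prob (cyl n x) / B') * (c\<^sub>0 / B') * (prob (cyl k y) / B')
          \<le> exp (birkhoff \<Phi> (n + K + k) ?z - real (n + K + k) * P)"
        using c0(1) B'_pos by (simp only:) (intro mult_mono; simp)
      then have "A' * ((prob (cyl n x) / B') * (c\<^sub>0 / B') * (prob (cyl k y) / B'))
          \<le> A' * exp (birkhoff \<Phi> (n + K + k) ?z - real (n + K + k) * P)"
        using A'_pos by (intro mult_left_mono) auto
      also have "\<dots> \<le> prob (cyl (n + K + k) ?z)" using gibbs_lower[OF _ z, of "n + K + k"] nk by simp
      also note le
      finally have "c * prob (cyl n x) * prob (cyl k y) \<le> prob (cyl n x \<inter> pull (n + K) (cyl k y))"
        by (simp add: c_def power3_eq_cube mult_ac)
      then show "ennreal c * emeasure \<mu> (cyl n x) * emeasure \<mu> (cyl k y) \<le> emeasure \<mu> (cyl n x \<inter> pull (n + K) (cyl k y))"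
        unfolding ennreal_product_prob[OF less_imp_le[OF c]] unfolding emeasure_eq_measure by (rule ennreal_leI)
    qed
    then show "c * prob E * prob F \<le> prob (E \<inter> pull (n + K) F)"
      unfolding ennreal_product_prob[OF less_imp_le[OF c]] unfolding emeasure_eq_measure
      by (subst (asm) ennreal_le_iff) auto
  qed
qed

end

section \<open>Large deviations\<close>

lemma depends_on_prefixI:
  "(\<And>x y. x \<in> markov_shift S A \<Longrightarrow> y \<in> markov_shift S A \<Longrightarrow> (\<And>i. i < n \<Longrightarrow> x i = y i) \<Longrightarrow> Q x \<Longrightarrow> Q y)
    \<Longrightarrow> depends_on_prefix S A n {x \<in> markov_shift S A. Q x}"
  unfolding depends_on_prefix_def by blast

lemma indicator_shift_cong:
  assumes "x \<in> markov_shift S A" "y \<in> markov_shift S A" "depends_on_prefix S A k E"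
    and eq: "\<And>i. i < j + k \<Longrightarrow> x i = y i"
  shows "indicator E ((left_shift ^^ j) x) = (indicator E ((left_shift ^^ j) y) :: real)"
proof -
  have "(left_shift ^^ j) x i = (left_shift ^^ j) y i" if "i < k" for i
    using eq[of "i + j"] that by (simp add: left_shift_funpow)
  then have "(left_shift ^^ j) x \<in> E \<longleftrightarrow> (left_shift ^^ j) y \<in> E"
    using assms(3) left_shift_funpow_in[OF assms(1), of j] left_shift_funpow_in[OF assms(2), of j]
    unfolding depends_on_prefix_def by metis
  then show ?thesis by (simp add: indicator_def)
qed

section \<open>Visit frequencies\<close>

definition frequency :: "nat \<Rightarrow> (nat \<Rightarrow> 's) set \<Rightarrow> (nat \<Rightarrow> 's) \<Rightarrow> real" where
  "frequency n E x = (\<Sum>j<n. indicator E ((left_shift ^^ j) x)) / real n"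

lemma frequency_bounds: "0 \<le> frequency n E x" "frequency n E x \<le> 1"
proof -
  have "(\<Sum>j<n. indicator E ((left_shift ^^ j) x)) \<le> (\<Sum>j<n. 1 :: real)"
    by (intro sum_mono) (auto simp: indicator_def)
  then show "frequency n E x \<le> 1" by (simp add: frequency_def divide_le_eq)
  show "0 \<le> frequency n E x" by (simp add: frequency_def sum_nonneg)
qed

lemma frequency_cong:
  assumes "x \<in> markov_shift S A" "y \<in> markov_shift S A" "depends_on_prefix S A k E"
    "\<And>i. i < n + k \<Longrightarrow> x i = y i"
  shows "frequency n E x = frequency n E y"
  unfolding frequency_def
  by (intro arg_cong2[where f = "(/)"] sum.cong refl indicator_shift_cong[OF assms(1-3)]) (use assms(4) in auto)

text \<open>Agreement on \<open>n\<close> letters decides every visit except possibly the last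
  \<open>k\<close>. A deviation at one point thereby spreads to its whole cylinder of length
  \<open>n\<close>, at the price of \<open>k / n\<close>.\<close>

lemma frequency_prefix_stable:
  assumes "x \<in> markov_shift S A" "y \<in> markov_shift S A" "\<And>i. i < n \<Longrightarrow> x i = y i"
    and E: "depends_on_prefix S A k E" and n: "n \<ge> 1"
  shows "\<bar>frequency n E x - frequency n E y\<bar> \<le> real k / real n"
proof -
  have eq: "indicator E ((left_shift ^^ j) x) = (indicator E ((left_shift ^^ j) y) :: real)" if j: "j + k \<le> n" for j
    by (rule indicator_shift_cong[OF assms(1,2) E]) (use assms(3) j in auto)
  have "\<bar>(\<Sum>j<n. indicator E ((left_shift ^^ j) x)) - (\<Sum>j<n. indicator E ((left_shift ^^ j) y))\<bar>
      \<le> (\<Sum>j<n. if j + k \<le> n then 0 else 1 :: real)"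
    unfolding sum_subtractf[symmetric]
  proof (rule order_trans[OF sum_abs], rule sum_mono)
    fix j
    show "\<bar>indicator E ((left_shift ^^ j) x) - indicator E ((left_shift ^^ j) y)\<bar> \<le> (if j + k \<le> n then 0 else 1 :: real)"
      using eq[of j] by (auto simp: indicator_def)
  qed
  also have "\<dots> = real (card {j\<in>{..<n}. \<not> j + k \<le> n})"
    by (simp add: sum.If_cases Int_def)
  also have "\<dots> \<le> real (card {n - k..<n})"
    by (intro of_nat_mono card_mono) auto
  also have "\<dots> \<le> real k" by simp
  finally show ?thesis
    using n by (simp add: frequency_def diff_divide_distrib[symmetric] divide_right_mono)
qed

section \<open>Counting bad blocks\<close>

context gibbs_shift begin

definition block_hits :: "nat \<Rightarrow> (nat \<Rightarrow> 's) set \<Rightarrow> nat set \<Rightarrow> (nat \<Rightarrow> 's) set" where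
  "block_hits L D J = {x\<in>X. \<forall>j\<in>J. (left_shift ^^ (j * L)) x \<in> D}"

text \<open>The Gibbs bounds concern positive lengths, so one block more than the index set demands
  is granted; for \<open>L \<ge> 1\<close> the length is then positive even if
  \<open>q = 0\<close>.\<close>

lemma block_hits_prefix:
  assumes "depends_on_prefix S A L D" "J \<subseteq> {..<q}"
  shows "depends_on_prefix S A (Suc q * L) (block_hits L D J)"
  unfolding block_hits_def
proof (rule depends_on_prefixI)
  fix x y assume x: "x \<in> X" and y: "y \<in> X" and eq: "\<And>i. i < Suc q * L \<Longrightarrow> x i = y i"
    and D: "\<forall>j\<in>J. (left_shift ^^ (j * L)) x \<in> D"
  show "\<forall>j\<in>J. (left_shift ^^ (j * L)) y \<in> D"
  proof
    fix j assume j: "j \<in> J"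
    then have "j < q" using assms(2) by auto
    then have le: "Suc j * L \<le> Suc q * L" by (intro mult_le_mono1) auto
    have "i + j * L < Suc q * L" if "i < L" for i
      by (rule less_le_trans[OF _ le]) (use that in simp)
    then have "(left_shift ^^ (j * L)) x i = (left_shift ^^ (j * L)) y i" if "i < L" for i
      using eq[of "i + j * L"] that by (simp add: left_shift_funpow)
    then show "(left_shift ^^ (j * L)) y \<in> D"
      using assms(1) D j left_shift_funpow_in[OF y] unfolding depends_on_prefix_def by blast
  qed
qed

text \<open>Induction on the number of blocks. An unconstrained first block is removed by
  invariance, a constrained one by the upper product bound, at the price of a factor
  \<open>C * prob D\<close>.\<close>

lemma prob_block_hits:
  assumes L: "L \<ge> 1" and D: "depends_on_prefix S A L D" and C: "B' / A'\<^sup>2 \<le> C"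
    and J: "J \<subseteq> {..<q}"
  shows "prob (block_hits L D J) \<le> (C * prob D) ^ card J"
  using J
proof (induction q arbitrary: J)
  case 0
  then show ?case by simp
next
  case (Suc q)
  define J' where "J' = {j. Suc j \<in> J}"
  have J': "J' \<subseteq> {..<q}" using Suc.prems by (auto simp: J'_def)
  have C0: "C \<ge> 0" using C A'_pos B'_pos by (meson divide_nonneg_pos less_imp_le order_trans zero_less_power)
  note IH = Suc.IH[OF J']
  have fin: "finite J'" using J' finite_subset by blast
  have pre: "depends_on_prefix S A (Suc q * L) (block_hits L D J')" by (rule block_hits_prefix[OF D J'])
  have pull: "pull L (block_hits L D J') = {x\<in>X. \<forall>j\<in>J'. (left_shift ^^ (Suc j * L)) x \<in> D}"
    using left_shift_funpow_in[of _ S A L] by (auto simp: pull_def block_hits_def left_shift_funpow_add)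
  have split: "block_hits L D J = (if 0 \<in> J then D \<inter> pull L (block_hits L D J') else pull L (block_hits L D J'))"
  proof -
    have "(\<forall>j\<in>J. Q j) \<longleftrightarrow> (0 \<in> J \<longrightarrow> Q 0) \<and> (\<forall>j\<in>J'. Q (Suc j))" for Q
      unfolding J'_def by (metis mem_Collect_eq not0_implies_Suc)
    note * = this[of "\<lambda>j. (left_shift ^^ (j * L)) _ \<in> D"]
    have "D \<subseteq> X" using D by (simp add: depends_on_prefix_def)
    then show ?thesis unfolding pull unfolding block_hits_def * by auto
  qed
  have pp: "prob (pull L (block_hits L D J')) = prob (block_hits L D J')"
    using emeasure_pull[OF prefix_sets[OF pre], of L] by (simp add: measure_def)
  show ?case
  proof (cases "0 \<in> J")
    case True
    then have "J = insert 0 (Suc ` J')" unfolding J'_def by (auto simp: image_iff) (metis not0_implies_Suc)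
    then have card: "card J = Suc (card J')" using fin by (simp add: card_image)
    have "prob (block_hits L D J) \<le> B' / A'\<^sup>2 * prob D * prob (block_hits L D J')"
      using split True L prob_prefix_product_le[OF L _ D pre] by simp
    also have "\<dots> \<le> C * prob D * (C * prob D) ^ card J'"
      using IH C C0 by (intro mult_mono) auto
    finally show ?thesis by (simp add: card)
  next
    case False
    then have "J = Suc ` J'" unfolding J'_def by (auto simp: image_iff) (metis not0_implies_Suc)
    then have "card J = card J'" by (simp add: card_image)
    then show ?thesis using split False pp IH by simp
  qed
qed

text \<open>A union bound over at most \<open>2 ^ q\<close> patterns of bad blocks. The smallness
  threshold is what gives each pattern with \<open>\<epsilon> * q\<close> or more bad blocks
  probability at most \<open>(1 / 4) ^ q\<close>.\<close>

lemma prob_many_block_hits: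
  assumes L: "L \<ge> 1" and D: "depends_on_prefix S A L D" and C: "B' / A'\<^sup>2 \<le> C"
    and small: "C * prob D \<le> (1 / 4) powr (1 / \<epsilon>)" and \<epsilon>: "\<epsilon> > 0"
  shows "prob {x\<in>X. \<epsilon> * real q \<le> real (card {j\<in>{..<q}. (left_shift ^^ (j * L)) x \<in> D})} \<le> (1 / 2) ^ q"
proof -
  let ?\<J> = "{J \<in> Pow {..<q}. \<epsilon> * real q \<le> real (card J)}"
  let ?b = "(1 / 4 :: real) powr (1 / \<epsilon>)"
  have C0: "C \<ge> 0" using C A'_pos B'_pos by (meson divide_nonneg_pos less_imp_le order_trans zero_less_power)
  have b: "0 < ?b" "?b \<le> 1" using \<epsilon> by (auto intro: powr_le1)
  have fin: "finite ?\<J>" by simp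
  have sets: "block_hits L D J \<in> sets \<mu>" if "J \<in> ?\<J>" for J
    using prefix_sets[OF block_hits_prefix[OF D, of J q]] that by auto
  have "prob {x\<in>X. \<epsilon> * real q \<le> real (card {j\<in>{..<q}. (left_shift ^^ (j * L)) x \<in> D})}
      \<le> prob (\<Union>J\<in>?\<J>. block_hits L D J)"
  proof (rule finite_measure_mono)
    show "{x\<in>X. \<epsilon> * real q \<le> real (card {j\<in>{..<q}. (left_shift ^^ (j * L)) x \<in> D})} \<subseteq> (\<Union>J\<in>?\<J>. block_hits L D J)"
    proof
      fix x assume "x \<in> {x\<in>X. \<epsilon> * real q \<le> real (card {j\<in>{..<q}. (left_shift ^^ (j * L)) x \<in> D})}"
      then show "x \<in> (\<Union>J\<in>?\<J>. block_hits L D J)"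
        by (intro UN_I[of "{j\<in>{..<q}. (left_shift ^^ (j * L)) x \<in> D}"]) (auto simp: block_hits_def)
    qed
    show "(\<Union>J\<in>?\<J>. block_hits L D J) \<in> sets \<mu>" using fin sets by (intro sets.finite_UN) auto
  qed
  also have "\<dots> \<le> (\<Sum>J\<in>?\<J>. prob (block_hits L D J))"
    using sets by (intro measure_UNION_le fin) auto
  also have "\<dots> \<le> (\<Sum>J\<in>?\<J>. (1 / 4) ^ q)"
  proof (rule sum_mono)
    fix J assume J: "J \<in> ?\<J>"
    have "prob (block_hits L D J) \<le> (C * prob D) ^ card J"
      using J by (intro prob_block_hits[OF L D C, of J q]) auto
    also have "\<dots> \<le> ?b ^ card J" using small C0 by (intro power_mono) auto
    also have "\<dots> = ?b powr real (card J)" using b by (simp add: powr_realpow)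
    also have "\<dots> \<le> ?b powr (\<epsilon> * real q)" using J b by (intro powr_mono') auto
    also have "\<dots> = (1 / 4) ^ q" using \<epsilon> by (simp add: powr_powr powr_realpow)
    finally show "prob (block_hits L D J) \<le> (1 / 4) ^ q" .
  qed
  also have "\<dots> = real (card ?\<J>) * (1 / 4) ^ q" by simp
  also have "\<dots> \<le> 2 ^ q * (1 / 4) ^ q"
  proof (rule mult_right_mono)
    have "card ?\<J> \<le> card (Pow {..<q})" by (intro card_mono) auto
    then have "card ?\<J> \<le> 2 ^ q" by (simp add: card_Pow)
    then show "real (card ?\<J>) \<le> 2 ^ q" by (metis of_nat_le_iff of_nat_numeral of_nat_power)
  qed simp
  also have "\<dots> = (1 / 2) ^ q" by (simp add: power_mult_distrib[symmetric])
  finally show ?thesis .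
qed

text \<open>A block is bad if the average over its first \<open>m\<close> steps deviates by
  \<open>\<epsilon>\<close>. For suitable \<open>m\<close> a bad block is so improbable that a
  proportion \<open>\<epsilon>\<close> of bad blocks is exponentially rare; without that many, the
  deviation over the whole segment stays below \<open>\<theta>\<close>.\<close>

theorem large_deviations:
  assumes W: "finite W" "W \<subseteq> X" "K \<ge> 1"
    "\<And>s t. s \<in> S \<Longrightarrow> t \<in> S \<Longrightarrow> \<exists>m\<in>W. A s (m 0) \<and> A (m (K - 1)) t"
    and \<theta>: "\<theta> > 0"
  obtains \<gamma> R where "\<gamma> > 0"
    "\<And>n. prob {x\<in>X. \<bar>frequency n (cylinder S A w) x - prob (cylinder S A w)\<bar> \<ge> \<theta>}
       \<le> R * exp (- \<gamma> * real n)"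
proof -
  interpret M: measure_preserving_system \<mu> left_shift "cylinder S A w"
    by unfold_locales (use invariant in auto)
  \<comment> \<open>\<open>avg m\<close> is decided by the first \<open>m + l\<close> letters,
    whence the block length \<open>m + l\<close> below.\<close>
  define l where "l = Suc (length w)"
  have dw: "depends_on_prefix S A (length w) (cylinder S A w)" by (rule depends_on_prefix_cylinder)
  have avg_eq: "M.avg m x = M.avg m y" if "x \<in> X" "y \<in> X" "\<And>i. i < m + l \<Longrightarrow> x i = y i" for m x y
    unfolding M.avg_def M.f_def
    by (intro arg_cong2[where f = "(/)"] arg_cong2[where f = "(-)"] sum.cong refl indicator_shift_cong[OF that(1,2) dw])
       (use that(3) in \<open>auto simp: l_def\<close>)
  obtain c where c: "c > 0" "\<And>n k E F. n \<ge> 1 \<Longrightarrow> k \<ge> 1 \<Longrightarrow> depends_on_prefix S A n E \<Longrightarrow> depends_on_prefix S A k F \<Longrightarrow>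
       c * prob E * prob F \<le> prob (E \<inter> pull (n + K) F)"
    by (rule prob_prefix_product_ge[OF W(1-3)]) (rule W(4), assumption+, rule that)
  have gap: "\<exists>h. \<forall>n\<ge>1. \<forall>s t.
       c * prob {x\<in>space \<mu>. M.avg m x \<ge> s} * prob {x\<in>space \<mu>. M.avg n x \<le> t}
         \<le> prob {x\<in>space \<mu>. M.avg m x \<ge> s \<and> M.avg n ((left_shift ^^ h) x) \<le> t}" if "m \<ge> 1" for m
  \<comment> \<open>The first event occupies \<open>m + l\<close> letters, the connecting word
    \<open>K\<close> more.\<close>
  proof (intro exI[of _ "m + l + K"] allI impI)
    fix n :: nat and s t assume n: "n \<ge> 1"
    let ?E = "{x\<in>X. M.avg m x \<ge> s}" and ?F = "{x\<in>X. M.avg n x \<le> t}"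
    have "depends_on_prefix S A (m + l) ?E" "depends_on_prefix S A (n + l) ?F"
      by (rule depends_on_prefixI; use avg_eq in metis)+
    then have "c * prob ?E * prob ?F \<le> prob (?E \<inter> pull (m + l + K) ?F)"
      by (intro c(2)) (auto simp: l_def)
    moreover have "?E \<inter> pull (m + l + K) ?F = {x\<in>X. M.avg m x \<ge> s \<and> M.avg n ((left_shift ^^ (m + l + K)) x) \<le> t}"
      using left_shift_funpow_in[of _ S A "m + l + K"] by (auto simp: pull_def)
    ultimately show "c * prob {x\<in>space \<mu>. M.avg m x \<ge> s} * prob {x\<in>space \<mu>. M.avg n x \<le> t}
         \<le> prob {x\<in>space \<mu>. M.avg m x \<ge> s \<and> M.avg n ((left_shift ^^ (m + l + K)) x) \<le> t}" by simp
  qed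
  \<comment> \<open>Four contributions of size at most \<open>\<epsilon> * n\<close> occur below:
    bad blocks, the tolerated averages, the \<open>l\<close> surplus letters of each block, and the
    incomplete last block.\<close>
  define \<epsilon> where "\<epsilon> = \<theta> / 5"
  have \<epsilon>: "\<epsilon> > 0" using \<theta> by (simp add: \<epsilon>_def)
  define C where "C = max 1 (B' / A'\<^sup>2)"
  define \<kappa> where "\<kappa> = (1 / 4) powr (1 / \<epsilon>) / C"
  have C: "C \<ge> 1" "B' / A'\<^sup>2 \<le> C" by (auto simp: C_def)
  have \<kappa>: "\<kappa> > 0" using C by (simp add: \<kappa>_def)
  \<comment> \<open>A lower bound on \<open>m\<close> that makes the \<open>l\<close> surplus
    letters a fraction of at most \<open>\<epsilon>\<close> of each block.\<close>
  obtain m\<^sub>0 :: nat where m\<^sub>0: "real l / \<epsilon> < real m\<^sub>0" using reals_Archimedean2 by blast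
  obtain m where m: "m \<ge> max 1 m\<^sub>0" "prob {x\<in>X. \<bar>M.avg m x\<bar> \<ge> \<epsilon>} \<le> \<kappa>"
    using M.small_deviation_probability[OF c(1) gap \<epsilon> \<kappa>, of m\<^sub>0] by auto
  have lm: "real l \<le> \<epsilon> * real m"
  proof -
    have "real l < \<epsilon> * real m\<^sub>0" using m\<^sub>0 \<epsilon> by (simp add: divide_less_eq mult.commute)
    also have "\<dots> \<le> \<epsilon> * real m" using m(1) \<epsilon> by (intro mult_left_mono) auto
    finally show ?thesis by simp
  qed
  define D where "D = {x\<in>X. \<bar>M.avg m x\<bar> \<ge> \<epsilon>}"
  define L where "L = m + l"
  have L: "L \<ge> 1" "m \<le> L" using m by (auto simp: L_def l_def)
  have D: "depends_on_prefix S A L D"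
    unfolding D_def L_def by (rule depends_on_prefixI) (use avg_eq in metis)
  have CD: "C * prob D \<le> (1 / 4) powr (1 / \<epsilon>)"
    using m(2) C(1) unfolding D_def[symmetric] \<kappa>_def by (simp add: le_divide_eq mult.commute)
  define Sf where "Sf n x = (\<Sum>j<n. M.f ((left_shift ^^ j) x))" for n x
  have Sf_add: "Sf (n + k) x = Sf n x + Sf k ((left_shift ^^ n) x)" for n k x
    using birkhoff_add[of M.f n k x] by (simp add: Sf_def birkhoff_def)
  have Sf_bound: "\<bar>Sf n x\<bar> \<le> real n" for n x
  proof -
    have "\<bar>Sf n x\<bar> \<le> (\<Sum>j<n. 1)"
      unfolding Sf_def by (rule order_trans[OF sum_abs]) (intro sum_mono M.f_bound)
    then show ?thesis by simp
  qed
  have block: "\<bar>Sf L y\<bar> \<le> (if y \<in> D then real m else 0) + (real m * \<epsilon> + real l)" if "y \<in> X" for y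
  proof -
    have "Sf m y = real m * M.avg m y" using m(1) by (simp add: Sf_def M.avg_def)
    then have "\<bar>Sf m y\<bar> = real m * \<bar>M.avg m y\<bar>" by (simp add: abs_mult)
    also have "\<dots> \<le> (if y \<in> D then real m else 0) + real m * \<epsilon>"
    proof (cases "y \<in> D")
      case True
      have "real m * \<bar>M.avg m y\<bar> \<le> real m * 1" by (intro mult_left_mono M.avg_bound) simp
      then show ?thesis using True \<epsilon> by (simp add: add_increasing2)
    next
      case False
      then have "\<bar>M.avg m y\<bar> \<le> \<epsilon>" using that by (auto simp: D_def)
      then show ?thesis using False by (simp add: mult_left_mono)
    qed
    finally show ?thesis
      using Sf_add[of m l y] Sf_bound[of l "(left_shift ^^ m) y"] unfolding L_def by linarith
  qed
  have blocks: "\<bar>Sf (q * L) x\<bar> \<le> (\<Sum>i<q. (if (left_shift ^^ (i * L)) x \<in> D then real m else 0) + (real m * \<epsilon> + real l))"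
    if x: "x \<in> X" for q x
  proof (induction q)
    case (Suc q)
    have "Sf (Suc q * L) x = Sf (q * L) x + Sf L ((left_shift ^^ (q * L)) x)"
      using Sf_add[of "q * L" L x] by (simp add: add.commute)
    then show ?case
      using Suc block[OF left_shift_funpow_in[OF x, of "q * L"]] by simp
  qed (simp add: Sf_def)
  have deviation: "{x\<in>X. \<bar>frequency n (cylinder S A w) x - prob (cylinder S A w)\<bar> \<ge> \<theta>}
      \<subseteq> {x\<in>X. \<epsilon> * real (n div L) \<le> real (card {j\<in>{..<n div L}. (left_shift ^^ (j * L)) x \<in> D})}"
    if n: "n \<ge> 1" "real L \<le> \<epsilon> * real n" for n
  proof (intro subsetI CollectI conjI)
    fix x assume x': "x \<in> {x\<in>X. \<bar>frequency n (cylinder S A w) x - prob (cylinder S A w)\<bar> \<ge> \<theta>}"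
    then have x: "x \<in> X" by simp
    have "frequency n (cylinder S A w) x - prob (cylinder S A w) = Sf n x / real n"
      using n(1) by (simp add: frequency_def Sf_def M.f_def sum_subtractf diff_divide_distrib)
    then have dev: "\<theta> * real n \<le> \<bar>Sf n x\<bar>" using x' n(1) by (simp add: le_divide_eq abs_divide)
    let ?q = "n div L"
    let ?k = "real (card {j\<in>{..<?q}. (left_shift ^^ (j * L)) x \<in> D})"
    show "\<epsilon> * real ?q \<le> ?k"
    proof (rule ccontr)
      assume "\<not> ?thesis"
      then have k: "?k \<le> \<epsilon> * real ?q" by simp
      have "Sf n x = Sf (?q * L) x + Sf (n mod L) ((left_shift ^^ (?q * L)) x)"
        using Sf_add[of "?q * L" "n mod L" x] by simp
      then have "\<bar>Sf n x\<bar> \<le> \<bar>Sf (?q * L) x\<bar> + real (n mod L)"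
        using Sf_bound[of "n mod L" "(left_shift ^^ (?q * L)) x"] by linarith
      also have "real (n mod L) \<le> real L" using L(1) by (simp add: less_imp_le)
      also have "\<bar>Sf (?q * L) x\<bar> \<le> real m * ?k + real ?q * (real m * \<epsilon> + real l)"
        using blocks[OF x, of ?q] by (simp add: sum.distrib sum.If_cases Int_def conj_commute mult.commute)
      also have "real m * ?k \<le> real m * (\<epsilon> * real ?q)" using k by (intro mult_left_mono) auto
      also have "real ?q * (real m * \<epsilon> + real l) \<le> real ?q * (real m * \<epsilon> + \<epsilon> * real m)"
        using lm by (intro mult_left_mono add_mono) auto
      finally have "\<bar>Sf n x\<bar> \<le> 3 * \<epsilon> * (real ?q * real m) + real L"
        by (simp add: algebra_simps)
      also have "real ?q * real m \<le> real n"
      proof -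
        have "?q * m \<le> ?q * L" using L(2) by simp
        also have "\<dots> \<le> n" by simp
        finally show ?thesis by (metis of_nat_le_iff of_nat_mult)
      qed
      finally have "\<bar>Sf n x\<bar> \<le> 4 * \<epsilon> * real n"
        using \<epsilon> n(2) by (simp add: mult_left_mono)
      moreover have "4 * \<epsilon> * real n < \<theta> * real n" using n(1) \<theta> by (simp add: \<epsilon>_def)
      ultimately show False using dev by simp
    qed
  qed (simp)
  obtain n\<^sub>1 :: nat where n\<^sub>1: "real L / \<epsilon> < real n\<^sub>1" using reals_Archimedean2 by blast
  \<comment> \<open>The bound halves once per block of length \<open>L\<close>; rounding in
    \<open>n div L\<close> costs the factor \<open>2\<close> that enters \<open>R\<close>.\<close>
  define \<gamma> where "\<gamma> = ln 2 / real L"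
  \<comment> \<open>The second entry of the maximum covers the finitely many \<open>n\<close> below
    the threshold, where the probability is bounded by one.\<close>
  define R where "R = max 2 (exp (\<gamma> * real (Suc n\<^sub>1)))"
  have \<gamma>: "\<gamma> > 0" using L(1) by (simp add: \<gamma>_def)
  show ?thesis
  proof (rule that[OF \<gamma>])
    fix n
    let ?dev = "{x\<in>X. \<bar>frequency n (cylinder S A w) x - prob (cylinder S A w)\<bar> \<ge> \<theta>}"
    show "prob ?dev \<le> R * exp (- \<gamma> * real n)"
    proof (cases "n \<ge> Suc n\<^sub>1")
      case True
      have "real L \<le> \<epsilon> * real n"
      proof -
        have "real L < \<epsilon> * real n\<^sub>1" using n\<^sub>1 \<epsilon> by (simp add: divide_less_eq mult.commute)
        also have "\<dots> \<le> \<epsilon> * real n" using True \<epsilon> by (intro mult_left_mono) auto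
        finally show ?thesis by simp
      qed
      then have "prob ?dev \<le> prob {x\<in>X. \<epsilon> * real (n div L) \<le> real (card {j\<in>{..<n div L}. (left_shift ^^ (j * L)) x \<in> D})}"
      proof (intro finite_measure_mono deviation)
        have "depends_on_prefix S A (Suc (n div L) * L) {x\<in>X. \<epsilon> * real (n div L) \<le> real (card {j\<in>{..<n div L}. (left_shift ^^ (j * L)) x \<in> D})}"
        proof (rule depends_on_prefixI)
          fix x y assume x: "x \<in> X" and y: "y \<in> X" and eq: "\<And>i. i < Suc (n div L) * L \<Longrightarrow> x i = y i"
            and h: "\<epsilon> * real (n div L) \<le> real (card {j\<in>{..<n div L}. (left_shift ^^ (j * L)) x \<in> D})"
          have "(left_shift ^^ (j * L)) x \<in> D \<longleftrightarrow> (left_shift ^^ (j * L)) y \<in> D" if j: "j < n div L" for j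
            using block_hits_prefix[OF D, of "{j}" "n div L"] j x y eq
            unfolding depends_on_prefix_def block_hits_def by (auto; metis)
          then have "{j\<in>{..<n div L}. (left_shift ^^ (j * L)) x \<in> D} = {j\<in>{..<n div L}. (left_shift ^^ (j * L)) y \<in> D}" by auto
          then show "\<epsilon> * real (n div L) \<le> real (card {j\<in>{..<n div L}. (left_shift ^^ (j * L)) y \<in> D})" using h by simp
        qed
        then show "{x\<in>X. \<epsilon> * real (n div L) \<le> real (card {j\<in>{..<n div L}. (left_shift ^^ (j * L)) x \<in> D})} \<in> sets \<mu>"
          by (rule prefix_sets)
      qed (use True in auto)
      also have "\<dots> \<le> (1 / 2) ^ (n div L)"
        by (rule prob_many_block_hits[OF L(1) D C(2) CD \<epsilon>])
      also have "\<dots> = exp (- ln 2 * real (n div L))"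
        by (simp add: exp_of_nat2_mult exp_minus inverse_eq_divide power_one_over)
      also have "\<dots> \<le> exp (ln 2 - \<gamma> * real n)"
      proof -
        have "real n \<le> real L * (real (n div L) + 1)"
        proof -
          have "n < L * (n div L + 1)" using L(1) dividend_less_times_div[of L n] by simp
          then have "real n < real (L * (n div L + 1))" by (simp only: of_nat_less_iff)
          then show ?thesis by (simp add: distrib_left)
        qed
        then have "\<gamma> * real n \<le> \<gamma> * (real L * (real (n div L) + 1))" using \<gamma> by (intro mult_left_mono) auto
        also have "\<dots> = ln 2 * (real (n div L) + 1)" using L(1) by (simp add: \<gamma>_def)
        finally show ?thesis by (simp add: algebra_simps)
      qed
      also have "\<dots> = 2 * exp (- \<gamma> * real n)" by (simp add: exp_diff exp_minus divide_inverse)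
      also have "\<dots> \<le> R * exp (- \<gamma> * real n)" by (intro mult_right_mono) (auto simp: R_def)
      finally show ?thesis .
    next
      case False
      have "prob ?dev \<le> 1" by simp
      also have "1 \<le> exp (\<gamma> * real (Suc n\<^sub>1)) * exp (- \<gamma> * real n)"
        using False \<gamma> by (simp add: mult_exp_exp)
      also have "\<dots> \<le> R * exp (- \<gamma> * real n)" by (intro mult_right_mono) (auto simp: R_def)
      finally show ?thesis .
    qed
  qed
qed

end

section \<open>Weak convergence from cylinders\<close>

context gibbs_shift begin

text \<open>By continuity \<open>g\<close> stays near \<open>g x\<close> on all long prefix
  cylinders of \<open>x\<close>, and so does its infimum there.\<close>

lemma cylinder_infimum_limit:
  fixes g :: "(nat \<Rightarrow> 's) \<Rightarrow> real"
  assumes cont: "continuous_map (shift_topology S A) euclideanreal g"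
    and bound: "\<And>x. x \<in> X \<Longrightarrow> 0 \<le> g x \<and> g x \<le> B" and x: "x \<in> X"
  shows "(\<lambda>k. INF y\<in>cyl k x. g y) \<longlonglongrightarrow> g x"
proof (rule LIMSEQ_I)
  have bdd: "bdd_below (g ` cyl k x)" for k
    using bound by (intro bdd_belowI2[of _ 0]) (auto simp: cylinder_def)
  fix e :: real assume e: "0 < e"
  have "openin (shift_topology S A) {y \<in> topspace (shift_topology S A). g y \<in> {g x - e / 2<..}}"
    by (rule openin_continuous_map_preimage[OF cont]) auto
  then obtain N where N: "cyl N x \<subseteq> {y \<in> X. g y \<in> {g x - e / 2<..}}"
    using x e unfolding openin_shift_topology by auto
  show "\<exists>N. \<forall>k\<ge>N. norm ((INF y\<in>cyl k x. g y) - g x) < e"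
  proof (intro exI[of _ N] allI impI)
    fix k assume "k \<ge> N"
    then have "cyl k x \<subseteq> cyl N x" by (auto simp: mem_cylinder_prefix)
    moreover have xk: "x \<in> cyl k x" using x by (simp add: mem_cylinder_prefix)
    ultimately have "g x - e / 2 \<le> (INF y\<in>cyl k x. g y)"
      using N by (intro cINF_greatest) force+
    moreover have "(INF y\<in>cyl k x. g y) \<le> g x" by (rule cINF_lower[OF bdd xk])
    ultimately show "norm ((INF y\<in>cyl k x. g y) - g x) < e" using e by simp
  qed
qed

definition words :: "nat \<Rightarrow> 's list set" where
  "words k = (\<lambda>x. map x [0..<k]) ` X"

text \<open>Only finitely many of the possibly infinitely many words of length \<open>k\<close> are
  kept. The sum runs over the image set because the enumeration repeats words when there are
  finitely many.\<close>

definition truncated :: "((nat \<Rightarrow> 's) \<Rightarrow> real) \<Rightarrow> nat \<Rightarrow> nat \<Rightarrow> (nat \<Rightarrow> 's) \<Rightarrow> real" where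
  "truncated g k j x = (\<Sum>w\<in>from_nat_into (words k) ` {..<j}. (INF y\<in>cylinder S A w. g y) * indicator (cylinder S A w) x)"

lemma X_nonempty: "X \<noteq> {}"
  using not_empty by simp

lemma from_nat_into_words: "from_nat_into (words k) i \<in> words k"
  using X_nonempty by (intro from_nat_into) (auto simp: words_def)

lemma truncated_eq:
  assumes "x \<in> X"
  shows "truncated g k j x = (if map x [0..<k] \<in> from_nat_into (words k) ` {..<j} then INF y\<in>cyl k x. g y else 0)"
proof -
  have ind: "indicator (cylinder S A w) x = (if w = map x [0..<k] then 1 else 0 :: real)"
    if w: "w \<in> from_nat_into (words k) ` {..<j}" for w
  proof -
    have "w \<in> words k" using w from_nat_into_words by auto
    then have len: "length w = k" by (auto simp: words_def)
    have "x \<in> cylinder S A w \<longleftrightarrow> w = map x [0..<k]"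
    proof
      show "w = map x [0..<k]" if "x \<in> cylinder S A w" using cylinder_eq_prefix[OF that] unfolding len .
      show "x \<in> cylinder S A w" if "w = map x [0..<k]" unfolding that using assms by (simp add: mem_cylinder_prefix)
    qed
    then show ?thesis by (simp add: indicator_def)
  qed
  have "truncated g k j x = (\<Sum>w\<in>from_nat_into (words k) ` {..<j}. if w = map x [0..<k] then INF y\<in>cylinder S A w. g y else 0)"
    unfolding truncated_def by (rule sum.cong[OF refl]) (simp add: ind)
  then show ?thesis by (simp add: sum.delta)
qed

lemma truncated_limit:
  assumes "x \<in> X"
  shows "(\<lambda>j. truncated g k j x) \<longlonglongrightarrow> (INF y\<in>cyl k x. g y)"
proof -
  have "countable (words k)" unfolding words_def by (rule prefix_image_countable[OF countable_S order_refl])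
  moreover have "map x [0..<k] \<in> words k" using assms by (auto simp: words_def)
  ultimately have "\<exists>i. from_nat_into (words k) i = map x [0..<k]" by (rule from_nat_into_surj)
  then obtain i where i: "from_nat_into (words k) i = map x [0..<k]" ..
  have "truncated g k j x = (INF y\<in>cyl k x. g y)" if "j \<ge> Suc i" for j
  proof -
    have "map x [0..<k] \<in> from_nat_into (words k) ` {..<j}"
      using i that by (intro image_eqI[of _ _ i]) auto
    then show ?thesis unfolding truncated_eq[OF assms] by simp
  qed
  then show ?thesis by (intro tendsto_eventually) (auto simp: eventually_sequentially)
qed

text \<open>
  Lower semicontinuity of \<open>\<integral> g\<close>: from below, \<open>g\<close> is a limit of finite combinations of
  cylinder indicators, on which the convergence is assumed.
\<close>

lemma integral_liminf_ge:
  fixes g :: "(nat \<Rightarrow> 's) \<Rightarrow> real"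
  assumes cont: "continuous_map (shift_topology S A) euclideanreal g"
    and bound: "\<And>x. x \<in> X \<Longrightarrow> 0 \<le> g x \<and> g x \<le> B"
    and M: "\<And>n. n \<ge> n\<^sub>0 \<Longrightarrow> finite_measure (M n) \<and> sets (M n) = sets (shift_borel S A)"
    and lim: "\<And>x k. x \<in> X \<Longrightarrow> k \<ge> 1 \<Longrightarrow> (\<lambda>n. measure (M n) (cyl k x)) \<longlonglongrightarrow> prob (cyl k x)"
    and e: "e > 0"
  shows "g \<in> borel_measurable (shift_borel S A)"
    and "\<forall>\<^sub>F n in sequentially. (\<integral>x. g x \<partial>\<mu>) - e \<le> (\<integral>x. g x \<partial>M n)"
proof -
  define gk where "gk k x = (INF y\<in>cyl k x. g y)" for k x
  have bdd: "bdd_below (g ` cylinder S A w)" for w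
    using bound by (intro bdd_belowI2[of _ 0]) (auto simp: cylinder_def)
  have gk: "0 \<le> gk k x" "gk k x \<le> g x" if "x \<in> X" for k x
  proof -
    have "x \<in> cyl k x" using that by (simp add: mem_cylinder_prefix)
    then show "gk k x \<le> g x" unfolding gk_def by (rule cINF_lower[OF bdd])
    show "0 \<le> gk k x"
      unfolding gk_def using \<open>x \<in> cyl k x\<close> bound by (intro cINF_greatest) (auto simp: cylinder_def)
  qed
  have tr: "0 \<le> truncated g k j x" "truncated g k j x \<le> gk k x" if "x \<in> X" for k j x
    unfolding truncated_eq[OF that] gk_def[symmetric] using gk[OF that] by auto
  have tr_meas: "truncated g k j \<in> borel_measurable (shift_borel S A)" for k j
    unfolding truncated_def[abs_def] by (intro borel_measurable_sum borel_measurable_times borel_measurable_const borel_measurable_indicator cylinder_sets)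
  have gk_meas: "gk k \<in> borel_measurable (shift_borel S A)" for k
    by (rule borel_measurable_LIMSEQ_real[OF _ tr_meas]) (auto simp: gk_def intro: truncated_limit)
  show g_meas: "g \<in> borel_measurable (shift_borel S A)"
    by (rule borel_measurable_LIMSEQ_real[OF _ gk_meas])
       (auto simp: gk_def intro!: cylinder_infimum_limit[OF cont bound])
  have meas: "u \<in> borel_measurable \<mu>" if "u \<in> borel_measurable (shift_borel S A)" for u :: "(nat \<Rightarrow> 's) \<Rightarrow> real"
    using that measurable_cong_sets[OF sets_\<mu> refl] by blast
  have int: "integrable \<mu> u" if "u \<in> borel_measurable (shift_borel S A)" "\<And>x. x \<in> X \<Longrightarrow> 0 \<le> u x \<and> u x \<le> B" for u
    using that by (intro integrable_const_bound[of _ B] meas) auto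
  have "(\<lambda>k. \<integral>x. gk k x \<partial>\<mu>) \<longlonglongrightarrow> (\<integral>x. g x \<partial>\<mu>)"
  proof (rule integral_dominated_convergence[of _ _ _ "\<lambda>_. B"])
    show "AE x in \<mu>. (\<lambda>k. gk k x) \<longlonglongrightarrow> g x"
      by (rule AE_I2) (auto simp: gk_def intro!: cylinder_infimum_limit[OF cont bound])
    show "AE x in \<mu>. norm (gk k x) \<le> B" for k
    proof (rule AE_I2)
      fix x assume "x \<in> space \<mu>"
      then show "norm (gk k x) \<le> B" using gk[of x k] bound[of x] by simp
    qed
  qed (auto intro: meas g_meas gk_meas)
  \<comment> \<open>A third of \<open>e\<close> each goes to the infima over cylinders, the
    restriction to finitely many words, and the convergence of measures.\<close>
  then have "\<forall>\<^sub>F k in sequentially. (\<integral>x. g x \<partial>\<mu>) - e / 3 < (\<integral>x. gk k x \<partial>\<mu>)"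
    using e by (intro order_tendstoD) auto
  then have "\<forall>\<^sub>F k in sequentially. k \<ge> 1 \<and> (\<integral>x. g x \<partial>\<mu>) - e / 3 < (\<integral>x. gk k x \<partial>\<mu>)"
    using eventually_ge_at_top[of 1] by eventually_elim simp
  then obtain k where k: "k \<ge> 1" "(\<integral>x. g x \<partial>\<mu>) - e / 3 < (\<integral>x. gk k x \<partial>\<mu>)"
    using eventually_happens by fastforce
  have "(\<lambda>j. \<integral>x. truncated g k j x \<partial>\<mu>) \<longlonglongrightarrow> (\<integral>x. gk k x \<partial>\<mu>)"
  proof (rule integral_dominated_convergence[of _ _ _ "\<lambda>_. B"])
    show "AE x in \<mu>. (\<lambda>j. truncated g k j x) \<longlonglongrightarrow> gk k x"
      by (rule AE_I2) (auto simp: gk_def intro!: truncated_limit)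
    show "AE x in \<mu>. norm (truncated g k j x) \<le> B" for j
    proof (rule AE_I2)
      fix x assume "x \<in> space \<mu>"
      then show "norm (truncated g k j x) \<le> B" using tr[of x k j] gk[of x k] bound[of x] by simp
    qed
  qed (auto intro: meas tr_meas gk_meas)
  then have "\<forall>\<^sub>F j in sequentially. (\<integral>x. gk k x \<partial>\<mu>) - e / 3 < (\<integral>x. truncated g k j x \<partial>\<mu>)"
    using e by (intro order_tendstoD) auto
  then obtain j where j: "(\<integral>x. gk k x \<partial>\<mu>) - e / 3 < (\<integral>x. truncated g k j x \<partial>\<mu>)"
    using eventually_happens by fastforce
  let ?F = "from_nat_into (words k) ` {..<j}"
  let ?c = "\<lambda>w. INF y\<in>cylinder S A w. g y"
  have sum_int: "(\<integral>x. truncated g k j x \<partial>N) = (\<Sum>w\<in>?F. ?c w * measure N (cylinder S A w))"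
    if N: "finite_measure N" "sets N = sets (shift_borel S A)" for N
  proof -
    interpret N: finite_measure N by (rule N)
    have cs: "cylinder S A w \<in> sets N" for w unfolding N(2) by (rule cylinder_sets)
    have "space N = X" using sets_eq_imp_space_eq[OF N(2)] by simp
    then have sp: "cylinder S A w \<inter> space N = cylinder S A w" for w unfolding cylinder_def by blast
    have i: "integrable N (indicator (cylinder S A w) :: _ \<Rightarrow> real)" for w
      by (rule integrable_real_indicator[OF cs]) (simp add: less_top[symmetric])
    have "(\<integral>x. truncated g k j x \<partial>N) = (\<Sum>w\<in>?F. \<integral>x. ?c w * indicator (cylinder S A w) x \<partial>N)"
      unfolding truncated_def by (rule Bochner_Integration.integral_sum) (intro integrable_mult_right i)
    then show ?thesis by (simp only: integral_mult_right_zero Bochner_Integration.integral_indicator sp)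
  qed
  \<comment> \<open>Only finitely many cylinders are left, so convergence on each of them passes to
    the sum.\<close>
  have "(\<lambda>n. \<Sum>w\<in>?F. ?c w * measure (M n) (cylinder S A w)) \<longlonglongrightarrow> (\<Sum>w\<in>?F. ?c w * prob (cylinder S A w))"
  proof (intro tendsto_sum tendsto_mult tendsto_const)
    fix w assume "w \<in> ?F"
    then have "w \<in> words k" using from_nat_into_words by auto
    then obtain x where "x \<in> X" "w = map x [0..<k]" by (auto simp: words_def)
    then show "(\<lambda>n. measure (M n) (cylinder S A w)) \<longlonglongrightarrow> prob (cylinder S A w)" using lim k(1) by simp
  qed
  moreover have "(\<Sum>w\<in>?F. ?c w * prob (cylinder S A w)) = (\<integral>x. truncated g k j x \<partial>\<mu>)"
    using sum_int[OF _ sets_\<mu>] by (simp add: finite_measure_axioms)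
  ultimately have "\<forall>\<^sub>F n in sequentially. (\<integral>x. truncated g k j x \<partial>\<mu>) - e / 3 < (\<Sum>w\<in>?F. ?c w * measure (M n) (cylinder S A w))"
    using e by (intro order_tendstoD) auto
  then show "\<forall>\<^sub>F n in sequentially. (\<integral>x. g x \<partial>\<mu>) - e \<le> (\<integral>x. g x \<partial>M n)"
    using eventually_ge_at_top[of n\<^sub>0]
  proof eventually_elim
    case (elim n)
    interpret N: finite_measure "M n" using M[OF elim(2)] by simp
    have sets: "sets (M n) = sets (shift_borel S A)" using M[OF elim(2)] by simp
    have space: "space (M n) = X" using sets_eq_imp_space_eq[OF sets] by simp
    have m: "u \<in> borel_measurable (M n)" if "u \<in> borel_measurable (shift_borel S A)" for u :: "(nat \<Rightarrow> 's) \<Rightarrow> real"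
      using that measurable_cong_sets[OF sets refl] by blast
    have "(\<Sum>w\<in>?F. ?c w * measure (M n) (cylinder S A w)) = (\<integral>x. truncated g k j x \<partial>M n)"
      by (rule sum_int[OF N.finite_measure_axioms sets, symmetric])
    also have "\<dots> \<le> (\<integral>x. g x \<partial>M n)"
    proof (rule integral_mono)
      show "integrable (M n) (truncated g k j)"
      proof (rule N.integrable_const_bound[of _ B])
        show "AE x in M n. norm (truncated g k j x) \<le> B"
        proof (rule AE_I2)
          fix x assume "x \<in> space (M n)"
          then show "norm (truncated g k j x) \<le> B" using tr[of x k j] gk[of x k] bound[of x] space by simp
        qed
      qed (rule m[OF tr_meas])
      show "integrable (M n) g"
        by (rule N.integrable_const_bound[of _ B]) (use bound space m[OF g_meas] in auto)
      show "truncated g k j x \<le> g x" if "x \<in> space (M n)" for x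
        using tr[of x k j] gk[of x k] that space by simp
    qed
    finally show ?case using elim(1) k(2) j by linarith
  qed
qed

text \<open>Lower semicontinuity is applied to the nonnegative functions \<open>h + B\<close> and
  \<open>B - h\<close>; equal total masses cancel the constant \<open>B\<close>. No mass escapes,
  because finitely many cylinders already carry nearly all of the limit.\<close>

theorem weak_star_convergesI:
  assumes M: "\<And>n. n \<ge> n\<^sub>0 \<Longrightarrow> finite_measure (M n) \<and> sets (M n) = sets (shift_borel S A)"
    and total: "\<And>n. n \<ge> n\<^sub>0 \<Longrightarrow> measure (M n) X = 1"
    and lim: "\<And>x k. x \<in> X \<Longrightarrow> k \<ge> 1 \<Longrightarrow> (\<lambda>n. measure (M n) (cyl k x)) \<longlonglongrightarrow> prob (cyl k x)"
  shows "weak_star_converges S A M \<mu>"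
  unfolding weak_star_converges_def
proof (intro allI impI, elim conjE)
  fix h :: "(nat \<Rightarrow> 's) \<Rightarrow> real"
  assume cont: "continuous_map (shift_topology S A) euclideanreal h" and "bounded (h ` X)"
  then obtain B where B: "\<And>x. x \<in> X \<Longrightarrow> \<bar>h x\<bar> \<le> B" by (auto simp: bounded_iff)
  have c1: "continuous_map (shift_topology S A) euclideanreal (\<lambda>x. h x + B)"
    by (intro continuous_intros cont) auto
  have c2: "continuous_map (shift_topology S A) euclideanreal (\<lambda>x. B - h x)"
    by (intro continuous_intros cont) auto
  have b1: "0 \<le> h x + B \<and> h x + B \<le> 2 * B" and b2: "0 \<le> B - h x \<and> B - h x \<le> 2 * B" if "x \<in> X" for x
    using B[OF that] by auto
  have "(\<lambda>x. h x + B - B) \<in> borel_measurable (shift_borel S A)"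
    using integral_liminf_ge(1)[OF c1 b1 M lim zero_less_one] by (intro borel_measurable_diff) auto
  then have h_meas: "h \<in> borel_measurable (shift_borel S A)" by simp
  have shift: "(\<integral>x. h x + B \<partial>N) = (\<integral>x. h x \<partial>N) + B" "(\<integral>x. B - h x \<partial>N) = B - (\<integral>x. h x \<partial>N)"
    if N: "finite_measure N" "sets N = sets (shift_borel S A)" "measure N X = 1" for N
  proof -
    interpret N: finite_measure N by (rule N)
    have sp: "space N = X" using sets_eq_imp_space_eq[OF N(2)] by simp
    have "integrable N h"
      using h_meas measurable_cong_sets[OF N(2) refl] B sp by (intro N.integrable_const_bound[of _ B]) auto
    then show "(\<integral>x. h x + B \<partial>N) = (\<integral>x. h x \<partial>N) + B" "(\<integral>x. B - h x \<partial>N) = B - (\<integral>x. h x \<partial>N)"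
      using N(3) sp by auto
  qed
  have s\<mu>: "(\<integral>x. h x + B \<partial>\<mu>) = (\<integral>x. h x \<partial>\<mu>) + B" "(\<integral>x. B - h x \<partial>\<mu>) = B - (\<integral>x. h x \<partial>\<mu>)"
    using shift[OF finite_measure_axioms sets_\<mu>] prob_space by simp_all
  show "(\<lambda>n. \<integral>x. h x \<partial>M n) \<longlonglongrightarrow> (\<integral>x. h x \<partial>\<mu>)"
  proof (rule tendstoI)
    fix e :: real assume e: "e > 0"
    from e have "e / 2 > 0" by simp
    note e2 = this
    have "\<forall>\<^sub>F n in sequentially. (\<integral>x. h x + B \<partial>\<mu>) - e / 2 \<le> (\<integral>x. h x + B \<partial>M n)"
      by (rule integral_liminf_ge(2)[where B = "2 * B" and n\<^sub>0 = n\<^sub>0]) (rule c1 b1 M lim e2 | assumption)+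
    moreover have "\<forall>\<^sub>F n in sequentially. (\<integral>x. B - h x \<partial>\<mu>) - e / 2 \<le> (\<integral>x. B - h x \<partial>M n)"
      by (rule integral_liminf_ge(2)[where B = "2 * B" and n\<^sub>0 = n\<^sub>0]) (rule c2 b2 M lim e2 | assumption)+
    ultimately show "\<forall>\<^sub>F n in sequentially. dist (\<integral>x. h x \<partial>M n) (\<integral>x. h x \<partial>\<mu>) < e"
      using eventually_ge_at_top[of n\<^sub>0]
    proof eventually_elim
      case (elim n)
      then show ?case
        using shift[of "M n"] s\<mu> M[of n] total[of n] e by (auto simp: dist_real_def abs_less_iff)
    qed
  qed
qed

end

section \<open>Averaged empirical measures\<close>

text \<open>Countable additivity of the averaged measure interchanges a series with the sum over
  \<open>\<Lambda>\<close>; this is a theorem on integrals, which the identification makes available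
  for unordered sums.\<close>

lemma nn_integral_count_space_eq_infsum:
  fixes f :: "'a \<Rightarrow> ennreal"
  assumes "countable A"
  shows "(\<integral>\<^sup>+ x. f x \<partial>count_space A) = infsum f A"
proof (rule antisym)
  show "infsum f A \<le> (\<integral>\<^sup>+ x. f x \<partial>count_space A)"
  proof (rule infsum_le_ennreal)
    fix F assume F: "finite F" "F \<subseteq> A"
    have "sum f F = (\<integral>\<^sup>+ x. f x * indicator F x \<partial>count_space UNIV)"
      using F by (simp add: nn_integral_count_space_finite flip: nn_integral_count_space_indicator)
    also have "\<dots> \<le> (\<integral>\<^sup>+ x. f x * indicator A x \<partial>count_space UNIV)"
      using F by (intro nn_integral_mono) (auto simp: indicator_def)
    also have "\<dots> = (\<integral>\<^sup>+ x. f x \<partial>count_space A)"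
      by (simp flip: nn_integral_count_space_indicator)
    finally show "sum f F \<le> (\<integral>\<^sup>+ x. f x \<partial>count_space A)" .
  qed
  show "(\<integral>\<^sup>+ x. f x \<partial>count_space A) \<le> infsum f A"
  proof (cases "finite A")
    case True
    then show ?thesis by (simp add: nn_integral_count_space_finite)
  next
    case False
    let ?g = "from_nat_into A"
    have bij: "bij_betw ?g UNIV A" by (rule bij_betw_from_nat_into[OF assms False])
    have "(\<integral>\<^sup>+ x. f x \<partial>count_space A) = (\<Sum>i. f (?g i))"
      using nn_integral_bij_count_space[OF bij, of f] by (simp add: nn_integral_count_space_nat)
    also have "\<dots> = (SUP n. \<Sum>i<n. f (?g i))" by (rule suminf_eq_SUP)
    also have "\<dots> \<le> infsum f A"
    proof (rule SUP_least)
      fix n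
      have "inj_on ?g {..<n}" using bij by (meson bij_betw_def inj_on_subset subset_UNIV)
      then have "(\<Sum>i<n. f (?g i)) = sum f (?g ` {..<n})" by (simp add: sum.reindex)
      also have "\<dots> \<le> infsum f A"
        using bij by (intro sum_le_infsum_ennreal) (auto simp: bij_betw_def)
      finally show "(\<Sum>i<n. f (?g i)) \<le> infsum f A" .
    qed
    finally show ?thesis .
  qed
qed

lemma sigma_algebra_shift_borel: "sigma_algebra (markov_shift S A) (sets (shift_borel S A))"
  using sets.sigma_algebra_axioms[of "shift_borel S A"] by simp

lemma sets_measure_of_shift [simp]:
  "sets (measure_of (markov_shift S A) (sets (shift_borel S A)) m) = sets (shift_borel S A)"
  using sigma_algebra.sets_measure_of_eq[OF sigma_algebra_shift_borel] .

text \<open>\<open>measure_of\<close> yields the zero measure unless the given set function is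
  positive and countably additive, so both have to be established before any value can be read
  off.\<close>

lemma emeasure_empirical_measure:
  assumes x: "x \<in> markov_shift S A" and E: "E \<in> sets (shift_borel S A)"
  shows "emeasure (empirical_measure S A n x) E
    = (\<Sum>j<n. emeasure (return (shift_borel S A) ((left_shift ^^ j) x)) E) / of_nat n"
  unfolding empirical_measure_def
proof (rule emeasure_measure_of_sigma[OF sigma_algebra_shift_borel _ _ E])
  let ?r = "\<lambda>j. return (shift_borel S A) ((left_shift ^^ j) x)"
  show "positive (sets (shift_borel S A)) (\<lambda>E. (\<Sum>j<n. emeasure (?r j) E) / of_nat n)"
    by (simp add: positive_def)
  show "countably_additive (sets (shift_borel S A)) (\<lambda>E. (\<Sum>j<n. emeasure (?r j) E) / of_nat n)"
  proof (rule countably_additiveI)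
    fix B :: "nat \<Rightarrow> (nat \<Rightarrow> 'a) set"
    assume B: "range B \<subseteq> sets (shift_borel S A)" "disjoint_family B"
    have "(\<Sum>i. (\<Sum>j<n. emeasure (?r j) (B i)) / of_nat n) = (\<Sum>i. \<Sum>j<n. emeasure (?r j) (B i)) / of_nat n"
      by (simp add: divide_ennreal_def ennreal_suminf_multc)
    also have "(\<Sum>i. \<Sum>j<n. emeasure (?r j) (B i)) = (\<Sum>j<n. \<Sum>i. emeasure (?r j) (B i))"
      by (rule suminf_sum) simp
    also have "\<dots> = (\<Sum>j<n. emeasure (?r j) (\<Union>i. B i))"
      using B by (intro sum.cong refl suminf_emeasure) auto
    finally show "(\<Sum>i. (\<Sum>j<n. emeasure (?r j) (B i)) / of_nat n) = (\<Sum>j<n. emeasure (?r j) (\<Union>i. B i)) / of_nat n" .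
  qed
qed

lemma emeasure_averaged_measure:
  assumes \<Lambda>: "countable \<Lambda>" and E: "E \<in> sets (shift_borel S A)"
  shows "emeasure (averaged_measure S A \<phi> n \<Lambda>) E
    = (\<Sum>\<^sub>\<infinity>x\<in>\<Lambda>. ennreal (exp (birkhoff \<phi> n x)) * emeasure (empirical_measure S A n x) E) / partition_sum \<phi> n \<Lambda>"
  unfolding averaged_measure_def
proof (rule emeasure_measure_of_sigma[OF sigma_algebra_shift_borel _ _ E])
  let ?r = "\<lambda>x. emeasure (empirical_measure S A n x)"
  let ?w = "\<lambda>x. ennreal (exp (birkhoff \<phi> n x))"
  have sets: "sets (empirical_measure S A n x) = sets (shift_borel S A)" for x
    by (simp add: empirical_measure_def)
  show "positive (sets (shift_borel S A)) (\<lambda>E. (\<Sum>\<^sub>\<infinity>x\<in>\<Lambda>. ?w x * ?r x E) / partition_sum \<phi> n \<Lambda>)"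
    by (simp add: positive_def)
  show "countably_additive (sets (shift_borel S A)) (\<lambda>E. (\<Sum>\<^sub>\<infinity>x\<in>\<Lambda>. ?w x * ?r x E) / partition_sum \<phi> n \<Lambda>)"
  proof (rule countably_additiveI)
    fix B :: "nat \<Rightarrow> (nat \<Rightarrow> 'a) set"
    assume B: "range B \<subseteq> sets (shift_borel S A)" "disjoint_family B"
    have "(\<Sum>i. (\<Sum>\<^sub>\<infinity>x\<in>\<Lambda>. ?w x * ?r x (B i)) / partition_sum \<phi> n \<Lambda>)
        = (\<Sum>i. \<integral>\<^sup>+ x. ?w x * ?r x (B i) \<partial>count_space \<Lambda>) / partition_sum \<phi> n \<Lambda>"
      by (simp add: divide_ennreal_def ennreal_suminf_multc nn_integral_count_space_eq_infsum[OF \<Lambda>])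
    also have "(\<Sum>i. \<integral>\<^sup>+ x. ?w x * ?r x (B i) \<partial>count_space \<Lambda>) = (\<integral>\<^sup>+ x. (\<Sum>i. ?w x * ?r x (B i)) \<partial>count_space \<Lambda>)"
      by (rule nn_integral_suminf[symmetric]) simp
    also have "\<dots> = (\<integral>\<^sup>+ x. ?w x * ?r x (\<Union>i. B i) \<partial>count_space \<Lambda>)"
      using B sets by (intro nn_integral_cong) (simp add: suminf_emeasure)
    also have "\<dots> = (\<Sum>\<^sub>\<infinity>x\<in>\<Lambda>. ?w x * ?r x (\<Union>i. B i))"
      by (rule nn_integral_count_space_eq_infsum[OF \<Lambda>])
    finally show "(\<Sum>i. (\<Sum>\<^sub>\<infinity>x\<in>\<Lambda>. ?w x * ?r x (B i)) / partition_sum \<phi> n \<Lambda>)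
        = (\<Sum>\<^sub>\<infinity>x\<in>\<Lambda>. ?w x * ?r x (\<Union>i. B i)) / partition_sum \<phi> n \<Lambda>" .
  qed
qed

lemma emeasure_empirical_frequency:
  assumes x: "x \<in> markov_shift S A" and E: "E \<in> sets (shift_borel S A)" and n: "n \<ge> 1"
  shows "emeasure (empirical_measure S A n x) E = ennreal (frequency n E x)"
proof -
  have "(\<Sum>j<n. emeasure (return (shift_borel S A) ((left_shift ^^ j) x)) E)
      = (\<Sum>j<n. ennreal (indicator E ((left_shift ^^ j) x)))"
    using E by (intro sum.cong) (auto simp: indicator_def)
  also have "\<dots> = ennreal (\<Sum>j<n. indicator E ((left_shift ^^ j) x))"
    by (rule sum_ennreal) simp
  finally have e: "(\<Sum>j<n. emeasure (return (shift_borel S A) ((left_shift ^^ j) x)) E)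
      = ennreal (\<Sum>j<n. indicator E ((left_shift ^^ j) x))" .
  show ?thesis
    unfolding emeasure_empirical_measure[OF x E] frequency_def e ennreal_of_nat_eq_real_of_nat
    using n by (intro divide_ennreal sum_nonneg) auto
qed

lemma ennreal_le_combination_iff:
  assumes "0 \<le> c" "0 \<le> w" "0 \<le> q" "0 \<le> t"
  shows "ennreal a \<le> ennreal c * ennreal w + ennreal q \<longleftrightarrow> a \<le> c * w + q"
    and "ennreal a \<le> (ennreal t + ennreal c * ennreal w) + ennreal q \<longleftrightarrow> a \<le> (t + c * w) + q"
proof -
  have "ennreal c * ennreal w + ennreal q = ennreal (c * w + q)"
    "(ennreal t + ennreal c * ennreal w) + ennreal q = ennreal ((t + c * w) + q)"
    using assms by (simp_all add: ennreal_mult)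
  then show "ennreal a \<le> ennreal c * ennreal w + ennreal q \<longleftrightarrow> a \<le> c * w + q"
    "ennreal a \<le> (ennreal t + ennreal c * ennreal w) + ennreal q \<longleftrightarrow> a \<le> (t + c * w) + q"
    using assms by (auto simp only: ennreal_le_iff add_nonneg_nonneg mult_nonneg_nonneg)
qed

context gibbs_shift begin

text \<open>Points whose visit frequency deviates carry weight at most of order
  \<open>exp (n * (P - \<gamma>))\<close>, while the total is at least of order
  \<open>exp (n * (P - \<gamma> / 2))\<close>; their share tends to zero.\<close>

theorem averaged_measures_converge:
  assumes W: "finite W" "W \<subseteq> X" "K \<ge> 1"
    "\<And>s t. s \<in> S \<Longrightarrow> t \<in> S \<Longrightarrow> \<exists>m\<in>W. A s (m 0) \<and> A (m (K - 1)) t"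
    and \<Lambda>: "\<And>n. \<Lambda> n \<subseteq> X"
    and \<phi>: "\<And>n x. x \<in> \<Lambda> n \<Longrightarrow> birkhoff \<phi> n x = birkhoff \<Phi> n x"
    and inj: "\<And>n x y. n \<ge> 1 \<Longrightarrow> x \<in> \<Lambda> n \<Longrightarrow> y \<in> \<Lambda> n \<Longrightarrow> (\<And>i. i < n \<Longrightarrow> x i = y i) \<Longrightarrow> x = y"
    and growth: "\<And>s. s < P \<Longrightarrow> \<exists>\<kappa> n\<^sub>0. \<kappa> > 0 \<and> (\<forall>n\<ge>n\<^sub>0. ennreal (\<kappa> * exp (s * real n)) \<le> partition_sum \<phi> n (\<Lambda> n))"
  shows "weak_star_converges S A (\<lambda>n. averaged_measure S A \<phi> n (\<Lambda> n)) \<mu>"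
proof -
  let ?w = "\<lambda>n x. exp (birkhoff \<phi> n x)"
  let ?Z = "\<lambda>n. partition_sum \<phi> n (\<Lambda> n)"
  let ?M = "\<lambda>n. averaged_measure S A \<phi> n (\<Lambda> n)"
  have inj_prefix: "inj_on (\<lambda>x. map x [0..<n]) (\<Lambda> n)" if "n \<ge> 1" for n
  proof (rule inj_onI)
    fix x y assume xy: "x \<in> \<Lambda> n" "y \<in> \<Lambda> n" "map x [0..<n] = map y [0..<n]"
    show "x = y" by (rule inj[OF that xy(1,2)]) (use xy(3) in simp)
  qed
  have count: "countable (\<Lambda> n)" if "n \<ge> 1" for n
    using prefix_image_countable[OF countable_S \<Lambda>] inj_prefix[OF that] by (rule countable_image_inj_on)
  \<comment> \<open>The lower Gibbs bound converts weights into measures of cylinders, which are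
    disjoint because points of \<open>\<Lambda> n\<close> are told apart by \<open>n\<close>
    letters.\<close>
  have mass_le: "sum (?w n) F \<le> exp (real n * P) / A' * prob E"
    if n: "n \<ge> 1" and F: "finite F" "F \<subseteq> \<Lambda> n" and E: "\<And>x. x \<in> F \<Longrightarrow> cyl n x \<subseteq> E" "E \<in> sets \<mu>" for n F E
  proof -
    have "sum (?w n) F \<le> (\<Sum>x\<in>F. exp (real n * P) / A' * prob (cyl n x))"
    proof (rule sum_mono)
      fix x assume x: "x \<in> F"
      have xx: "x \<in> \<Lambda> n" "x \<in> X" using x F(2) \<Lambda>[of n] by auto
      have "A' * exp (birkhoff \<phi> n x - real n * P) \<le> prob (cyl n x)"
        unfolding \<phi>[OF xx(1)] by (rule gibbs_lower[OF n xx(2)])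
      then have "exp (real n * P) * (A' * exp (birkhoff \<phi> n x - real n * P)) \<le> exp (real n * P) * prob (cyl n x)"
        by (rule mult_left_mono) simp
      moreover have "exp (real n * P) * (A' * exp (birkhoff \<phi> n x - real n * P)) = A' * ?w n x"
        by (simp add: exp_diff)
      ultimately have "A' * ?w n x \<le> exp (real n * P) * prob (cyl n x)" by (simp only:)
      then show "?w n x \<le> exp (real n * P) / A' * prob (cyl n x)"
        using A'_pos by (simp add: field_simps)
    qed
    also have "\<dots> = exp (real n * P) / A' * (\<Sum>x\<in>F. prob (cyl n x))" by (simp add: sum_distrib_left)
    also have "(\<Sum>x\<in>F. prob (cyl n x)) = prob (\<Union>x\<in>F. cyl n x)"
    proof (rule finite_measure_finite_Union[symmetric])
      show "disjoint_family_on (\<lambda>x. cyl n x) F"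
        unfolding disjoint_family_on_def
      proof (intro ballI impI equals0I)
        fix x y z assume xy: "x \<in> F" "y \<in> F" "x \<noteq> y" and "z \<in> cyl n x \<inter> cyl n y"
        then have "z i = x i" "z i = y i" if "i < n" for i using that by (auto simp: mem_cylinder_prefix)
        then have "\<And>i. i < n \<Longrightarrow> x i = y i" by metis
        then show False using inj[OF n, of x y] xy F(2) by auto
      qed
    qed (use F in auto)
    also have "exp (real n * P) / A' * prob (\<Union>x\<in>F. cyl n x) \<le> exp (real n * P) / A' * prob E"
      using E A'_pos by (intro mult_left_mono finite_measure_mono UN_least) auto
    finally show ?thesis .
  qed
  have Z_fin: "?Z n < \<infinity>" if n: "n \<ge> 1" for n
  proof -
    have "?Z n \<le> ennreal (exp (real n * P) / A' * prob X)"
      unfolding partition_sum_def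
    proof (subst infsum_ennreal_le_iff)
      show "\<forall>F. finite F \<and> F \<subseteq> \<Lambda> n \<longrightarrow> sum (?w n) F \<le> exp (real n * P) / A' * prob X"
        using sets.top[of \<mu>] by (intro allI impI mass_le[OF n]) (auto simp: cylinder_def)
    qed (use A'_pos in auto)
    also have "\<dots> < \<infinity>" by simp
    finally show ?thesis .
  qed
  \<comment> \<open>Any rate below \<open>P\<close> would do: only positivity for large
    \<open>n\<close> is extracted from it.\<close>
  obtain \<kappa>\<^sub>0 n\<^sub>0 where n\<^sub>0: "\<kappa>\<^sub>0 > 0" "\<And>n. n \<ge> n\<^sub>0 \<Longrightarrow> ennreal (\<kappa>\<^sub>0 * exp ((P - 1) * real n)) \<le> ?Z n"
    using growth[of "P - 1"] by auto
  have Z_pos: "?Z n > 0" if "n \<ge> n\<^sub>0" for n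
  proof -
    have "0 < ennreal (\<kappa>\<^sub>0 * exp ((P - 1) * real n))" using n\<^sub>0(1) by simp
    then show ?thesis using n\<^sub>0(2)[OF that] by (rule less_le_trans)
  qed
  have em: "emeasure (?M n) E = (\<Sum>\<^sub>\<infinity>x\<in>\<Lambda> n. ennreal (?w n x * frequency n E x)) / ?Z n"
    if n: "n \<ge> 1" and E: "E \<in> sets (shift_borel S A)" for n E
  proof -
    have "(\<Sum>\<^sub>\<infinity>x\<in>\<Lambda> n. ennreal (?w n x) * emeasure (empirical_measure S A n x) E)
        = (\<Sum>\<^sub>\<infinity>x\<in>\<Lambda> n. ennreal (?w n x * frequency n E x))"
    proof (rule infsum_cong)
      fix x assume "x \<in> \<Lambda> n"
      then have "x \<in> X" using \<Lambda> by auto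
      then show "ennreal (?w n x) * emeasure (empirical_measure S A n x) E = ennreal (?w n x * frequency n E x)"
        using emeasure_empirical_frequency[OF _ E n] by (simp add: ennreal_mult frequency_bounds)
    qed
    then show ?thesis using emeasure_averaged_measure[OF count[OF n] E] by simp
  qed
  have total: "emeasure (?M n) X = 1" if n: "n \<ge> max 1 n\<^sub>0" for n
  proof -
    have "frequency n X x = 1" if "x \<in> \<Lambda> n" for x
      using \<Lambda>[of n] that n left_shift_funpow_in[of x S A] by (auto simp: frequency_def)
    then have "(\<Sum>\<^sub>\<infinity>x\<in>\<Lambda> n. ennreal (?w n x * frequency n X x)) = ?Z n"
      unfolding partition_sum_def by (intro infsum_cong) simp
    then have "emeasure (?M n) X = ?Z n / ?Z n"
      using em[of n X] n sets.top[of "shift_borel S A"] by simp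
    then show ?thesis using Z_pos[of n] Z_fin[of n] n by (simp add: ennreal_divide_self)
  qed
  show ?thesis
  proof (rule weak_star_convergesI)
    fix n assume n: "n \<ge> max 1 n\<^sub>0"
    have sp: "space (?M n) = X"
      using sets_eq_imp_space_eq[of "?M n" "shift_borel S A"] by (simp add: averaged_measure_def)
    show "finite_measure (?M n) \<and> sets (?M n) = sets (shift_borel S A)"
      using total[OF n] sp by (auto intro!: finite_measureI simp: averaged_measure_def)
    show "measure (?M n) X = 1" using total[OF n] by (simp add: measure_def)
  next
    fix y k assume y: "y \<in> X" and k: "k \<ge> (1::nat)"
    let ?E = "cyl k y"
    let ?p = "prob ?E"
    have dE: "depends_on_prefix S A k ?E" using depends_on_prefix_cylinder[of S A "map y [0..<k]"] by simp
    have E: "?E \<in> sets (shift_borel S A)" by (rule cylinder_sets)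
    show "(\<lambda>n. measure (?M n) ?E) \<longlonglongrightarrow> ?p"
    proof (rule tendstoI)
      fix e :: real assume e: "e > 0"
      define \<theta> where "\<theta> = e / 2"
      have \<theta>: "\<theta> > 0" using e by (simp add: \<theta>_def)
      then have \<theta>2: "\<theta> / 2 > 0" by simp
      obtain \<gamma> R where \<gamma>: "\<gamma> > 0"
        and LD: "\<And>n. prob {x\<in>X. \<bar>frequency n ?E x - ?p\<bar> \<ge> \<theta> / 2} \<le> R * exp (- \<gamma> * real n)"
        by (rule large_deviations[OF W(1-3), where \<theta> = "\<theta> / 2" and w = "map y [0..<k]"])
           (rule W(4), assumption+, rule \<theta>2, rule that)
      \<comment> \<open>Half of the deviation rate is given up to the growth of the total weight;
        the other half remains in \<open>q\<close>.\<close>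
      obtain \<kappa> n\<^sub>1 where \<kappa>: "\<kappa> > 0" "\<And>n. n \<ge> n\<^sub>1 \<Longrightarrow> ennreal (\<kappa> * exp ((P - \<gamma> / 2) * real n)) \<le> ?Z n"
        using growth[of "P - \<gamma> / 2"] \<gamma> by auto
      define q where "q n = R / (A' * \<kappa>) * exp (- (\<gamma> / 2) * real n)" for n
      have "q \<longlonglongrightarrow> R / (A' * \<kappa>) * 0"
        unfolding q_def
      proof (intro tendsto_mult tendsto_const)
        have "(\<lambda>n. exp (- (\<gamma> / 2)) ^ n) \<longlonglongrightarrow> 0" using \<gamma> by (intro LIMSEQ_realpow_zero) auto
        then show "(\<lambda>n. exp (- (\<gamma> / 2) * real n)) \<longlonglongrightarrow> 0"
          by (simp only: exp_of_nat2_mult)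
      qed
      then have "\<forall>\<^sub>F n in sequentially. q n < \<theta>" using \<theta> by (intro order_tendstoD) auto
      moreover have "\<forall>\<^sub>F n in sequentially. real k / real n < \<theta> / 2"
        using \<theta> lim_const_over_n[of "real k"] by (intro order_tendstoD) auto
      ultimately show "\<forall>\<^sub>F n in sequentially. dist (measure (?M n) ?E) ?p < e"
        using eventually_ge_at_top[of "max 1 (max n\<^sub>0 n\<^sub>1)"]
      proof eventually_elim
        case (elim n)
        then have n: "n \<ge> 1" "n \<ge> n\<^sub>0" "n \<ge> n\<^sub>1" by auto
        let ?a = "frequency n ?E"
        let ?bad = "{x\<in>\<Lambda> n. \<bar>?a x - ?p\<bar> \<ge> \<theta>}"
        \<comment> \<open>The threshold is halved because the whole cylinder of length
          \<open>n\<close> around a bad point must lie in \<open>?Dev\<close>, and within it the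
          frequency varies by at most \<open>k / n < \<theta> / 2\<close>.\<close>
        let ?Dev = "{x\<in>X. \<bar>?a x - ?p\<bar> \<ge> \<theta> / 2}"
        let ?Q = "\<Sum>\<^sub>\<infinity>x\<in>\<Lambda> n. ennreal (?w n x * indicator ?bad x)"
        let ?T = "\<Sum>\<^sub>\<infinity>x\<in>\<Lambda> n. ennreal (?w n x * ?a x)"
        have "depends_on_prefix S A (n + k) ?Dev"
          by (rule depends_on_prefixI) (use frequency_cong[OF _ _ dE, of _ _ n] in metis)
        then have Dev: "?Dev \<in> sets \<mu>" by (rule prefix_sets)
        have bad_le: "sum (?w n) F \<le> exp (real n * P) / A' * (R * exp (- \<gamma> * real n))"
          if F: "finite F" "F \<subseteq> ?bad" for F
        proof -
          have "sum (?w n) F \<le> exp (real n * P) / A' * prob ?Dev"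
          proof (rule mass_le[OF n(1) F(1) _ _ Dev])
            fix x assume "x \<in> F"
            then have x: "x \<in> X" "\<bar>?a x - ?p\<bar> \<ge> \<theta>" using F(2) \<Lambda> by auto
            show "cyl n x \<subseteq> ?Dev"
            proof
              fix z assume "z \<in> cyl n x"
              then have z: "z \<in> X" "\<And>i. i < n \<Longrightarrow> z i = x i" by (auto simp: mem_cylinder_prefix)
              have "\<bar>?a z - ?a x\<bar> \<le> real k / real n"
                by (rule frequency_prefix_stable[OF z(1) x(1) z(2) dE n(1)])
              then have "\<bar>?a z - ?p\<bar> \<ge> \<theta> / 2" using x(2) elim(2) by linarith
              then show "z \<in> ?Dev" using z(1) by simp
            qed
          qed (use F in auto)
          also have "\<dots> \<le> exp (real n * P) / A' * (R * exp (- \<gamma> * real n))"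
            using A'_pos by (intro mult_left_mono LD) auto
          finally show ?thesis .
        qed
        have Q: "?Q \<le> ennreal (exp (real n * P) / A' * (R * exp (- \<gamma> * real n)))"
        proof (subst infsum_ennreal_le_iff)
          show "0 \<le> exp (real n * P) / A' * (R * exp (- \<gamma> * real n))" using bad_le[of "{}"] by simp
          show "\<forall>F. finite F \<and> F \<subseteq> \<Lambda> n \<longrightarrow> (\<Sum>x\<in>F. ?w n x * indicator ?bad x) \<le> exp (real n * P) / A' * (R * exp (- \<gamma> * real n))"
          proof (intro allI impI)
            fix F assume F: "finite F \<and> F \<subseteq> \<Lambda> n"
            then have "(\<Sum>x\<in>F. ?w n x * indicator ?bad x) = sum (?w n) (F \<inter> ?bad)"
              by (simp add: sum.inter_restrict indicator_def if_distrib cong: if_cong)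
            also have "\<dots> \<le> exp (real n * P) / A' * (R * exp (- \<gamma> * real n))" using F by (intro bad_le) auto
            finally show "(\<Sum>x\<in>F. ?w n x * indicator ?bad x) \<le> exp (real n * P) / A' * (R * exp (- \<gamma> * real n))" .
          qed
        qed simp
        \<comment> \<open>Pointwise, the frequency exceeds \<open>?p\<close> by at most
          \<open>\<theta>\<close>, with an additional error of at most one on the bad points. The
          lower estimate is symmetric, arranged without subtraction.\<close>
        have "?T \<le> (\<Sum>\<^sub>\<infinity>x\<in>\<Lambda> n. ennreal (?p + \<theta>) * ennreal (?w n x) + ennreal (?w n x * indicator ?bad x))"
        proof (rule infsum_mono)
          fix x assume x: "x \<in> \<Lambda> n"
          have "?a x \<le> (?p + \<theta>) + indicator ?bad x"
          proof (cases "x \<in> ?bad")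
            case True
            then have "indicator ?bad x = (1 :: real)" by simp
            then show ?thesis using frequency_bounds(2)[of n ?E x] \<theta> measure_nonneg[of \<mu> ?E] by linarith
          next
            case False
            then have "indicator ?bad x = (0 :: real)" "\<bar>?a x - ?p\<bar> < \<theta>" using x by auto
            then show ?thesis by linarith
          qed
          then have "?w n x * ?a x \<le> ?w n x * ((?p + \<theta>) + indicator ?bad x)" by (intro mult_left_mono) auto
          also have "\<dots> = (?p + \<theta>) * ?w n x + ?w n x * indicator ?bad x" by (simp add: algebra_simps)
          finally show "ennreal (?w n x * ?a x) \<le> ennreal (?p + \<theta>) * ennreal (?w n x) + ennreal (?w n x * indicator ?bad x)"
            using \<theta> by (subst ennreal_le_combination_iff(1)) (auto intro: add_nonneg_nonneg)
        qed auto
        also have "\<dots> = ennreal (?p + \<theta>) * ?Z n + ?Q"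
          by (simp add: infsum_add infsum_cmult_ennreal partition_sum_def)
        finally have upper: "?T \<le> ennreal (?p + \<theta>) * ?Z n + ?Q" .
        have "ennreal ?p * ?Z n = (\<Sum>\<^sub>\<infinity>x\<in>\<Lambda> n. ennreal ?p * ennreal (?w n x))"
          by (simp add: infsum_cmult_ennreal partition_sum_def)
        also have "\<dots> \<le> (\<Sum>\<^sub>\<infinity>x\<in>\<Lambda> n. (ennreal (?w n x * ?a x) + ennreal \<theta> * ennreal (?w n x)) + ennreal (?w n x * indicator ?bad x))"
        proof (rule infsum_mono)
          fix x assume x: "x \<in> \<Lambda> n"
          have "?p \<le> (?a x + \<theta>) + indicator ?bad x"
          proof (cases "x \<in> ?bad")
            case True
            then have "indicator ?bad x = (1 :: real)" by simp
            then show ?thesis using frequency_bounds(1)[of n ?E x] \<theta> prob_le_1[of ?E] by linarith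
          next
            case False
            then have "indicator ?bad x = (0 :: real)" "\<bar>?a x - ?p\<bar> < \<theta>" using x by auto
            then show ?thesis by linarith
          qed
          then have "?w n x * ?p \<le> ?w n x * ((?a x + \<theta>) + indicator ?bad x)" by (intro mult_left_mono) auto
          also have "\<dots> = (?w n x * ?a x + \<theta> * ?w n x) + ?w n x * indicator ?bad x" by (simp add: algebra_simps)
          finally have "?p * ?w n x \<le> (?w n x * ?a x + \<theta> * ?w n x) + ?w n x * indicator ?bad x"
            by (simp only: mult.commute)
          then show "ennreal ?p * ennreal (?w n x) \<le> (ennreal (?w n x * ?a x) + ennreal \<theta> * ennreal (?w n x)) + ennreal (?w n x * indicator ?bad x)"
            using \<theta> unfolding ennreal_mult[OF measure_nonneg exp_ge_zero, symmetric]
            by (subst ennreal_le_combination_iff(2)) (auto simp: frequency_bounds)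
        qed auto
        also have "\<dots> = ?T + ennreal \<theta> * ?Z n + ?Q"
          by (simp add: infsum_add infsum_cmult_ennreal partition_sum_def)
        finally have lower: "ennreal ?p * ?Z n \<le> ?T + ennreal \<theta> * ?Z n + ?Q" .
        obtain Z where Z: "?Z n = ennreal Z" "Z > 0"
        proof -
          have "?Z n = ennreal (enn2real (?Z n))" using Z_fin[OF n(1)] by simp
          moreover have "enn2real (?Z n) > 0" using Z_pos[OF n(2)] Z_fin[OF n(1)] by (simp add: enn2real_positive_iff)
          ultimately show thesis by (rule that)
        qed
        define Q' where "Q' = enn2real ?Q"
        have Q': "?Q = ennreal Q'" "Q' \<ge> 0"
          unfolding Q'_def by (rule ennreal_enn2real[OF le_less_trans[OF Q ennreal_less_top], symmetric]) (rule enn2real_nonneg)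
        \<comment> \<open>Finiteness of \<open>?T\<close> is read off from the upper estimate; from
          here on real arithmetic applies.\<close>
        have "ennreal (?p + \<theta>) * ?Z n + ?Q < top_class.top"
          unfolding Z(1) Q'(1) by (simp add: ennreal_mult_less_top)
        then have T_fin: "?T < top_class.top" by (rule le_less_trans[OF upper])
        define T where "T = enn2real ?T"
        have T: "?T = ennreal T" "T \<ge> 0"
          unfolding T_def by (rule ennreal_enn2real[OF T_fin, symmetric]) (rule enn2real_nonneg)
        have up: "T \<le> (?p + \<theta>) * Z + Q'"
          using upper \<theta> Z(2) Q'(2) unfolding Z T Q'
          by (subst (asm) ennreal_le_combination_iff(1)) (auto intro: add_nonneg_nonneg)
        have low: "?p * Z \<le> T + \<theta> * Z + Q'"
          using lower \<theta> Z(2) Q'(2) T(2) unfolding Z T Q' ennreal_mult[OF measure_nonneg less_imp_le[OF Z(2)], symmetric]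
          by (subst (asm) ennreal_le_combination_iff(2)) auto
        have m: "measure (?M n) ?E = T / Z"
          using em[OF n(1) E] Z T by (simp add: measure_def divide_ennreal)
        have QZ: "Q' / Z \<le> q n"
        proof -
          have "Q' \<le> exp (real n * P) / A' * (R * exp (- \<gamma> * real n))"
            using Q bad_le[of "{}"] unfolding Q' by (subst (asm) ennreal_le_iff) auto
          also have "\<dots> = q n * (\<kappa> * exp ((P - \<gamma> / 2) * real n))"
          proof -
            have "exp (real n * P) * exp (- \<gamma> * real n) = exp (- (\<gamma> / 2) * real n) * exp ((P - \<gamma> / 2) * real n)"
              unfolding mult_exp_exp by (simp add: algebra_simps)
            then show ?thesis using \<kappa>(1) A'_pos by (simp add: q_def field_simps)
          qed
          finally have "Q' \<le> q n * (\<kappa> * exp ((P - \<gamma> / 2) * real n))" .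
          moreover have "\<kappa> * exp ((P - \<gamma> / 2) * real n) \<le> Z"
            using \<kappa>(2)[OF n(3)] Z(2) unfolding Z by (subst (asm) ennreal_le_iff) auto
          moreover have "q n \<ge> 0"
          proof -
            have "0 \<le> R * exp (- \<gamma> * real 0)" using LD[of 0] measure_nonneg by (meson order_trans)
            then show ?thesis using A'_pos \<kappa>(1) by (simp add: q_def)
          qed
          ultimately have "Q' \<le> q n * Z" by (meson mult_left_mono order_trans)
          then show ?thesis using Z(2) by (simp add: divide_le_eq)
        qed
        have "T / Z \<le> ?p + \<theta> + Q' / Z" using up Z(2) by (simp add: field_simps)
        moreover have "?p \<le> T / Z + \<theta> + Q' / Z" using low Z(2) by (simp add: field_simps)
        ultimately have "\<bar>T / Z - ?p\<bar> < 2 * \<theta>" using QZ elim(1) by linarith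
        then show ?case unfolding m dist_real_def by (simp add: \<theta>_def)
      qed
    qed
  qed
qed

end

section \<open>Equidistribution\<close>

context group_extension begin

text \<open>\<open>\<tau>\<close> completes each word to a point of \<open>\<Lambda>\<close>, in the
  applications by periodic repetition or by a prescribed tail. It is injective on words, and
  changing the tail costs one factor \<open>exp (- D)\<close>.\<close>

lemma mass_le_partition_sum:
  assumes m: "mass n s t g r"
    and \<tau>: "\<And>x. x \<in> X \<Longrightarrow> x 0 = s \<Longrightarrow> x n = t \<Longrightarrow> cocycle G \<psi> n x = g \<Longrightarrow>
      \<tau> x \<in> \<Lambda> \<and> (\<forall>i<n. \<tau> x i = x i)" and \<Lambda>: "\<Lambda> \<subseteq> X"
  shows "ennreal (exp (- D) * r) \<le> partition_sum \<phi> n \<Lambda>"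
proof -
  obtain F where F: "finite F" "F \<subseteq> {x\<in>X. x 0 = s \<and> x n = t \<and> cocycle G \<psi> n x = g}"
     "\<And>x y. x \<in> F \<Longrightarrow> y \<in> F \<Longrightarrow> \<forall>i<n. x i = y i \<Longrightarrow> x = y" "r \<le> (\<Sum>x\<in>F. exp (birkhoff \<phi> n x))"
    by (rule massE[OF m]) (rule that)
  have \<tau>F: "\<tau> x \<in> \<Lambda>" "\<And>i. i < n \<Longrightarrow> \<tau> x i = x i" "x \<in> X" if "x \<in> F" for x
    using \<tau>[of x] F(2) that by auto
  have inj: "inj_on \<tau> F"
  proof (rule inj_onI)
    fix x y assume xy: "x \<in> F" "y \<in> F" "\<tau> x = \<tau> y"
    have "\<forall>i<n. x i = y i" using \<tau>F(2)[OF xy(1)] \<tau>F(2)[OF xy(2)] xy(3) by metis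
    then show "x = y" by (rule F(3)[OF xy(1,2)])
  qed
  have "exp (- D) * r \<le> (\<Sum>x\<in>F. exp (- D) * exp (birkhoff \<phi> n x))"
    using F(4) by (simp add: sum_distrib_left[symmetric])
  also have "\<dots> \<le> (\<Sum>x\<in>F. exp (birkhoff \<phi> n (\<tau> x)))"
  proof (rule sum_mono)
    fix x assume x: "x \<in> F"
    have "\<bar>birkhoff \<phi> n (\<tau> x) - birkhoff \<phi> n x\<bar> \<le> D"
      using \<tau>F[OF x] \<Lambda> by (intro distortion) auto
    then show "exp (- D) * exp (birkhoff \<phi> n x) \<le> exp (birkhoff \<phi> n (\<tau> x))"
      by (simp add: mult_exp_exp)
  qed
  also have "\<dots> = (\<Sum>y\<in>\<tau> ` F. exp (birkhoff \<phi> n y))" by (simp add: sum.reindex[OF inj])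
  finally have "ennreal (exp (- D) * r) \<le> ennreal (\<Sum>y\<in>\<tau> ` F. exp (birkhoff \<phi> n y))" by (rule ennreal_leI)
  also have "\<dots> = (\<Sum>y\<in>\<tau> ` F. ennreal (exp (birkhoff \<phi> n y)))" by (rule sum_ennreal[symmetric]) simp
  also have "\<dots> \<le> partition_sum \<phi> n \<Lambda>"
    unfolding partition_sum_def using F(1) \<tau>F(1) by (intro sum_le_infsum_ennreal) auto
  finally show ?thesis .
qed

text \<open>Between any two of the finitely many letters from BIP, mixing gives paths of all large
  lengths, so one length serves all pairs. The \<open>k\<close> steps span \<open>k + 1\<close>
  letters, hence \<open>Suc k\<close>.\<close>

lemma BIP_connecting_points:
  assumes "BIP S A"
  obtains W K where "finite W" "W \<subseteq> X" "K \<ge> 1"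
    "\<And>s t. s \<in> S \<Longrightarrow> t \<in> S \<Longrightarrow> \<exists>m\<in>W. A s (m 0) \<and> A (m (K - 1)) t"
proof -
  obtain B where B: "finite B" "B \<subseteq> S" "\<And>a. a \<in> S \<Longrightarrow> \<exists>b\<in>B. \<exists>c\<in>B. A b a \<and> A a c"
    using assms unfolding BIP_def by metis
  have "\<exists>N. \<forall>n\<ge>N. \<exists>x\<in>X. x 0 = fst p \<and> x n = snd p" if p: "p \<in> B \<times> B" for p
  proof -
    have "fst p \<in> S" "snd p \<in> S" using p B(2) by auto
    then obtain N where N: "\<And>n. n \<ge> N \<Longrightarrow> \<exists>x\<in>X. x 0 = fst p \<and> x n = snd p \<and> cocycle G \<psi> n x = \<one>"
      using connecting_point[OF _ _ one_closed] by metis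
    then show ?thesis by blast
  qed
  then obtain N where N: "\<And>p n. p \<in> B \<times> B \<Longrightarrow> n \<ge> N p \<Longrightarrow> \<exists>x\<in>X. x 0 = fst p \<and> x n = snd p"
    by metis
  define k where "k = Max (insert 0 (N ` (B \<times> B)))"
  have "\<exists>x\<in>X. x 0 = fst p \<and> x k = snd p" if "p \<in> B \<times> B" for p
    using that B(1) by (intro N) (auto simp: k_def intro!: Max_ge)
  then obtain x where x: "\<And>p. p \<in> B \<times> B \<Longrightarrow> x p \<in> X \<and> x p 0 = fst p \<and> x p k = snd p" by metis
  show ?thesis
  proof (rule that[of "x ` (B \<times> B)" "Suc k"])
    show "finite (x ` (B \<times> B))" using B(1) by simp
    show "x ` (B \<times> B) \<subseteq> X" using x by auto
    fix s t assume "s \<in> S" "t \<in> S"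
    then obtain c b where cb: "c \<in> B" "b \<in> B" "A s c" "A b t" using B(3) by meson
    then have p: "(c, b) \<in> B \<times> B" by simp
    show "\<exists>m\<in>x ` (B \<times> B). A s (m 0) \<and> A (m (Suc k - 1)) t"
      using x[OF p] cb p by (intro bexI[of _ "x (c, b)"]) auto
  qed simp
qed

end

theorem theorem6p1:
  fixes S :: "'s set" and A :: "'s \<Rightarrow> 's \<Rightarrow> bool"
    and G :: "('g, 'm) monoid_scheme"
    and \<phi> :: "(nat \<Rightarrow> 's) \<Rightarrow> real" and \<psi> :: "'s \<Rightarrow> 'g"
    and d :: nat and \<iota> :: "'g set set \<Rightarrow> nat \<Rightarrow> int"
    and \<xi> :: "nat \<Rightarrow> real" and \<mu> :: "(nat \<Rightarrow> 's) measure"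
    and a\<^sub>0 a :: 's
  defines "f \<equiv> lattice_map G \<iota> \<psi>"
  defines "\<delta> \<equiv> summability_radius S A d \<phi> f"
  assumes "countable S"
    and "BIP S A"
    and "group G" and "finitely_generated G"
    and "locally_Holder S A \<phi>"
    and "\<psi> \<in> S \<rightarrow> carrier G"
    and "\<iota> \<in> iso (free_abelianization G) (int_lattice d)"
    and "a\<^sub>0 \<in> S"
    and I: "topologically_mixing (S \<times> carrier G) (skew_transition A G \<psi>)"
    and II: "\<delta> > 0"
    and III: "unique_minimum_on (ball_d d \<delta>) (\<lambda>w. Gurevich_pressure S A a\<^sub>0 (tilt d \<phi> f w)) \<xi>"
             "\<xi> \<in> Euclidean_space d interior_of ball_d d \<delta>"
    and "Gibbs_measure S A a\<^sub>0 (tilt d \<phi> f \<xi>) \<mu>"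
    and "amenable G"
    and "a \<in> S"
  shows "weak_star_converges S A
           (\<lambda>n. averaged_measure S A \<phi> n
              {x \<in> markov_shift S A. (left_shift ^^ n) x = x \<and> cocycle G \<psi> n x = \<one>\<^bsub>G\<^esub>}) \<mu>
       \<and> weak_star_converges S A
           (\<lambda>n. averaged_measure S A \<phi> n
              {x \<in> cylinder S A [a]. (left_shift ^^ n) x = x \<and> cocycle G \<psi> n x = \<one>\<^bsub>G\<^esub>}) \<mu>
       \<and> (\<forall>o' \<in> markov_shift S A. weak_star_converges S A
           (\<lambda>n. averaged_measure S A \<phi> n
              {x \<in> markov_shift S A. (left_shift ^^ n) x = o' \<and> cocycle G \<psi> n x = \<one>\<^bsub>G\<^esub>}) \<mu>)
       \<and> (\<forall>o' \<in> cylinder S A [a]. weak_star_converges S A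
           (\<lambda>n. averaged_measure S A \<phi> n
              {x \<in> cylinder S A [a]. (left_shift ^^ n) x = o' \<and> cocycle G \<psi> n x = \<one>\<^bsub>G\<^esub>}) \<mu>)"
proof -
  let ?X = "markov_shift S A"
  let ?\<Phi> = "tilt d \<phi> f \<xi>"
  have "\<exists>D\<ge>0. \<forall>n. \<forall>x\<in>?X. \<forall>y\<in>?X. (\<forall>i<n. x i = y i) \<longrightarrow> \<bar>birkhoff \<phi> n x - birkhoff \<phi> n y\<bar> \<le> D"
    by (rule locally_Holder_distortion[OF \<open>locally_Holder S A \<phi>\<close>]) blast
  then obtain D where D0: "D \<ge> 0"
    "\<forall>n. \<forall>x\<in>?X. \<forall>y\<in>?X. (\<forall>i<n. x i = y i) \<longrightarrow> \<bar>birkhoff \<phi> n x - birkhoff \<phi> n y\<bar> \<le> D" by auto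
  have D: "\<bar>birkhoff \<phi> n x - birkhoff \<phi> n y\<bar> \<le> D"
    if "x \<in> ?X" "y \<in> ?X" "\<And>i. i < n \<Longrightarrow> x i = y i" for n x y
    using D0(2) that by blast
  interpret G: group G by fact
  interpret E: group_extension G S A \<psi> \<phi> D
    by unfold_locales (fact | rule D D0(1) | assumption)+
  interpret L: lattice_identification G \<iota> d by unfold_locales fact
  obtain W K where W: "finite W" "W \<subseteq> ?X" "K \<ge> 1"
    "\<And>s t. s \<in> S \<Longrightarrow> t \<in> S \<Longrightarrow> \<exists>m\<in>W. A s (m 0) \<and> A (m (K - 1)) t"
    by (rule E.BIP_connecting_points[OF \<open>BIP S A\<close>]) (rule that)
  have gibbs: "sets \<mu> = sets (shift_borel S A)" "prob_space \<mu>" "distr \<mu> \<mu> left_shift = \<mu>"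
    using \<open>Gibbs_measure S A a\<^sub>0 ?\<Phi> \<mu>\<close> unfolding Gibbs_measure_def by auto
  obtain P A' B' where P: "Gurevich_pressure S A a\<^sub>0 ?\<Phi> = ereal P" and AB: "A' > 0" "B' > 0"
    and ratio: "\<forall>n\<ge>1. \<forall>w \<in> allowed_words S A n. \<forall>x \<in> cylinder S A w.
           A' \<le> measure \<mu> (cylinder S A w) / exp (birkhoff ?\<Phi> n x - real n * P) \<and>
           measure \<mu> (cylinder S A w) / exp (birkhoff ?\<Phi> n x - real n * P) \<le> B'"
    using \<open>Gibbs_measure S A a\<^sub>0 ?\<Phi> \<mu>\<close> unfolding Gibbs_measure_def by auto
  interpret M: prob_space \<mu> by (rule gibbs(2))
  interpret M: gibbs_shift \<mu> S A ?\<Phi> P A' B'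
  proof unfold_locales
    fix n x assume n: "n \<ge> (1::nat)" and x: "x \<in> ?X"
    have "x \<in> cylinder S A (map x [0..<n])" using x by (simp add: mem_cylinder_prefix)
    then have r: "A' \<le> measure \<mu> (cylinder S A (map x [0..<n])) / exp (birkhoff ?\<Phi> n x - real n * P)"
      "measure \<mu> (cylinder S A (map x [0..<n])) / exp (birkhoff ?\<Phi> n x - real n * P) \<le> B'"
      using ratio[rule_format, OF n prefix_allowed[OF x]] by blast+
    show "A' * exp (birkhoff ?\<Phi> n x - real n * P) \<le> measure \<mu> (cylinder S A (map x [0..<n]))"
      using r(1) by (simp add: le_divide_eq)
    show "measure \<mu> (cylinder S A (map x [0..<n])) \<le> B' * exp (birkhoff ?\<Phi> n x - real n * P)"
      using r(2) by (simp add: divide_le_eq)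
  qed (fact | rule gibbs AB)+
  have min: "unique_minimum_on (ball_d d \<delta>) (\<lambda>w. Gurevich_pressure S A a\<^sub>0 (tilt d \<phi> (lattice_map G \<iota> \<psi>) w)) \<xi>"
    using III(1) unfolding f_def .
  \<comment> \<open>The minimum concerns the pressure at \<open>a\<^sub>0\<close>; growth of return
    masses is carried over to every state \<open>c\<close>.\<close>
  have growth: "\<exists>\<kappa> n\<^sub>0. \<kappa> > 0 \<and> (\<forall>n\<ge>n\<^sub>0. E.mass n c c \<one>\<^bsub>G\<^esub> (\<kappa> * exp (s * real n)))"
    if c: "c \<in> S" and s: "s < P" for c s
  proof -
    obtain \<kappa> n\<^sub>0 where "\<kappa> > 0" "\<And>n. n \<ge> n\<^sub>0 \<Longrightarrow> E.mass n c c \<one>\<^bsub>G\<^esub> (\<kappa> * exp (s * real n))"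
      by (rule E.return_mass_growth[OF \<open>\<iota> \<in> _\<close> \<open>amenable G\<close> \<open>a\<^sub>0 \<in> S\<close> c min P[unfolded f_def] s]) (rule that)
    then show ?thesis by blast
  qed
  have zero: "birkhoff \<phi> n x = birkhoff ?\<Phi> n x" if "x \<in> ?X" "cocycle G \<psi> n x = \<one>\<^bsub>G\<^esub>" for n x
    using L.birkhoff_tilt[OF \<open>\<psi> \<in> _\<close> that(1), of \<phi> \<xi> n] that(2)
    by (simp add: f_def inner_d_def L.lattice_proj_one)
  \<comment> \<open>One statement for all four families. Their weight is bounded below only through
    a map \<open>\<tau>\<close> that completes return words at \<open>c\<close> to members of
    \<open>\<Lambda> n\<close>.\<close>
  have main: "weak_star_converges S A (\<lambda>n. averaged_measure S A \<phi> n (\<Lambda> n)) \<mu>"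
    if \<Lambda>: "\<And>n. \<Lambda> n \<subseteq> {x\<in>?X. cocycle G \<psi> n x = \<one>\<^bsub>G\<^esub>}"
      and inj: "\<And>n x y. n \<ge> 1 \<Longrightarrow> x \<in> \<Lambda> n \<Longrightarrow> y \<in> \<Lambda> n \<Longrightarrow> (\<And>i. i < n \<Longrightarrow> x i = y i) \<Longrightarrow> x = y"
      and c: "c \<in> S"
      and \<tau>: "\<And>n x. n \<ge> 1 \<Longrightarrow> x \<in> ?X \<Longrightarrow> x 0 = c \<Longrightarrow> x n = c \<Longrightarrow> cocycle G \<psi> n x = \<one>\<^bsub>G\<^esub> \<Longrightarrow>
         \<tau> n x \<in> \<Lambda> n \<and> (\<forall>i<n. \<tau> n x i = x i)" for \<Lambda> c \<tau>
  proof (rule M.averaged_measures_converge[OF W(1-3)])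
    show "\<Lambda> n \<subseteq> ?X" for n using \<Lambda> by auto
    show "birkhoff \<phi> n x = birkhoff ?\<Phi> n x" if "x \<in> \<Lambda> n" for n x
      using \<Lambda>[of n] that by (intro zero) auto
    fix s assume "s < P"
    then obtain \<kappa> n\<^sub>0 where \<kappa>: "\<kappa> > 0" "\<And>n. n \<ge> n\<^sub>0 \<Longrightarrow> E.mass n c c \<one>\<^bsub>G\<^esub> (\<kappa> * exp (s * real n))"
      using growth[OF c] by blast
    have "ennreal ((exp (- D) * \<kappa>) * exp (s * real n)) \<le> partition_sum \<phi> n (\<Lambda> n)" if n: "n \<ge> max 1 n\<^sub>0" for n
    proof -
      have "ennreal (exp (- D) * (\<kappa> * exp (s * real n))) \<le> partition_sum \<phi> n (\<Lambda> n)"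
      proof (rule E.mass_le_partition_sum[where \<tau> = "\<tau> n"])
        show "E.mass n c c \<one>\<^bsub>G\<^esub> (\<kappa> * exp (s * real n))" using \<kappa>(2) n by simp
        show "\<Lambda> n \<subseteq> ?X" using \<Lambda> by auto
      qed (use \<tau> n in simp)
      then show ?thesis by (simp add: mult.assoc)
    qed
    then show "\<exists>\<kappa> n\<^sub>0. \<kappa> > 0 \<and> (\<forall>n\<ge>n\<^sub>0. ennreal (\<kappa> * exp (s * real n)) \<le> partition_sum \<phi> n (\<Lambda> n))"
      using \<kappa>(1) by (intro exI[of _ "exp (- D) * \<kappa>"] exI[of _ "max 1 n\<^sub>0"]) auto
  qed (use W(4) inj in blast)+
  have cyl: "cylinder S A [c] = {x\<in>?X. x 0 = c}" for c by (auto simp: cylinder_def)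
  have coc: "cocycle G \<psi> n y = \<one>\<^bsub>G\<^esub>" if "cocycle G \<psi> n x = \<one>\<^bsub>G\<^esub>" "\<And>i. i < n \<Longrightarrow> y i = x i" for n x y
    using that cocycle_cong[of n y x G \<psi>] by simp
  have per: "periodize n x \<in> ?X" "periodize n x 0 = x 0" "cocycle G \<psi> n (periodize n x) = \<one>\<^bsub>G\<^esub>"
    if "n \<ge> 1" "x \<in> ?X" "x n = x 0" "cocycle G \<psi> n x = \<one>\<^bsub>G\<^esub>" for n x
    using periodize_in[OF that(2,3,1)] coc[OF that(4), of "periodize n x"] that(1) by auto
  have gra: "graft n x z \<in> ?X" "graft n x z 0 = x 0" "cocycle G \<psi> n (graft n x z) = \<one>\<^bsub>G\<^esub>"
    if "x \<in> ?X" "z \<in> ?X" "x n = z 0" "cocycle G \<psi> n x = \<one>\<^bsub>G\<^esub>" for n x z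
    using graft_in[OF that(1-3)] graft_0[of x n z] that(3) coc[OF that(4), of "graft n x z"] by auto
  \<comment> \<open>\<open>Y\<close> will be the whole shift or the cylinder of \<open>a\<close>;
    return words at \<open>a\<close> alone already give enough weight in both cases.\<close>
  have periodic: "weak_star_converges S A (\<lambda>n. averaged_measure S A \<phi> n
      {x \<in> Y. (left_shift ^^ n) x = x \<and> cocycle G \<psi> n x = \<one>\<^bsub>G\<^esub>}) \<mu>"
    if Y: "cylinder S A [a] \<subseteq> Y" "Y \<subseteq> ?X" for Y
  proof (rule main[of _ a periodize, OF _ _ \<open>a \<in> S\<close>])
    fix n and x y :: "nat \<Rightarrow> 's"
    assume "n \<ge> 1" "x \<in> {x \<in> Y. (left_shift ^^ n) x = x \<and> cocycle G \<psi> n x = \<one>\<^bsub>G\<^esub>}"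
      "y \<in> {x \<in> Y. (left_shift ^^ n) x = x \<and> cocycle G \<psi> n x = \<one>\<^bsub>G\<^esub>}" "\<And>i. i < n \<Longrightarrow> x i = y i"
    then show "x = y" by (intro periodic_eqI[of n x y]) auto
  qed (use per Y in \<open>auto simp: cyl\<close>)
  \<comment> \<open>The base state is the first letter of the tail \<open>z\<close>, so that a
    return word can be followed by \<open>z\<close>; for \<open>z\<close> in the cylinder of
    \<open>a\<close> it is \<open>a\<close> itself.\<close>
  have preimage: "weak_star_converges S A (\<lambda>n. averaged_measure S A \<phi> n
      {x \<in> Y. (left_shift ^^ n) x = z \<and> cocycle G \<psi> n x = \<one>\<^bsub>G\<^esub>}) \<mu>"
    if z: "z \<in> ?X" and Y: "cylinder S A [z 0] \<subseteq> Y" "Y \<subseteq> ?X" for z Y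
  proof (rule main[of _ "z 0" "\<lambda>n x. graft n x z"])
    show "z 0 \<in> S" using z by (auto simp: markov_shift_def)
    fix n and x y :: "nat \<Rightarrow> 's"
    assume "x \<in> {x \<in> Y. (left_shift ^^ n) x = z \<and> cocycle G \<psi> n x = \<one>\<^bsub>G\<^esub>}"
      "y \<in> {x \<in> Y. (left_shift ^^ n) x = z \<and> cocycle G \<psi> n x = \<one>\<^bsub>G\<^esub>}" "\<And>i. i < n \<Longrightarrow> x i = y i"
    then show "x = y" by (intro preimage_eqI[of n x z y]) auto
  qed (use gra z Y in \<open>auto simp: cyl\<close>)
  have cyl_sub: "cylinder S A w \<subseteq> ?X" for w by (auto simp: cylinder_def)
  show ?thesis
  proof (intro conjI ballI)
    fix z assume z: "z \<in> cylinder S A [a]"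
    then have "z \<in> ?X" "z 0 = a" by (auto simp: cyl)
    then show "weak_star_converges S A (\<lambda>n. averaged_measure S A \<phi> n
        {x \<in> cylinder S A [a]. (left_shift ^^ n) x = z \<and> cocycle G \<psi> n x = \<one>\<^bsub>G\<^esub>}) \<mu>"
      by (intro preimage) (auto simp: cyl)
  qed (intro periodic preimage cyl_sub order_refl; assumption)+
qed

end
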